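(* Let $(M^n,g)$ be a BKL manifold of complex dimension $n\geq 4$. If its $B$-rank is $r_B=n-1$, then $g$ is Bismut flat (that is, $R^b=0$) and full (that is, $A>0$).
   Context: Manifolds are connected. Let $(M^n,g)$ be a Hermitian manifold of complex dimension $n$ with complex structure $J$; $g$ is extended complex-bilinearly to $TM\otimes\mathbb C=T^{1,0}M\oplus T^{0,1}M$. The Bismut connection $\nabla^b$ is the unique connection with $\nabla^b g=0$, $\nabla^b J=0$ and totally skew-symmetric torsion. $(M^n,g)$ is Bismut Kähler-like (BKL) if the curvature $R^b(x,y,z,w)=g(\nabla^b_x\nabla^b_yz-\nabla^b_y\nabla^b_xz-\nabla^b_{[x,y]}z,\,w)$ satisfies $R^b(X,Y,Z,\overline W)=0$ and $R^b(X,\overline Y,Z,\overline W)=R^b(Z,\overline Y,X,\overline W)$ for all type $(1,0)$ vectors $X,Y,Z,W$. Let $T^c$ be the torsion of the Chern connection. Under a local unitary frame $e=(e_1,\dots,e_n)$ of $T^{1,0}M$ (so $g(e_i,\overline{e}_j)=\delta_{ij}$), write $T^c(e_i,e_j)=2\sum_k T^k_{ij}e_k$, and set $$A_{i\overline j}=\sum_{q,k}T^q_{ik}\overline{T^q_{jk}},\quad B_{i\overline j}=\sum_{q,k}T^j_{qk}\overline{T^i_{qk}}.$$ These are positive semi-definite Hermitian tensors. On BKL manifolds $\nabla^bT^c=0$, so $A,B$ are $\nabla^b$-parallel and have constant eigenvalues. $A>0$ means $A$ is positive definite, and the BKL manifold is then called full. The $B$-rank $r_B$ is the rank of $B$ (number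 of positive eigenvalues). *)

theory Defs
  imports "HOL-Analysis.Analysis"
begin

section \<open>Smooth functions\<close>

text \<open>On an open set \<open>S\<close> this is \<open>C\<^sup>\<infinity>\<close>: all iterated directional derivatives exist and are
  differentiable on \<open>S\<close>. The values outside \<open>S\<close> are irrelevant.\<close>

coinductive smooth_on ::
  "'v::euclidean_space set \<Rightarrow> ('v \<Rightarrow> 'w::real_normed_vector) \<Rightarrow> bool" for S where
  "\<lbrakk>\<And>x. x \<in> S \<Longrightarrow> f differentiable (at x);
    \<And>v. smooth_on S (\<lambda>x. frechet_derivative f (at x) v)\<rbrakk> \<Longrightarrow> smooth_on S f"


section \<open>Complex manifolds\<close>

text \<open>A chart is a pair of a domain and a coordinate map. The real tangent space at a point of
  the domain is identified, by means of the chart, with the real vector space underlying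
  \<open>complex^'n\<close>, and the complex structure with multiplication by the imaginary unit. A tensor
  field or a connection is a family of coordinate expressions, one for each chart of the atlas,
  subject to the transformation law; the coordinate expression for the chart \<open>c\<close> is a function
  on \<open>chart_img c\<close>.\<close>

type_synonym ('a, 'n) chart = "'a set \<times> ('a \<Rightarrow> complex^'n)"

definition chart_img :: "('a, 'n::finite) chart \<Rightarrow> (complex^'n) set" where
  "chart_img c = snd c ` fst c"

definition overlap :: "('a, 'n::finite) chart \<Rightarrow> ('a, 'n) chart \<Rightarrow> (complex^'n) set" where
  "overlap c d = snd c ` (fst c \<inter> fst d)"

definition transition :: "('a, 'n::finite) chart \<Rightarrow> ('a, 'n) chart \<Rightarrow> complex^'n \<Rightarrow> complex^'n" where
  "transition c d z = snd d (inv_into (fst c) (snd c) z)"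

definition Jop :: "complex^'n::finite \<Rightarrow> complex^'n" where
  "Jop v = \<i> *s v"

definition holomorphic_map_on :: "(complex^'n::finite) set \<Rightarrow> (complex^'n \<Rightarrow> complex^'n) \<Rightarrow> bool" where
  "holomorphic_map_on S f \<longleftrightarrow>
     (\<forall>z\<in>S. \<exists>D. (f has_derivative D) (at z) \<and> (\<forall>v. D (Jop v) = Jop (D v)))"

definition complex_manifold :: "'a topology \<Rightarrow> ('a, 'n::finite) chart set \<Rightarrow> bool" where
  "complex_manifold X \<A> \<longleftrightarrow>
     Hausdorff_space X \<and> second_countable X \<and> connected_space X \<and>
     (\<Union>c\<in>\<A>. fst c) = topspace X \<and>
     (\<forall>c\<in>\<A>. openin X (fst c) \<and> open (chart_img c) \<and>
        homeomorphic_map (subtopology X (fst c)) (top_of_set (chart_img c)) (snd c)) \<and>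
     (\<forall>c\<in>\<A>. \<forall>d\<in>\<A>. holomorphic_map_on (overlap c d) (transition c d))"


section \<open>Hermitian metrics and connections\<close>

type_synonym 'n local_metric = "complex^'n \<Rightarrow> complex^'n \<Rightarrow> complex^'n \<Rightarrow> real"

definition hermitian_metric ::
  "('a, 'n::finite) chart set \<Rightarrow> (('a, 'n) chart \<Rightarrow> 'n local_metric) \<Rightarrow> bool" where
  "hermitian_metric \<A> g \<longleftrightarrow>
     (\<forall>c\<in>\<A>. \<forall>z\<in>chart_img c.
        bilinear (g c z) \<and>
        (\<forall>u v. g c z u v = g c z v u) \<and>
        (\<forall>u. u \<noteq> 0 \<longrightarrow> g c z u u > 0) \<and>
        (\<forall>u v. g c z (Jop u) (Jop v) = g c z u v)) \<and>
     (\<forall>c\<in>\<A>. \<forall>u v. smooth_on (chart_img c) (\<lambda>z. g c z u v)) \<and>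
     (\<forall>c\<in>\<A>. \<forall>d\<in>\<A>. \<forall>z\<in>overlap c d. \<forall>u v.
        g c z u v =
          (let D = frechet_derivative (transition c d) (at z)
           in g d (transition c d z) (D u) (D v)))"

definition hermitian_manifold ::
  "'a topology \<Rightarrow> ('a, 'n::finite) chart set \<Rightarrow> (('a, 'n) chart \<Rightarrow> 'n local_metric) \<Rightarrow> bool" where
  "hermitian_manifold X \<A> g \<longleftrightarrow> complex_manifold X \<A> \<and> hermitian_metric \<A> g"

text \<open>A connection is given in each chart by its real Christoffel symbols: the covariant
  derivative of \<open>Y\<close> along \<open>X\<close> is \<open>DY(X) + \<Gamma>(X,Y)\<close>.\<close>

type_synonym 'n local_conn = "complex^'n \<Rightarrow> complex^'n \<Rightarrow> complex^'n \<Rightarrow> complex^'n"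

text \<open>The last clause is the transformation law of Christoffel symbols under the transition
  map \<open>\<tau>\<close>: it says that the pushforward \<open>D\<tau>\<close> takes covariant derivatives to covariant
  derivatives.\<close>

definition connection ::
  "('a, 'n::finite) chart set \<Rightarrow> (('a, 'n) chart \<Rightarrow> 'n local_conn) \<Rightarrow> bool" where
  "connection \<A> \<Gamma> \<longleftrightarrow>
     (\<forall>c\<in>\<A>. \<forall>z\<in>chart_img c. bilinear (\<Gamma> c z)) \<and>
     (\<forall>c\<in>\<A>. \<forall>u v. smooth_on (chart_img c) (\<lambda>z. \<Gamma> c z u v)) \<and>
     (\<forall>c\<in>\<A>. \<forall>d\<in>\<A>. \<forall>z\<in>overlap c d. \<forall>u v.
        (let \<tau> = transition c d; D = (\<lambda>w. frechet_derivative \<tau> (at w))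
         in D z (\<Gamma> c z u v) =
              frechet_derivative (\<lambda>w. D w v) (at z) u + \<Gamma> d (\<tau> z) (D z u) (D z v)))"

type_synonym 'n vfield = "complex^'n \<Rightarrow> complex^'n"

definition cov :: "'n::finite local_conn \<Rightarrow> 'n vfield \<Rightarrow> 'n vfield \<Rightarrow> 'n vfield" where
  "cov \<Gamma> X Y = (\<lambda>z. frechet_derivative Y (at z) (X z) + \<Gamma> z (X z) (Y z))"

definition lie :: "'n::finite vfield \<Rightarrow> 'n vfield \<Rightarrow> 'n vfield" where
  "lie X Y = (\<lambda>z. frechet_derivative Y (at z) (X z) - frechet_derivative X (at z) (Y z))"

text \<open>The expressions below are tensorial, so each of them is evaluated on tangent vectors at
  \<open>z\<close> by extending these to the vector fields with constant coordinates.\<close>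

definition torsion ::
  "'n::finite local_conn \<Rightarrow> complex^'n \<Rightarrow> complex^'n \<Rightarrow> complex^'n \<Rightarrow> complex^'n" where
  "torsion \<Gamma> z x y =
     (let X = (\<lambda>_. x); Y = (\<lambda>_. y) in cov \<Gamma> X Y z - cov \<Gamma> Y X z - lie X Y z)"

definition curv_op ::
  "'n::finite local_conn \<Rightarrow> complex^'n \<Rightarrow> complex^'n \<Rightarrow> complex^'n \<Rightarrow> complex^'n \<Rightarrow> complex^'n" where
  "curv_op \<Gamma> z x y w =
     (let X = (\<lambda>_. x); Y = (\<lambda>_. y); W = (\<lambda>_. w)
      in cov \<Gamma> X (cov \<Gamma> Y W) z - cov \<Gamma> Y (cov \<Gamma> X W) z - cov \<Gamma> (lie X Y) W z)"

definition curv ::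
  "'n::finite local_metric \<Rightarrow> 'n local_conn \<Rightarrow> complex^'n \<Rightarrow>
   complex^'n \<Rightarrow> complex^'n \<Rightarrow> complex^'n \<Rightarrow> complex^'n \<Rightarrow> real" where
  "curv G \<Gamma> p x y z w = G p (curv_op \<Gamma> p x y z) w"

definition metric_compatible ::
  "('a, 'n::finite) chart set \<Rightarrow> (('a, 'n) chart \<Rightarrow> 'n local_metric) \<Rightarrow>
   (('a, 'n) chart \<Rightarrow> 'n local_conn) \<Rightarrow> bool" where
  "metric_compatible \<A> g \<Gamma> \<longleftrightarrow>
     (\<forall>c\<in>\<A>. \<forall>z\<in>chart_img c. \<forall>x u v.
        frechet_derivative (\<lambda>w. g c w u v) (at z) x =
          g c z (cov (\<Gamma> c) (\<lambda>_. x) (\<lambda>_. u) z) v + g c z u (cov (\<Gamma> c) (\<lambda>_. x) (\<lambda>_. v) z))"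

definition J_compatible ::
  "('a, 'n::finite) chart set \<Rightarrow> (('a, 'n) chart \<Rightarrow> 'n local_conn) \<Rightarrow> bool" where
  "J_compatible \<A> \<Gamma> \<longleftrightarrow>
     (\<forall>c\<in>\<A>. \<forall>z\<in>chart_img c. \<forall>x v.
        cov (\<Gamma> c) (\<lambda>_. x) (\<lambda>_. Jop v) z = Jop (cov (\<Gamma> c) (\<lambda>_. x) (\<lambda>_. v) z))"

definition bismut_connection ::
  "('a, 'n::finite) chart set \<Rightarrow> (('a, 'n) chart \<Rightarrow> 'n local_metric) \<Rightarrow>
   (('a, 'n) chart \<Rightarrow> 'n local_conn) \<Rightarrow> bool" where
  "bismut_connection \<A> g \<Gamma> \<longleftrightarrow>
     connection \<A> \<Gamma> \<and> metric_compatible \<A> g \<Gamma> \<and> J_compatible \<A> \<Gamma> \<and>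
     (\<forall>c\<in>\<A>. \<forall>z\<in>chart_img c. \<forall>x y w.
        g c z (torsion (\<Gamma> c) z x y) w = - g c z (torsion (\<Gamma> c) z y x) w \<and>
        g c z (torsion (\<Gamma> c) z x y) w = - g c z (torsion (\<Gamma> c) z x w) y)"


section \<open>The complexified tangent space\<close>

text \<open>The pair \<open>(u, v)\<close> stands for \<open>u + \<surd>-1 v\<close> with real tangent vectors \<open>u\<close> and \<open>v\<close>. This
  \<open>\<surd>-1\<close> is not \<open>Jop\<close>.\<close>

type_synonym 'n ctan = "(complex^'n) \<times> (complex^'n)"

definition ctan_scale :: "complex \<Rightarrow> 'n::finite ctan \<Rightarrow> 'n ctan" where
  "ctan_scale a X = (Re a *\<^sub>R fst X - Im a *\<^sub>R snd X, Im a *\<^sub>R fst X + Re a *\<^sub>R snd X)"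

definition ctan_cnj :: "'n::finite ctan \<Rightarrow> 'n ctan" where
  "ctan_cnj X = (fst X, - snd X)"

definition type10 :: "'n::finite ctan \<Rightarrow> bool" where
  "type10 X \<longleftrightarrow> (Jop (fst X), Jop (snd X)) = ctan_scale \<i> X"

text \<open>Complex-linear extension of real-linear maps on the tangent space, with values in the
  complex numbers and in the complexified tangent space.\<close>

definition cext :: "(complex^'n \<Rightarrow> complex) \<Rightarrow> 'n::finite ctan \<Rightarrow> complex" where
  "cext f X = f (fst X) + \<i> * f (snd X)"

definition cext_vec :: "(complex^'n \<Rightarrow> 'n ctan) \<Rightarrow> 'n::finite ctan \<Rightarrow> 'n ctan" where
  "cext_vec f X = f (fst X) + ctan_scale \<i> (f (snd X))"

definition metric_C :: "'n::finite local_metric \<Rightarrow> complex^'n \<Rightarrow> 'n ctan \<Rightarrow> 'n ctan \<Rightarrow> complex" where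
  "metric_C G p X Y = cext (\<lambda>x. cext (\<lambda>y. complex_of_real (G p x y)) Y) X"

definition torsion_C :: "'n::finite local_conn \<Rightarrow> complex^'n \<Rightarrow> 'n ctan \<Rightarrow> 'n ctan \<Rightarrow> 'n ctan" where
  "torsion_C \<Gamma> p X Y = cext_vec (\<lambda>x. cext_vec (\<lambda>y. (torsion \<Gamma> p x y, 0)) Y) X"

definition curv_C ::
  "'n::finite local_metric \<Rightarrow> 'n local_conn \<Rightarrow> complex^'n \<Rightarrow>
   'n ctan \<Rightarrow> 'n ctan \<Rightarrow> 'n ctan \<Rightarrow> 'n ctan \<Rightarrow> complex" where
  "curv_C G \<Gamma> p X Y Z W =
     cext (\<lambda>x. cext (\<lambda>y. cext (\<lambda>z. cext (\<lambda>w. complex_of_real (curv G \<Gamma> p x y z w)) W) Z) Y) X"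

text \<open>The Chern connection is the Hermitian connection whose torsion has no component of type
  \<open>(1,1)\<close>.\<close>

definition chern_connection ::
  "('a, 'n::finite) chart set \<Rightarrow> (('a, 'n) chart \<Rightarrow> 'n local_metric) \<Rightarrow>
   (('a, 'n) chart \<Rightarrow> 'n local_conn) \<Rightarrow> bool" where
  "chern_connection \<A> g \<Gamma> \<longleftrightarrow>
     connection \<A> \<Gamma> \<and> metric_compatible \<A> g \<Gamma> \<and> J_compatible \<A> \<Gamma> \<and>
     (\<forall>c\<in>\<A>. \<forall>z\<in>chart_img c. \<forall>X Y. type10 X \<and> type10 Y \<longrightarrow>
        torsion_C (\<Gamma> c) z X (ctan_cnj Y) = 0)"

definition bismut_kaehler_like ::
  "('a, 'n::finite) chart set \<Rightarrow> (('a, 'n) chart \<Rightarrow> 'n local_metric) \<Rightarrow>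
   (('a, 'n) chart \<Rightarrow> 'n local_conn) \<Rightarrow> bool" where
  "bismut_kaehler_like \<A> g \<Gamma>b \<longleftrightarrow>
     (\<forall>c\<in>\<A>. \<forall>p\<in>chart_img c. \<forall>X Y Z W.
        type10 X \<and> type10 Y \<and> type10 Z \<and> type10 W \<longrightarrow>
          curv_C (g c) (\<Gamma>b c) p X Y Z (ctan_cnj W) = 0 \<and>
          curv_C (g c) (\<Gamma>b c) p X (ctan_cnj Y) Z (ctan_cnj W) =
            curv_C (g c) (\<Gamma>b c) p Z (ctan_cnj Y) X (ctan_cnj W))"

definition bismut_flat ::
  "('a, 'n::finite) chart set \<Rightarrow> (('a, 'n) chart \<Rightarrow> 'n local_metric) \<Rightarrow>
   (('a, 'n) chart \<Rightarrow> 'n local_conn) \<Rightarrow> bool" where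
  "bismut_flat \<A> g \<Gamma>b \<longleftrightarrow>
     (\<forall>c\<in>\<A>. \<forall>p\<in>chart_img c. \<forall>x y z w. curv (g c) (\<Gamma>b c) p x y z w = 0)"


section \<open>The tensors A and B\<close>

definition unitary_frame :: "'n::finite local_metric \<Rightarrow> complex^'n \<Rightarrow> ('n \<Rightarrow> 'n ctan) \<Rightarrow> bool" where
  "unitary_frame G p e \<longleftrightarrow>
     (\<forall>i. type10 (e i)) \<and>
     (\<forall>i j. metric_C G p (e i) (ctan_cnj (e j)) = (if i = j then 1 else 0))"

text \<open>\<open>torsion_coeff \<Gamma> p e k i j\<close> is \<open>T\<^sup>k\<^sub>i\<^sub>j\<close>.\<close>

definition torsion_coeff ::
  "'n::finite local_conn \<Rightarrow> complex^'n \<Rightarrow> ('n \<Rightarrow> 'n ctan) \<Rightarrow> 'n \<Rightarrow> 'n \<Rightarrow> 'n \<Rightarrow> complex" where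
  "torsion_coeff \<Gamma> p e k i j =
     (THE t :: complex^'n.
        torsion_C \<Gamma> p (e i) (e j) = (\<Sum>l\<in>UNIV. ctan_scale (2 * t $ l) (e l))) $ k"

definition A_matrix :: "'n::finite local_conn \<Rightarrow> complex^'n \<Rightarrow> ('n \<Rightarrow> 'n ctan) \<Rightarrow> complex^'n^'n" where
  "A_matrix \<Gamma> p e =
     (\<chi> i j. \<Sum>q\<in>UNIV. \<Sum>k\<in>UNIV. torsion_coeff \<Gamma> p e q i k * cnj (torsion_coeff \<Gamma> p e q j k))"

definition B_matrix :: "'n::finite local_conn \<Rightarrow> complex^'n \<Rightarrow> ('n \<Rightarrow> 'n ctan) \<Rightarrow> complex^'n^'n" where
  "B_matrix \<Gamma> p e =
     (\<chi> i j. \<Sum>q\<in>UNIV. \<Sum>k\<in>UNIV. torsion_coeff \<Gamma> p e j q k * cnj (torsion_coeff \<Gamma> p e i q k))"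

definition pos_def_hermitian :: "complex^'n^'n::finite \<Rightarrow> bool" where
  "pos_def_hermitian M \<longleftrightarrow>
     (\<forall>i j. M $ j $ i = cnj (M $ i $ j)) \<and>
     (\<forall>v :: complex^'n. v \<noteq> 0 \<longrightarrow>
        Re (\<Sum>i\<in>UNIV. \<Sum>j\<in>UNIV. M $ i $ j * v $ i * cnj (v $ j)) > 0)"

text \<open>A change of unitary frame conjugates the matrices of \<open>A\<close> and \<open>B\<close> by a unitary matrix, so
  rank and positivity do not depend on the frame, of which one exists at every point.\<close>

definition full ::
  "('a, 'n::finite) chart set \<Rightarrow> (('a, 'n) chart \<Rightarrow> 'n local_metric) \<Rightarrow>
   (('a, 'n) chart \<Rightarrow> 'n local_conn) \<Rightarrow> bool" where
  "full \<A> g \<Gamma>c \<longleftrightarrow>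
     (\<forall>c\<in>\<A>. \<forall>p\<in>chart_img c. \<forall>e. unitary_frame (g c) p e \<longrightarrow>
        pos_def_hermitian (A_matrix (\<Gamma>c c) p e))"

definition has_B_rank ::
  "('a, 'n::finite) chart set \<Rightarrow> (('a, 'n) chart \<Rightarrow> 'n local_metric) \<Rightarrow>
   (('a, 'n) chart \<Rightarrow> 'n local_conn) \<Rightarrow> nat \<Rightarrow> bool" where
  "has_B_rank \<A> g \<Gamma>c r \<longleftrightarrow>
     (\<forall>c\<in>\<A>. \<forall>p\<in>chart_img c. \<forall>e. unitary_frame (g c) p e \<longrightarrow>
        rank (B_matrix (\<Gamma>c c) p e) = r)"

end

theory Submission
  imports Defs "HOL-Computational_Algebra.Fundamental_Theorem_Algebra"
begin

text \<open>Why the theorem holds. Everything is local, so one chart is enough. Let \<open>\<nabla>\<close> be the Bismut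
  connection, \<open>T\<close> its torsion, \<open>H(x,y,w) = g(T(x,y),w)\<close> the torsion three-form, \<open>P = \<nabla>H\<close>, and
  \<open>\<sigma>\<close> the four-form obtained by cyclic summation from \<open>g(T(x,y),T(w,v))\<close>.

  \<^item> The two curvature conditions make the cyclic sum of \<open>R(x,y)w\<close> vanish (\<open>cyclic_Rop\<close>). The
    first Bianchi identity then forces \<open>P\<close> to be totally skew with \<open>3P = -\<sigma>\<close> (\<open>three_P\<close>), and since
    \<open>\<nabla>\<close> preserves type, \<open>P\<close> has type \<open>(2,2)\<close>.

  \<^item> \<open>P = 0\<close>. The second covariant derivative of \<open>H\<close> can be computed in two ways: by
    differentiating \<open>3P = -\<sigma>\<close>, and, in two directions of type \<open>(1,0)\<close>, where the curvature vanishes,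
    from the Ricci identity and the skewness of \<open>P\<close>. Comparing them gives a relation
    bilinear in \<open>T\<close> and \<open>P\<close> (\<open>tc_cubic\<close>). Its traces show that the Lee form \<open>\<eta>\<close> annihilates the Ricci type
    contraction \<open>\<rho>\<close> of \<open>P\<close>. Differentiating this along the Lee vector field \<open>E\<close>, whose derivative
    is \<open>\<rho>\<close>, gives \<open>|\<nabla>E|\<^sup>2 = 0\<close>, hence \<open>\<rho> = 0\<close> (\<open>rho_vanishes\<close>). With \<open>\<rho> = 0\<close>
    the same traces give \<open>|P|\<^sup>2 = 0\<close> (\<open>p_zero\<close>).

  \<^item> Now \<open>\<nabla>T = 0\<close> and \<open>\<sigma> = 0\<close>: at each point \<open>T\<close> is a Lie bracket on the tangent space with an
    invariant metric, the \<open>(1,0)\<close> vectors form a complex subalgebra \<open>V\<close>, and the curvature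
    operators are derivations. The kernel of \<open>B\<close> is the orthogonal complement of \<open>[V,V]\<close>, so \<open>r\<^sub>B = n - 1\<close>
    says that it is spanned by one vector \<open>v\<close>. The operator \<open>ad v\<close> is normal on \<open>V\<close>; in a unitary
    eigenframe \<open>V\<close> splits into weight spaces of weights \<open>\<lambda>\<^sub>j\<close>. The trace of the Jacobi identity says
    that \<open>B\<close> is diagonal with entries \<open>2 Re (\<lambda>\<^sub>j s)\<close> for a constant \<open>s\<close>, so all weights other than
    that of \<open>v\<close> lie in one open half plane (\<open>ell_pos\<close>). This positivity replaces the root theory of
    compact Lie algebras: weights are distinct (\<open>lam_distinct\<close>), a derivation with the symmetries of
    a Kaehler curvature can only act on one weight space at a time, and if it did not vanish there, the
    at least two remaining weights would lie on a common ray, which is impossible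
    (\<open>weights_not_on_ray\<close>; here \<open>n \<ge> 4\<close> enters). So \<open>R = 0\<close>, and a vector commuting with all of
    \<open>V\<close> is zero, which is the positivity of \<open>A\<close>.

  Finally the torsions of the Chern and Bismut connections on \<open>V\<close> are opposite
  (\<open>chern_torsion_eq_minus_bismut_torsion\<close>), which translates \<open>A\<close> and \<open>B\<close>.\<close>

abbreviation sum_UNIV :: "('a::finite \<Rightarrow> 'b::comm_monoid_add) \<Rightarrow> 'b" (binder "\<Sum>\<^sub>U " 10) where
  "sum_UNIV f \<equiv> sum f UNIV"

section \<open>Symmetry of second derivatives and families of linear maps\<close>

lemma second_difference_mean_value:
  fixes f :: "'v::real_normed_vector \<Rightarrow> real"
  assumes f1: "\<And>z. z \<in> ball p d \<Longrightarrow> (f has_derivative f1 z) (at z)"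
    and f2: "\<And>z. z \<in> ball p d \<Longrightarrow> ((\<lambda>z. f1 z u) has_derivative f2 z) (at z)"
    and h: "h > 0" "h * (norm u + norm v) < d"
  shows "\<exists>z\<in>cball p (h * (norm u + norm v)).
    f (p + h *\<^sub>R u + h *\<^sub>R v) - f (p + h *\<^sub>R u) - f (p + h *\<^sub>R v) + f p = h * h * f2 z v"
proof -
  have bound: "norm (s *\<^sub>R u + t *\<^sub>R v) \<le> h * (norm u + norm v)"
    if "0 \<le> s" "s \<le> h" "0 \<le> t" "t \<le> h" for s t
  proof -
    have "norm (s *\<^sub>R u + t *\<^sub>R v) \<le> s * norm u + t * norm v"
      using norm_triangle_ineq[of "s *\<^sub>R u" "t *\<^sub>R v"] that by simp
    also have "\<dots> \<le> h * norm u + h * norm v"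
      using that by (intro add_mono mult_right_mono) auto
    finally show ?thesis by (simp add: algebra_simps)
  qed
  have inb: "p + s *\<^sub>R u + t *\<^sub>R v \<in> ball p d" if "0 \<le> s" "s \<le> h" "0 \<le> t" "t \<le> h" for s t
    using bound[OF that] h by (subst mem_ball, subst dist_commute) (simp add: dist_norm add.assoc)
  have lin: "((\<lambda>s. q + s *\<^sub>R a + r) has_derivative (\<lambda>x. x *\<^sub>R a)) (at s)"
    and lin': "((\<lambda>s. q + s *\<^sub>R a) has_derivative (\<lambda>x. x *\<^sub>R a)) (at s)" for q a r :: 'v and s
    by (auto intro!: derivative_eq_intros)
  have d1: "((\<lambda>s. f (p + s *\<^sub>R u + t *\<^sub>R v)) has_derivative (\<lambda>x. f1 (p + s *\<^sub>R u + t *\<^sub>R v) (x *\<^sub>R u))) (at s)"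
    if "0 \<le> s" "s \<le> h" "0 \<le> t" "t \<le> h" for s t
    by (rule has_derivative_compose[where f = "\<lambda>s. p + s *\<^sub>R u + t *\<^sub>R v" and
          f' = "\<lambda>x. x *\<^sub>R u" and g = f and g' = "f1 (p + s *\<^sub>R u + t *\<^sub>R v)"])
      (intro lin f1[OF inb[OF that]])+
  have d1': "((\<lambda>s. f (p + s *\<^sub>R u + t *\<^sub>R v)) has_real_derivative f1 (p + s *\<^sub>R u + t *\<^sub>R v) u) (at s)"
    if "0 \<le> s" "s \<le> h" "0 \<le> t" "t \<le> h" for s t
    using d1[OF that] linear_cmul[OF has_derivative_linear[OF f1[OF inb[OF that]]]]
    by (simp add: has_field_derivative_def mult_commute_abs)
  obtain s where s: "0 < s" "s < h" and
    eq1: "(f (p + h *\<^sub>R u + h *\<^sub>R v) - f (p + h *\<^sub>R u + 0 *\<^sub>R v)) - (f (p + 0 *\<^sub>R u + h *\<^sub>R v) - f (p + 0 *\<^sub>R u + 0 *\<^sub>R v))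
      = (h - 0) * (f1 (p + s *\<^sub>R u + h *\<^sub>R v) u - f1 (p + s *\<^sub>R u + 0 *\<^sub>R v) u)"
    using MVT2[OF h(1), of "\<lambda>s. f (p + s *\<^sub>R u + h *\<^sub>R v) - f (p + s *\<^sub>R u + 0 *\<^sub>R v)"
        "\<lambda>s. f1 (p + s *\<^sub>R u + h *\<^sub>R v) u - f1 (p + s *\<^sub>R u + 0 *\<^sub>R v) u"]
      d1'[of _ h] d1'[of _ 0] h by (force intro: DERIV_diff)
  have d2: "((\<lambda>t. f1 (p + s *\<^sub>R u + t *\<^sub>R v) u) has_real_derivative f2 (p + s *\<^sub>R u + t *\<^sub>R v) v) (at t)"
    if "0 \<le> t" "t \<le> h" for t
  proof -
    have i: "p + s *\<^sub>R u + t *\<^sub>R v \<in> ball p d" using inb that s by simp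
    have "((\<lambda>t. f1 (p + s *\<^sub>R u + t *\<^sub>R v) u) has_derivative (\<lambda>x. f2 (p + s *\<^sub>R u + t *\<^sub>R v) (x *\<^sub>R v))) (at t)"
      by (rule has_derivative_compose[where f = "\<lambda>t. p + s *\<^sub>R u + t *\<^sub>R v" and
            f' = "\<lambda>x. x *\<^sub>R v" and g = "\<lambda>z. f1 z u" and g' = "f2 (p + s *\<^sub>R u + t *\<^sub>R v)"])
        (intro lin' f2[OF i])+
    then show ?thesis
      using linear_cmul[OF has_derivative_linear[OF f2[OF i]]]
      by (simp add: has_field_derivative_def mult_commute_abs)
  qed
  obtain t where t: "0 < t" "t < h" and
    eq2: "f1 (p + s *\<^sub>R u + h *\<^sub>R v) u - f1 (p + s *\<^sub>R u + 0 *\<^sub>R v) u = (h - 0) * f2 (p + s *\<^sub>R u + t *\<^sub>R v) v"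
    using MVT2[OF h(1) d2] by blast
  have "p + s *\<^sub>R u + t *\<^sub>R v \<in> cball p (h * (norm u + norm v))"
    using bound[of s t] s t by (subst mem_cball, subst dist_commute) (simp add: dist_norm add.assoc)
  moreover have "f (p + h *\<^sub>R u + h *\<^sub>R v) - f (p + h *\<^sub>R u) - f (p + h *\<^sub>R v) + f p
      = h * h * f2 (p + s *\<^sub>R u + t *\<^sub>R v) v"
    using eq1 eq2 by simp
  ultimately show ?thesis by blast
qed

text \<open>The second difference in the directions \<open>u\<close> and \<open>v\<close> does not change when \<open>u\<close> and \<open>v\<close> are
  exchanged, and the mean value theorem expresses it through either of the two iterated derivatives at
  points that tend to \<open>p\<close> with \<open>h\<close>.\<close>

lemma symmetric_second_derivative_real:
  fixes f :: "'v::real_normed_vector \<Rightarrow> real"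
  assumes S: "open S" "p \<in> S"
    and df: "\<And>z. z \<in> S \<Longrightarrow> (f has_derivative f' z) (at z)"
    and ddf: "\<And>z w. z \<in> S \<Longrightarrow> ((\<lambda>z. f' z w) has_derivative f'' w z) (at z)"
    and cont: "\<And>w w'. isCont (\<lambda>z. f'' w z w') p"
  shows "f'' u p v = f'' v p u"
proof -
  have "\<bar>f'' u p v - f'' v p u\<bar> \<le> e" if "e > 0" for e
  proof -
    obtain d0 where d0: "d0 > 0" "ball p d0 \<subseteq> S"
      using S open_contains_ball by blast
    obtain d1 where d1: "d1 > 0" "\<And>z. dist z p < d1 \<Longrightarrow> dist (f'' u z v) (f'' u p v) < e/2"
      using cont[of u v] \<open>e > 0\<close> unfolding continuous_at by (metis half_gt_zero continuous_at_eps_delta dist_commute cont)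
    obtain d2 where d2: "d2 > 0" "\<And>z. dist z p < d2 \<Longrightarrow> dist (f'' v z u) (f'' v p u) < e/2"
      using cont[of v u] \<open>e > 0\<close> by (metis half_gt_zero continuous_at_eps_delta)
    define d where "d = min d0 (min d1 d2)"
    have d: "d > 0" using d0 d1 d2 by (simp add: d_def)
    define h where "h = d / (norm u + norm v + 1)"
    have n: "norm u + norm v + 1 > 0" by (smt (verit) norm_ge_zero)
    have h: "h > 0" "h * (norm u + norm v) < d"
      using d n by (auto simp: h_def divide_simps)
    have h': "h * (norm v + norm u) < d" using h(2) by (simp add: add.commute)
    have sub: "ball p d \<subseteq> S" using d0 by (auto simp: d_def)
    obtain z where z: "z \<in> cball p (h * (norm u + norm v))"
      "f (p + h *\<^sub>R u + h *\<^sub>R v) - f (p + h *\<^sub>R u) - f (p + h *\<^sub>R v) + f p = h * h * f'' u z v"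
      using second_difference_mean_value[of p d f f' u "f'' u" h v] df ddf sub h by blast
    obtain z' where z': "z' \<in> cball p (h * (norm v + norm u))"
      "f (p + h *\<^sub>R v + h *\<^sub>R u) - f (p + h *\<^sub>R v) - f (p + h *\<^sub>R u) + f p = h * h * f'' v z' u"
      using second_difference_mean_value[of p d f f' v "f'' v" h u] df ddf sub h h'
      by blast
    have "h * h * f'' u z v = h * h * f'' v z' u"
      using z(2) z'(2) by (simp add: algebra_simps)
    then have "f'' u z v = f'' v z' u" using h(1) by simp
    moreover have "dist (f'' u z v) (f'' u p v) < e/2"
      using z(1) h(2) d1(2)[of z] by (simp add: d_def dist_commute)
    moreover have "dist (f'' v z' u) (f'' v p u) < e/2"
      using z'(1) h(2) d2(2)[of z'] by (simp add: d_def dist_commute add.commute)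
    ultimately show ?thesis unfolding dist_real_def by linarith
  qed
  then have "\<bar>f'' u p v - f'' v p u\<bar> \<le> 0" using field_le_epsilon[of "\<bar>f'' u p v - f'' v p u\<bar>" 0] by simp
  then show ?thesis by simp
qed

lemma smooth_on_has_derivative:
  assumes "smooth_on S f" "z \<in> S"
  shows "(f has_derivative (\<lambda>v. frechet_derivative f (at z) v)) (at z)"
proof -
  have "f differentiable (at z)"
    using assms by (cases rule: smooth_on.cases) auto
  then show ?thesis
    using frechet_derivative_works by blast
qed

lemma smooth_on_derivative:
  assumes "smooth_on S f"
  shows "smooth_on S (\<lambda>z. frechet_derivative f (at z) v)"
  using assms by (cases rule: smooth_on.cases) auto

lemma symmetric_second_derivative:
  fixes f :: "'v::euclidean_space \<Rightarrow> 'w::euclidean_space"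
  assumes S: "open S" "p \<in> S" and sm: "smooth_on S f"
  shows "frechet_derivative (\<lambda>z. frechet_derivative f (at z) u) (at p) v
       = frechet_derivative (\<lambda>z. frechet_derivative f (at z) v) (at p) u"
proof (rule euclidean_eqI)
  fix b :: 'w assume "b \<in> Basis"
  show "frechet_derivative (\<lambda>z. frechet_derivative f (at z) u) (at p) v \<bullet> b
       = frechet_derivative (\<lambda>z. frechet_derivative f (at z) v) (at p) u \<bullet> b"
  proof (rule symmetric_second_derivative_real[OF S, where
        f = "\<lambda>z. f z \<bullet> b" and f' = "\<lambda>z w. frechet_derivative f (at z) w \<bullet> b" and
        f'' = "\<lambda>w z w'. frechet_derivative (\<lambda>z. frechet_derivative f (at z) w) (at z) w' \<bullet> b"])
    fix w w'
    have "isCont (\<lambda>z. frechet_derivative (\<lambda>z. frechet_derivative f (at z) w) (at z) w') p"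
      using smooth_on_has_derivative[OF smooth_on_derivative[OF smooth_on_derivative[OF sm]] S(2)]
      by (rule has_derivative_continuous)
    then show "isCont (\<lambda>z. frechet_derivative (\<lambda>z. frechet_derivative f (at z) w) (at z) w' \<bullet> b) p"
      by (intro continuous_intros)
  qed (auto intro!: has_derivative_inner_left smooth_on_has_derivative[OF sm]
        smooth_on_has_derivative[OF smooth_on_derivative[OF sm]])
qed

text \<open>The product rule for \<open>z \<mapsto> L\<^sub>z(w(z))\<close> when only the functions \<open>z \<mapsto> L\<^sub>z(v)\<close> with fixed
  \<open>v\<close> are known to be differentiable: the moving argument is expanded in a fixed basis.\<close>

lemma has_derivative_linear_family:
  fixes L :: "'c::real_normed_vector \<Rightarrow> 'v::euclidean_space \<Rightarrow> 'w::real_normed_vector"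
  assumes S: "open S" "p \<in> S"
    and lin: "\<And>z. z \<in> S \<Longrightarrow> linear (L z)"
    and L': "\<And>v. ((\<lambda>z. L z v) has_derivative L' v) (at p)"
    and w: "(w has_derivative w') (at p)"
  shows "((\<lambda>z. L z (w z)) has_derivative (\<lambda>u. L' (w p) u + L p (w' u))) (at p)"
proof -
  have rep: "L z v = (\<Sum>b\<in>Basis. (v \<bullet> b) *\<^sub>R L z b)" if "z \<in> S" for z v
  proof -
    have "L z v = L z (\<Sum>b\<in>Basis. (v \<bullet> b) *\<^sub>R b)" by (simp add: euclidean_representation)
    also have "\<dots> = (\<Sum>b\<in>Basis. (v \<bullet> b) *\<^sub>R L z b)"
      using lin[OF that] by (simp add: linear_sum linear_cmul)
    finally show ?thesis .
  qed
  have d0: "((\<lambda>z. L z v) has_derivative (\<lambda>u. \<Sum>b\<in>Basis. (v \<bullet> b) *\<^sub>R L' b u)) (at p)" for v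
  proof (rule has_derivative_transform_within_open[OF _ S, where f = "\<lambda>z. \<Sum>b\<in>Basis. (v \<bullet> b) *\<^sub>R L z b"])
    show "((\<lambda>z. \<Sum>b\<in>Basis. (v \<bullet> b) *\<^sub>R L z b) has_derivative (\<lambda>u. \<Sum>b\<in>Basis. (v \<bullet> b) *\<^sub>R L' b u)) (at p)"
      by (auto intro!: derivative_eq_intros L')
  qed (simp add: rep[symmetric])
  have L'_eq: "L' v = (\<lambda>u. \<Sum>b\<in>Basis. (v \<bullet> b) *\<^sub>R L' b u)" for v
    using has_derivative_unique[OF L'[of v] d0[of v]] .
  have "((\<lambda>z. \<Sum>b\<in>Basis. (w z \<bullet> b) *\<^sub>R L z b) has_derivative
      (\<lambda>u. \<Sum>b\<in>Basis. (w p \<bullet> b) *\<^sub>R L' b u + (w' u \<bullet> b) *\<^sub>R L p b)) (at p)"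
    by (auto intro!: derivative_eq_intros L' w)
  moreover have "(\<Sum>b\<in>Basis. (w p \<bullet> b) *\<^sub>R L' b u + (w' u \<bullet> b) *\<^sub>R L p b) = L' (w p) u + L p (w' u)" for u
    by (subst L'_eq, subst rep[OF S(2), of "w' u"]) (simp add: sum.distrib)
  ultimately have "((\<lambda>z. \<Sum>b\<in>Basis. (w z \<bullet> b) *\<^sub>R L z b) has_derivative (\<lambda>u. L' (w p) u + L p (w' u))) (at p)"
    by simp
  then show ?thesis
    by (rule has_derivative_transform_within_open[OF _ S]) (simp add: rep[symmetric])
qed

lemma has_derivative_bilinear_family:
  fixes B :: "'c::real_normed_vector \<Rightarrow> 'v::euclidean_space \<Rightarrow> 'v2::euclidean_space \<Rightarrow> 'w::real_normed_vector"
  assumes S: "open S" "p \<in> S"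
    and bil: "\<And>z. z \<in> S \<Longrightarrow> bilinear (B z)"
    and B': "\<And>u v. ((\<lambda>z. B z u v) has_derivative B' u v) (at p)"
    and a: "(a has_derivative a') (at p)" and c: "(c has_derivative c') (at p)"
  shows "((\<lambda>z. B z (a z) (c z)) has_derivative (\<lambda>u. B' (a p) (c p) u + B p (a' u) (c p) + B p (a p) (c' u))) (at p)"
proof -
  have lin1: "linear (\<lambda>u. B z u v)" and lin2: "linear (B z u)" if "z \<in> S" for z u v
    using bil[OF that] by (auto simp: bilinear_def)
  have 1: "((\<lambda>z. B z (a z) v) has_derivative (\<lambda>u. B' (a p) v u + B p (a' u) v)) (at p)" for v
    by (rule has_derivative_linear_family[OF S, where L = "\<lambda>z u. B z u v", OF lin1 B' a]) auto
  show ?thesis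
    by (rule has_derivative_linear_family[OF S, where L = "\<lambda>z v. B z (a z) v", OF lin2 1 c]) auto
qed

lemma linear_frechet_derivative_family:
  fixes L :: "'v::euclidean_space \<Rightarrow> 'v2::real_normed_vector \<Rightarrow> 'w::real_normed_vector"
  assumes S: "open S" "p \<in> S"
    and lin: "\<And>z. z \<in> S \<Longrightarrow> linear (L z)"
    and d: "\<And>v. (\<lambda>z. L z v) differentiable (at p)"
  shows "linear (\<lambda>v. frechet_derivative (\<lambda>z. L z v) (at p) u)"
proof (rule linearI)
  note w = iffD1[OF frechet_derivative_works, OF d]
  fix x y
  have "((\<lambda>z. L z x + L z y) has_derivative (\<lambda>u. frechet_derivative (\<lambda>z. L z x) (at p) u + frechet_derivative (\<lambda>z. L z y) (at p) u)) (at p)"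
    by (intro has_derivative_add w)
  then have "((\<lambda>z. L z (x + y)) has_derivative (\<lambda>u. frechet_derivative (\<lambda>z. L z x) (at p) u + frechet_derivative (\<lambda>z. L z y) (at p) u)) (at p)"
    by (rule has_derivative_transform_within_open[OF _ S]) (simp add: lin linear_add)
  from has_derivative_unique[OF this w]
  show "frechet_derivative (\<lambda>z. L z (x + y)) (at p) u = frechet_derivative (\<lambda>z. L z x) (at p) u + frechet_derivative (\<lambda>z. L z y) (at p) u"
    by metis
next
  note w = iffD1[OF frechet_derivative_works, OF d]
  fix r x
  have "((\<lambda>z. r *\<^sub>R L z x) has_derivative (\<lambda>u. r *\<^sub>R frechet_derivative (\<lambda>z. L z x) (at p) u)) (at p)"
    by (intro has_derivative_scaleR_right w)
  then have "((\<lambda>z. L z (r *\<^sub>R x)) has_derivative (\<lambda>u. r *\<^sub>R frechet_derivative (\<lambda>z. L z x) (at p) u)) (at p)"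
    by (rule has_derivative_transform_within_open[OF _ S]) (simp add: lin linear_cmul)
  from has_derivative_unique[OF this w]
  show "frechet_derivative (\<lambda>z. L z (r *\<^sub>R x)) (at p) u = r *\<^sub>R frechet_derivative (\<lambda>z. L z x) (at p) u"
    by metis
qed

section \<open>Metric connections commuting with the complex structure\<close>

lemma linear_Jop: "linear Jop"
  by (rule linearI) (simp_all add: Jop_def vec_eq_iff algebra_simps)

lemma Jop_Jop [simp]: "Jop (Jop v) = - v"
  by (simp add: Jop_def vec_eq_iff)

lemmas Jop_simps [simp] =
  linear_add[OF linear_Jop] linear_diff[OF linear_Jop] linear_neg[OF linear_Jop]
  linear_0[OF linear_Jop] linear_cmul[OF linear_Jop]

lemma bounded_linear_Jop: "bounded_linear Jop"
  using linear_Jop by (simp add: linear_conv_bounded_linear)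

lemmas bilinear_expand =
  bilinear_ladd bilinear_radd bilinear_lsub bilinear_rsub bilinear_lneg bilinear_rneg
  bilinear_lzero bilinear_rzero bilinear_lmul bilinear_rmul

text \<open>The coordinate expressions, in the image \<open>S\<close> of one chart, of a Hermitian metric and of a connection
  for which metric and complex structure are parallel.\<close>

locale hermitian_connection =
  fixes S :: "(complex^'n::finite) set" and g :: "'n local_metric" and G :: "'n local_conn"
  assumes open_S: "open S"
    and g_bilinear: "z \<in> S \<Longrightarrow> bilinear (g z)"
    and g_sym: "z \<in> S \<Longrightarrow> g z u v = g z v u"
    and g_pos: "z \<in> S \<Longrightarrow> u \<noteq> 0 \<Longrightarrow> g z u u > 0"
    and g_J: "z \<in> S \<Longrightarrow> g z (Jop u) (Jop v) = g z u v"
    and g_smooth: "smooth_on S (\<lambda>z. g z u v)"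
    and G_bilinear: "z \<in> S \<Longrightarrow> bilinear (G z)"
    and G_smooth: "smooth_on S (\<lambda>z. G z u v)"
    and g_compat: "z \<in> S \<Longrightarrow> frechet_derivative (\<lambda>w. g w u v) (at z) x = g z (G z x u) v + g z u (G z x v)"
    and G_J: "z \<in> S \<Longrightarrow> G z x (Jop v) = Jop (G z x v)"
begin

lemmas g_simps = bilinear_expand[OF g_bilinear]
lemmas G_simps = bilinear_expand[OF G_bilinear]

lemma g_eq_iff: "z \<in> S \<Longrightarrow> (\<forall>w. g z u w = g z v w) \<longleftrightarrow> u = v"
proof
  assume z: "z \<in> S" and "\<forall>w. g z u w = g z v w"
  then have "g z (u - v) (u - v) = 0" by (simp add: g_simps)
  then show "u = v" using g_pos[OF z, of "u - v"] by auto
qed simp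

lemma g_J_left: "z \<in> S \<Longrightarrow> g z (Jop u) v = - g z u (Jop v)"
  using g_J[of z u "Jop v"] by (simp add: g_simps)

definition torsion_of :: "complex^'n \<Rightarrow> complex^'n \<Rightarrow> complex^'n \<Rightarrow> complex^'n" where
  "torsion_of z x y = G z x y - G z y x"

text \<open>Torsion, curvature and covariant derivatives are evaluated on vector fields with constant coordinates,
  so that no Lie brackets appear. In \<open>dG\<close>, \<open>nabla_T\<close> and \<open>nabla2_T\<close> the directions of
  differentiation come first, the one of the last differentiation leading.\<close>

definition dG :: "complex^'n \<Rightarrow> complex^'n \<Rightarrow> complex^'n \<Rightarrow> complex^'n \<Rightarrow> complex^'n" where
  "dG z u x y = frechet_derivative (\<lambda>w. G w x y) (at z) u"

definition Rop :: "complex^'n \<Rightarrow> complex^'n \<Rightarrow> complex^'n \<Rightarrow> complex^'n \<Rightarrow> complex^'n" where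
  "Rop z x y w = dG z x y w - dG z y x w + G z x (G z y w) - G z y (G z x w)"

definition nabla_T :: "complex^'n \<Rightarrow> complex^'n \<Rightarrow> complex^'n \<Rightarrow> complex^'n \<Rightarrow> complex^'n" where
  "nabla_T z u x y = dG z u x y - dG z u y x + G z u (torsion_of z x y)
     - torsion_of z (G z u x) y - torsion_of z x (G z u y)"

definition nabla2_T :: "complex^'n \<Rightarrow> complex^'n \<Rightarrow> complex^'n \<Rightarrow> complex^'n \<Rightarrow> complex^'n \<Rightarrow> complex^'n" where
  "nabla2_T z v u x y = frechet_derivative (\<lambda>w. nabla_T w u x y) (at z) v + G z v (nabla_T z u x y)
     - nabla_T z (G z v u) x y - nabla_T z u (G z v x) y - nabla_T z u x (G z v y)"

text \<open>\<open>has_cov a A p\<close>: the vector field \<open>a\<close> is differentiable at \<open>p\<close> with covariant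
  derivative \<open>A u\<close> in the direction \<open>u\<close>.\<close>

definition has_cov :: "'n vfield \<Rightarrow> (complex^'n \<Rightarrow> complex^'n) \<Rightarrow> complex^'n \<Rightarrow> bool" where
  "has_cov a A p \<longleftrightarrow> (a has_derivative (\<lambda>u. A u - G p u (a p))) (at p)"

text \<open>A vector field with value \<open>x\<close> and covariant derivative zero at \<open>p\<close>. When a tensor identity is
  differentiated along such fields, the product rule produces no derivatives of the arguments.\<close>

definition par :: "complex^'n \<Rightarrow> complex^'n \<Rightarrow> complex^'n \<Rightarrow> complex^'n" where
  "par p x = (\<lambda>w. x - G p (w - p) x)"

lemma linear_G: "z \<in> S \<Longrightarrow> linear (\<lambda>u. G z u x)" "z \<in> S \<Longrightarrow> linear (G z u)"
  using G_bilinear by (auto simp: bilinear_def)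

lemma par_at [simp]: "p \<in> S \<Longrightarrow> par p x p = x"
  by (simp add: par_def G_simps)

lemma has_cov_par: "p \<in> S \<Longrightarrow> has_cov (par p x) (\<lambda>_. 0) p"
proof -
  assume p: "p \<in> S"
  have "bounded_linear (\<lambda>u. G p u x)"
    using linear_G(1)[OF p] by (simp add: linear_conv_bounded_linear)
  then have "((\<lambda>w. G p (w - p) x) has_derivative (\<lambda>u. G p (u - 0) x)) (at p)"
    by (rule bounded_linear.has_derivative) (intro derivative_intros)
  then have "((\<lambda>w. x - G p (w - p) x) has_derivative (\<lambda>u. 0 - G p (u - 0) x)) (at p)"
    by (intro derivative_intros)
  then show ?thesis by (simp add: has_cov_def par_def p G_simps)
qed

lemma has_cov_D: "has_cov a A p \<Longrightarrow> (a has_derivative (\<lambda>u. A u - G p u (a p))) (at p)"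
  by (simp add: has_cov_def)

lemma has_cov_J: "p \<in> S \<Longrightarrow> has_cov a A p \<Longrightarrow> has_cov (\<lambda>w. Jop (a w)) (\<lambda>u. Jop (A u)) p"
  unfolding has_cov_def
  using bounded_linear.has_derivative[OF bounded_linear_Jop, of a "\<lambda>u. A u - G p u (a p)" "at p"]
  by (simp add: G_J)

lemma has_cov_add: "p \<in> S \<Longrightarrow> has_cov a A p \<Longrightarrow> has_cov b B p \<Longrightarrow> has_cov (\<lambda>w. a w + b w) (\<lambda>u. A u + B u) p"
  unfolding has_cov_def by (auto intro!: derivative_eq_intros simp: G_simps)

lemma has_cov_diff: "p \<in> S \<Longrightarrow> has_cov a A p \<Longrightarrow> has_cov b B p \<Longrightarrow> has_cov (\<lambda>w. a w - b w) (\<lambda>u. A u - B u) p"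
  unfolding has_cov_def by (auto intro!: derivative_eq_intros simp: G_simps)

lemma has_derivative_g_const:
  assumes "z \<in> S"
  shows "((\<lambda>w. g w u v) has_derivative (\<lambda>x. g z (G z x u) v + g z u (G z x v))) (at z)"
proof -
  have "(\<lambda>x. frechet_derivative (\<lambda>w. g w u v) (at z) x) = (\<lambda>x. g z (G z x u) v + g z u (G z x v))"
    using g_compat[OF assms] by auto
  then show ?thesis using smooth_on_has_derivative[OF g_smooth assms, of u v] by simp
qed

lemma has_cov_g:
  assumes p: "p \<in> S" and a: "has_cov a A p" and b: "has_cov b B p"
  shows "((\<lambda>w. g w (a w) (b w)) has_derivative (\<lambda>u. g p (A u) (b p) + g p (a p) (B u))) (at p)"
  using has_derivative_bilinear_family[OF open_S p g_bilinear has_derivative_g_const[OF p] has_cov_D[OF a] has_cov_D[OF b]]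
  by (simp add: g_simps[OF p])

lemma has_derivative_G: "z \<in> S \<Longrightarrow> ((\<lambda>w. G w x y) has_derivative (\<lambda>u. dG z u x y)) (at z)"
  unfolding dG_def by (rule smooth_on_has_derivative[OF G_smooth])

lemma dG_bilinear: "z \<in> S \<Longrightarrow> bilinear (dG z u)"
  unfolding bilinear_def dG_def
proof (intro conjI allI)
  assume z: "z \<in> S"
  have d: "(\<lambda>w. G w x y) differentiable (at z)" for x y
    using has_derivative_G[OF z] unfolding differentiable_def by blast
  show "linear (\<lambda>y. frechet_derivative (\<lambda>w. G w x y) (at z) u)" for x
    by (rule linear_frechet_derivative_family[OF open_S z, where L = "\<lambda>w. G w x", OF linear_G(2) d])
  show "linear (\<lambda>x. frechet_derivative (\<lambda>w. G w x y) (at z) u)" for y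
    by (rule linear_frechet_derivative_family[OF open_S z, where L = "\<lambda>w x. G w x y", OF linear_G(1) d])
qed

lemmas dG_simps = bilinear_expand[OF dG_bilinear]

lemma linear_dG_first: "z \<in> S \<Longrightarrow> linear (\<lambda>u. dG z u x y)"
  using has_derivative_G has_derivative_linear by blast

lemma has_derivative_G_fields:
  assumes p: "p \<in> S" and a: "(a has_derivative a') (at p)" and b: "(b has_derivative b') (at p)"
  shows "((\<lambda>w. G w (a w) (b w)) has_derivative (\<lambda>u. dG p u (a p) (b p) + G p (a' u) (b p) + G p (a p) (b' u))) (at p)"
  by (rule has_derivative_bilinear_family[OF open_S p G_bilinear has_derivative_G[OF p] a b])

lemma has_derivative_T_fields:
  assumes p: "p \<in> S" and a: "(a has_derivative a') (at p)" and b: "(b has_derivative b') (at p)"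
  shows "((\<lambda>w. torsion_of w (a w) (b w)) has_derivative (\<lambda>u. dG p u (a p) (b p) - dG p u (b p) (a p)
     + torsion_of p (a' u) (b p) + torsion_of p (a p) (b' u))) (at p)"
  unfolding torsion_of_def
  by (rule has_derivative_eq_rhs[OF has_derivative_diff[OF has_derivative_G_fields[OF p a b] has_derivative_G_fields[OF p b a]]])
    (simp add: fun_eq_iff algebra_simps)

lemma has_cov_T:
  assumes p: "p \<in> S" and a: "has_cov a A p" and b: "has_cov b B p"
  shows "has_cov (\<lambda>w. torsion_of w (a w) (b w)) (\<lambda>u. nabla_T p u (a p) (b p) + torsion_of p (A u) (b p) + torsion_of p (a p) (B u)) p"
  unfolding has_cov_def
  by (rule has_derivative_eq_rhs[OF has_derivative_T_fields[OF p has_cov_D[OF a] has_cov_D[OF b]]])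
    (simp add: fun_eq_iff nabla_T_def torsion_of_def G_simps[OF p])

lemma torsion_bilinear: "z \<in> S \<Longrightarrow> bilinear (torsion_of z)"
  unfolding bilinear_def torsion_of_def by (auto intro!: linear_compose_sub linear_G)

lemmas torsion_simps = bilinear_expand[OF torsion_bilinear]

lemma nabla_T_bilinear: "z \<in> S \<Longrightarrow> bilinear (nabla_T z u)"
  unfolding bilinear_def
  by (auto intro!: linearI simp: nabla_T_def G_simps dG_simps torsion_simps scaleR_diff_right scaleR_add_right)

lemma linear_nabla_T_first: "z \<in> S \<Longrightarrow> linear (\<lambda>u. nabla_T z u x y)"
  by (rule linearI) (auto simp: nabla_T_def G_simps linear_add[OF linear_dG_first] linear_cmul[OF linear_dG_first] torsion_simps scaleR_diff_right scaleR_add_right)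

lemmas nabla_T_simps = bilinear_expand[OF nabla_T_bilinear] linear_add[OF linear_nabla_T_first]
  linear_diff[OF linear_nabla_T_first] linear_neg[OF linear_nabla_T_first] linear_0[OF linear_nabla_T_first]
  linear_cmul[OF linear_nabla_T_first]

definition ddG :: "complex^'n \<Rightarrow> complex^'n \<Rightarrow> complex^'n \<Rightarrow> complex^'n \<Rightarrow> complex^'n \<Rightarrow> complex^'n" where
  "ddG z v u x y = frechet_derivative (\<lambda>w. dG w u x y) (at z) v"

lemma has_derivative_dG: "z \<in> S \<Longrightarrow> ((\<lambda>w. dG w u x y) has_derivative (\<lambda>v. ddG z v u x y)) (at z)"
  unfolding ddG_def dG_def
  by (rule smooth_on_has_derivative[OF smooth_on_derivative[OF G_smooth]])

lemma ddG_sym: "z \<in> S \<Longrightarrow> ddG z v u x y = ddG z u v x y"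
  unfolding ddG_def dG_def using symmetric_second_derivative[OF open_S _ G_smooth] by blast

text \<open>The coordinate derivative of \<open>nabla_T\<close> in the direction \<open>v\<close>, written out through the first and second
  derivatives of the Christoffel symbols.\<close>

definition dnabla_T where
  "dnabla_T z v u x y = ddG z v u x y - ddG z v u y x
     + dG z v u (torsion_of z x y) + G z u (dG z v x y - dG z v y x)
     - (dG z v (G z u x) y - dG z v y (G z u x) + torsion_of z (dG z v u x) y)
     - (dG z v x (G z u y) - dG z v (G z u y) x + torsion_of z x (dG z v u y))"

lemma has_derivative_nabla_T:
  assumes p: "p \<in> S"
  shows "((\<lambda>w. nabla_T w u x y) has_derivative (\<lambda>v. dnabla_T p v u x y)) (at p)"
proof -
  have c: "((\<lambda>w. c) has_derivative (\<lambda>v. 0)) (at p)" for c :: "complex^'n" by simp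
  note T = has_derivative_T_fields[OF p] and G = has_derivative_G_fields[OF p]
  show ?thesis
    unfolding nabla_T_def
    by (rule has_derivative_eq_rhs[OF has_derivative_diff[OF has_derivative_diff[OF has_derivative_add[OF
          has_derivative_diff[OF has_derivative_dG[OF p] has_derivative_dG[OF p]]
          G[OF c T[OF c c]]] T[OF has_derivative_G[OF p] c]] T[OF c has_derivative_G[OF p]]]])
      (simp add: fun_eq_iff dnabla_T_def G_simps[OF p] torsion_simps[OF p])
qed

lemma nabla2_T_eq:
  assumes p: "p \<in> S"
  shows "nabla2_T p v u x y = dnabla_T p v u x y + G p v (nabla_T p u x y)
     - nabla_T p (G p v u) x y - nabla_T p u (G p v x) y - nabla_T p u x (G p v y)"
  using frechet_derivative_at[OF has_derivative_nabla_T[OF p]] by (metis nabla2_T_def)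

lemma has_derivative_nabla_T_fields:
  assumes p: "p \<in> S" and c: "(c has_derivative c') (at p)"
    and a: "(a has_derivative a') (at p)" and b: "(b has_derivative b') (at p)"
  shows "((\<lambda>w. nabla_T w (c w) (a w) (b w)) has_derivative
     (\<lambda>v. dnabla_T p v (c p) (a p) (b p) + nabla_T p (c' v) (a p) (b p)
         + nabla_T p (c p) (a' v) (b p) + nabla_T p (c p) (a p) (b' v))) (at p)"
proof -
  have 1: "((\<lambda>w. nabla_T w (c w) x y) has_derivative (\<lambda>v. dnabla_T p v (c p) x y + nabla_T p (c' v) x y)) (at p)" for x y
    by (rule has_derivative_linear_family[OF open_S p, where L = "\<lambda>w u. nabla_T w u x y",
          OF linear_nabla_T_first has_derivative_nabla_T[OF p] c])
  show ?thesis
    by (rule has_derivative_bilinear_family[OF open_S p, where B = "\<lambda>w. nabla_T w (c w)",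
          OF nabla_T_bilinear 1 a b])
qed

lemma has_cov_nabla_T:
  assumes p: "p \<in> S" and c: "has_cov c C p" and a: "has_cov a A p" and b: "has_cov b B p"
  shows "has_cov (\<lambda>w. nabla_T w (c w) (a w) (b w)) (\<lambda>v. nabla2_T p v (c p) (a p) (b p)
     + nabla_T p (C v) (a p) (b p) + nabla_T p (c p) (A v) (b p) + nabla_T p (c p) (a p) (B v)) p"
  unfolding has_cov_def
  by (rule has_derivative_eq_rhs[OF has_derivative_nabla_T_fields[OF p has_cov_D[OF c] has_cov_D[OF a] has_cov_D[OF b]]])
    (simp add: fun_eq_iff nabla2_T_eq[OF p] nabla_T_simps[OF p])

text \<open>After expansion both sides are the same expression in the Christoffel symbols and their derivatives;
  the second derivatives cancel because they are symmetric in \<open>u\<close> and \<open>v\<close>.\<close>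

lemma ricci_identity_torsion:
  assumes p: "p \<in> S"
  shows "nabla2_T p v u x y - nabla2_T p u v x y =
    Rop p v u (torsion_of p x y) - torsion_of p (Rop p v u x) y - torsion_of p x (Rop p v u y)
    - nabla_T p (torsion_of p v u) x y"
  unfolding nabla2_T_eq[OF p] dnabla_T_def nabla_T_def Rop_def torsion_of_def
  by (simp add: G_simps[OF p] dG_simps[OF p] linear_diff[OF linear_dG_first[OF p]] ddG_sym[OF p, of v u])

lemma bianchi_first:
  assumes p: "p \<in> S"
  shows "Rop p x y z + Rop p y z x + Rop p z x y =
    torsion_of p (torsion_of p x y) z + torsion_of p (torsion_of p y z) x + torsion_of p (torsion_of p z x) y
    + nabla_T p x y z + nabla_T p y z x + nabla_T p z x y"
  unfolding nabla_T_def Rop_def torsion_of_def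
  by (simp add: G_simps[OF p])

lemma Rop_skew: "Rop z x y w = - Rop z y x w"
  by (simp add: Rop_def)

text \<open>The curvature is the commutator of covariant derivatives, and the second derivatives of the function
  \<open>g(u,v)\<close> commute; writing these through \<open>\<nabla>g = 0\<close> leaves exactly the two curvature terms.\<close>

lemma Rop_metric_skew:
  assumes p: "p \<in> S"
  shows "g p (Rop p x y u) v = - g p u (Rop p x y v)"
proof -
  have c: "((\<lambda>w. c) has_derivative (\<lambda>v. 0)) (at p)" for c :: "complex^'n" by simp
  have cc: "has_cov (\<lambda>_. c) (\<lambda>x. G p x c) p" for c by (simp add: has_cov_def)
  have cG: "has_cov (\<lambda>w. G w y c) (\<lambda>x. dG p x y c + G p x (G p y c)) p" for y c
    unfolding has_cov_def using has_derivative_G[OF p] by simp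
  have D: "((\<lambda>w. frechet_derivative (\<lambda>w. g w u v) (at w) y) has_derivative
     (\<lambda>x. g p (dG p x y u + G p x (G p y u)) v + g p (G p y u) (G p x v)
        + (g p (G p x u) (G p y v) + g p u (dG p x y v + G p x (G p y v))))) (at p)" for y
  proof (rule has_derivative_transform_within_open[OF _ open_S p])
    show "((\<lambda>w. g w (G w y u) v + g w u (G w y v)) has_derivative
     (\<lambda>x. g p (dG p x y u + G p x (G p y u)) v + g p (G p y u) (G p x v)
        + (g p (G p x u) (G p y v) + g p u (dG p x y v + G p x (G p y v))))) (at p)"
      by (intro has_derivative_add has_cov_g[OF p] cc cG)
  qed (simp add: g_compat)
  have "frechet_derivative (\<lambda>w. frechet_derivative (\<lambda>w. g w u v) (at w) y) (at p) x
      = frechet_derivative (\<lambda>w. frechet_derivative (\<lambda>w. g w u v) (at w) x) (at p) y"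
    by (rule symmetric_second_derivative[OF open_S p g_smooth])
  then show ?thesis
    unfolding frechet_derivative_at[OF D, symmetric] Rop_def by (simp add: g_simps[OF p])
qed

lemma dG_J:
  assumes p: "p \<in> S" shows "dG p u x (Jop y) = Jop (dG p u x y)"
proof -
  have "((\<lambda>w. Jop (G w x y)) has_derivative (\<lambda>u. Jop (dG p u x y))) (at p)"
    by (rule bounded_linear.has_derivative[OF bounded_linear_Jop has_derivative_G[OF p]])
  then have "((\<lambda>w. G w x (Jop y)) has_derivative (\<lambda>u. Jop (dG p u x y))) (at p)"
    by (rule has_derivative_transform_within_open[OF _ open_S p]) (simp add: G_J)
  from has_derivative_unique[OF this has_derivative_G[OF p]] show ?thesis by metis
qed

lemma Rop_J: "p \<in> S \<Longrightarrow> Rop p x y (Jop w) = Jop (Rop p x y w)"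
  by (simp add: Rop_def dG_J G_J)

text \<open>The complex structure is integrable and \<open>\<nabla>\<close> preserves type, so the torsion of two vectors \<open>x - iJx\<close> and
  \<open>y - iJy\<close> of type \<open>(1,0)\<close> is again of type \<open>(1,0)\<close>. This is the real form of that statement.\<close>

lemma torsion_J: "p \<in> S \<Longrightarrow> torsion_of p (Jop x) y + torsion_of p x (Jop y) = Jop (torsion_of p x y - torsion_of p (Jop x) (Jop y))"
  by (simp add: torsion_of_def G_J)

lemma nabla_T_J:
  assumes p: "p \<in> S"
  shows "nabla_T p u (Jop x) y + nabla_T p u x (Jop y) = Jop (nabla_T p u x y - nabla_T p u (Jop x) (Jop y))"
  by (simp add: nabla_T_def torsion_of_def G_J dG_J G_simps p)

end

section \<open>The first Bianchi identity under the curvature conditions\<close>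

text \<open>The last two assumptions are the real forms of \<open>R(X,Y) = 0\<close> and of the symmetry of
  \<open>R(X,Y)Z\<close> (second argument conjugated) in \<open>X\<close> and \<open>Z\<close>, for \<open>X\<close>, \<open>Y\<close>, \<open>Z\<close> of type \<open>(1,0)\<close>.\<close>

locale bkl_chart = hermitian_connection S g G
  for S :: "(complex^'n::finite) set" and g :: "'n local_metric" and G :: "'n local_conn" +
  assumes torsion_skew: "z \<in> S \<Longrightarrow> g z (torsion_of z x y) w = - g z (torsion_of z x w) y"
    and Rop_JJ: "z \<in> S \<Longrightarrow> Rop z (Jop x) (Jop y) w = Rop z x y w"
    and kaehler_like: "z \<in> S \<Longrightarrow> Rop z x y w + Jop (Rop z x (Jop y) w) = Rop z w y x + Jop (Rop z w (Jop y) x)"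
begin

definition H :: "complex^'n \<Rightarrow> complex^'n \<Rightarrow> complex^'n \<Rightarrow> complex^'n \<Rightarrow> real" where
  "H z x y w = g z (torsion_of z x y) w"

definition P :: "complex^'n \<Rightarrow> complex^'n \<Rightarrow> complex^'n \<Rightarrow> complex^'n \<Rightarrow> complex^'n \<Rightarrow> real" where
  "P z u x y w = g z (nabla_T z u x y) w"

definition Q :: "complex^'n \<Rightarrow> complex^'n \<Rightarrow> complex^'n \<Rightarrow> complex^'n \<Rightarrow> complex^'n \<Rightarrow> complex^'n \<Rightarrow> real" where
  "Q z v u x y w = g z (nabla2_T z v u x y) w"

lemma Rop_J_right: "z \<in> S \<Longrightarrow> Rop z x (Jop y) w = - Rop z (Jop x) y w"
  using Rop_JJ[of z x "Jop y" w] Rop_JJ[of z "Jop x" y w]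
  by (simp add: Rop_def dG_simps G_simps linear_neg[OF linear_dG_first] algebra_simps)

lemma torsion_anti: "torsion_of z x y = - torsion_of z y x"
  by (simp add: torsion_of_def)

text \<open>The symmetry of the curvature makes the cyclic sum \<open>b\<close> complex linear in each argument, so
  \<open>b(Jx,Jy,w) = -b(x,y,w)\<close>; the invariance of \<open>R\<close> under \<open>J\<close> in its first two arguments gives the opposite sign.\<close>

lemma cyclic_Rop:
  assumes z: "z \<in> S"
  shows "Rop z x y w + Rop z y w x + Rop z w x y = 0"
proof -
  define b where "b x y w = Rop z x y w + Rop z y w x + Rop z w x y" for x y w
  have lin: "Rop z (- x) y w = - Rop z x y w" "Rop z x (- y) w = - Rop z x y w" for x y w
    by (simp_all add: Rop_def dG_simps[OF z] G_simps[OF z] linear_neg[OF linear_dG_first[OF z]])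
  have 1: "b x y w = - Jop (b x (Jop y) w)" for x y w
  proof -
    have "b x y w + Jop (b x (Jop y) w) = (Rop z x y w + Jop (Rop z x (Jop y) w)) - (Rop z w y x + Jop (Rop z w (Jop y) x))"
      by (simp add: b_def Rop_J[OF z] Rop_skew[of z y w] Rop_skew[of z "Jop y" w])
    then show ?thesis using kaehler_like[OF z, of x y w] by (simp add: eq_neg_iff_add_eq_0)
  qed
  have 2: "b x y w = b y w x" for x y w by (simp add: b_def)
  have J2: "b x (Jop y) w = Jop (b x y w)" for x y w
    using arg_cong[OF 1[of x y w], of Jop] by simp
  have J1: "b (Jop x) y w = Jop (b x y w)" for x y w using 2 J2 by metis
  have J3: "b x y (Jop w) = Jop (b x y w)" for x y w using 2 J2 by metis
  have "b (Jop x) (Jop y) w = b x y w" for x y w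
  proof -
    have "Jop (b x y (Jop w)) = - (Rop z x y w) + Jop (Rop z y (Jop w) x + Rop z (Jop w) x y)"
      by (simp add: b_def Rop_J[OF z])
    then have "b (Jop x) (Jop y) w = - Jop (b x y (Jop w))"
      by (simp add: b_def Rop_J[OF z] Rop_JJ[OF z] Rop_J_right[OF z] lin)
    then show ?thesis by (simp add: J3)
  qed
  moreover have "b (Jop x) (Jop y) w = - b x y w" for x y w by (simp add: J1 J2)
  ultimately have "b x y w = - b x y w" by metis
  then have "2 *\<^sub>R b x y w = 0" unfolding scaleR_2 by (metis add.right_inverse)
  then have "b x y w = 0" by simp
  then show ?thesis by (simp add: b_def)
qed

definition sigma :: "complex^'n \<Rightarrow> complex^'n \<Rightarrow> complex^'n \<Rightarrow> complex^'n \<Rightarrow> complex^'n \<Rightarrow> real" where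
  "sigma z x y w v = g z (torsion_of z x y) (torsion_of z w v)
     + g z (torsion_of z y w) (torsion_of z x v) + g z (torsion_of z w x) (torsion_of z y v)"

lemma H_skew: assumes z: "z \<in> S"
  shows "H z y x w = - H z x y w" "H z x w y = - H z x y w" "H z y w x = H z x y w"
proof -
  show 1: "H z y x w = - H z x y w" for x y w
    unfolding H_def torsion_anti[of z y x] by (simp add: g_simps[OF z])
  show 2: "H z x w y = - H z x y w" for x y w unfolding H_def by (rule torsion_skew[OF z])
  show "H z y w x = H z x y w" using 1[of x y w] 2[of y x w] by linarith
qed

lemma nabla_T_anti: "z \<in> S \<Longrightarrow> nabla_T z u x y = - nabla_T z u y x"
  by (simp add: nabla_T_def torsion_of_def G_simps)

lemma P_skew34: assumes z: "z \<in> S" shows "P z u x w y = - P z u x y w"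
proof -
  have p: "has_cov (par z a) (\<lambda>_. 0) z" for a by (rule has_cov_par[OF z])
  have "((\<lambda>v. g v (torsion_of v (par z x v) (par z y v)) (par z w v) + g v (torsion_of v (par z x v) (par z w v)) (par z y v))
     has_derivative (\<lambda>u. P z u x y w + P z u x w y)) (at z)"
    by (rule has_derivative_eq_rhs[OF has_derivative_add[OF has_cov_g[OF z has_cov_T[OF z p p] p] has_cov_g[OF z has_cov_T[OF z p p] p]]])
      (simp add: fun_eq_iff P_def torsion_simps[OF z] g_simps[OF z] z)
  moreover have "((\<lambda>v. g v (torsion_of v (par z x v) (par z y v)) (par z w v) + g v (torsion_of v (par z x v) (par z w v)) (par z y v))
     has_derivative (\<lambda>u. 0)) (at z)"
  proof (rule has_derivative_transform_within_open[OF _ open_S z])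
    show "((\<lambda>v. 0::real) has_derivative (\<lambda>u. 0)) (at z)" by simp
    fix v assume "v \<in> S"
    then show "0 = g v (torsion_of v (par z x v) (par z y v)) (par z w v) + g v (torsion_of v (par z x v) (par z w v)) (par z y v)"
      using torsion_skew[of v "par z x v" "par z y v" "par z w v"] by simp
  qed
  ultimately have "(\<lambda>u. P z u x y w + P z u x w y) = (\<lambda>u. 0)" by (rule has_derivative_unique)
  then show ?thesis by (metis add_eq_0_iff)
qed

lemma P_skew23: "z \<in> S \<Longrightarrow> P z u y x w = - P z u x y w"
  unfolding P_def nabla_T_anti[of z u y x] by (simp add: g_simps)

lemma cyclic_P:
  assumes z: "z \<in> S"
  shows "P z x y w v + P z y w x v + P z w x y v = - sigma z x y w v"
proof -
  have 1: "g z (torsion_of z (torsion_of z x y) w) v = g z (torsion_of z x y) (torsion_of z w v)" for x y w v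
    using H_skew(3)[OF z, of w v "torsion_of z x y"] by (simp add: H_def g_sym[OF z, of _ "torsion_of z x y"])
  (* pair the first Bianchi identity with v; its left-hand side is the vanishing cyclic sum *)
  have "g z (Rop z x y w + Rop z y w x + Rop z w x y) v = 0"
    by (simp add: cyclic_Rop[OF z] g_simps[OF z])
  then show ?thesis
    unfolding bianchi_first[OF z] by (simp add: g_simps[OF z] 1 P_def sigma_def)
qed

lemma sigma_skew14: assumes z: "z \<in> S" shows "sigma z v y w x = - sigma z x y w v"
  unfolding sigma_def torsion_anti[of z v y] torsion_anti[of z w v] torsion_anti[of z v x] torsion_anti[of z y x]
    torsion_anti[of z x w]
  using g_sym[OF z] by (simp add: g_simps[OF z])

text \<open>The form \<open>P\<close> is skew in its last three arguments, so its cyclic sum over the first three differs from the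
  full alternation by \<open>P\<close> with the last argument moved to the front. Both the alternation and the
  cyclic sum \<open>-\<sigma>\<close> are skew in all arguments; hence \<open>P\<close> is too.\<close>

lemma P_skew12: assumes z: "z \<in> S" shows "P z x u y w = - P z u x y w"
  using cyclic_P[OF z, of x y w u] cyclic_P[OF z, of u y w x] sigma_skew14[OF z, of u y w x]
    P_skew23[OF z, of y x w u] P_skew23[OF z, of y u w x] P_skew34[OF z, of y x w u] P_skew23[OF z, of y w u x]
    P_skew34[OF z, of w x y u] P_skew34[OF z, of u y w x] P_skew23[OF z, of u x y w] P_skew34[OF z, of u y x w]
    P_skew34[OF z, of x y w u] P_skew23[OF z, of x u y w] P_skew34[OF z, of x y u w] P_skew23[OF z, of w u x y] P_skew34[OF z, of w u x y]
    P_skew23[OF z, of y w x u] P_skew34[OF z, of y w x u] P_skew34[OF z, of y u x w] P_skew23[OF z, of w x u y] P_skew23[OF z, of w y u x]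
    P_skew34[OF z, of y u w x] P_skew23[OF z, of y x u w]  P_skew23[OF z, of w u y x] P_skew23[OF z, of w x y u]
  by linarith

lemma three_P: assumes z: "z \<in> S" shows "3 * P z u x y w = - sigma z u x y w"
  using cyclic_P[OF z, of u x y w] P_skew12[OF z, of u x y w] P_skew23[OF z, of x u y w]
    P_skew12[OF z, of y u x w] P_skew23[OF z, of u x y w]
  by linarith

text \<open>Tensor identities that hold on the whole chart are differentiated with these two rules, applied to
  fields that are parallel at the point.\<close>

lemma has_derivative_zero_on:
  assumes z: "z \<in> S" and "\<And>v. v \<in> S \<Longrightarrow> f v = 0" and d: "(f has_derivative f') (at z)"
  shows "f' u = 0"
proof -
  have "(f has_derivative (\<lambda>u. 0)) (at z)"
    by (rule has_derivative_transform_within_open[OF _ open_S z, of "\<lambda>_. 0"]) (auto simp: assms)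
  from has_derivative_unique[OF this d] show ?thesis by metis
qed

lemma has_cov_zero_on:
  assumes z: "z \<in> S" and f: "\<And>v. v \<in> S \<Longrightarrow> f v = 0" and d: "has_cov f F z"
  shows "F u = 0"
  using has_derivative_zero_on[OF z f has_cov_D[OF d]] f[OF z] by (simp add: G_simps[OF z])

lemma nabla2_T_J:
  assumes z: "z \<in> S"
  shows "nabla2_T z v u (Jop x) y + nabla2_T z v u x (Jop y) = Jop (nabla2_T z v u x y - nabla2_T z v u (Jop x) (Jop y))"
proof -
  have p: "has_cov (par z a) (\<lambda>_. 0) z" for a by (rule has_cov_par[OF z])
  note N = has_cov_nabla_T[OF z p] and J = has_cov_J[OF z]
  let ?f = "\<lambda>w. (nabla_T w (par z u w) (Jop (par z x w)) (par z y w) + nabla_T w (par z u w) (par z x w) (Jop (par z y w)))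
     - Jop (nabla_T w (par z u w) (par z x w) (par z y w) - nabla_T w (par z u w) (Jop (par z x w)) (Jop (par z y w)))"
  have zero: "?f w = 0" if "w \<in> S" for w
    using nabla_T_J[OF that, of "par z u w" "par z x w" "par z y w"] by simp
  show ?thesis
    using has_cov_zero_on[OF z zero has_cov_diff[OF z has_cov_add[OF z N[OF J[OF p] p] N[OF p J[OF p]]]
       J[OF has_cov_diff[OF z N[OF p p] N[OF J[OF p] J[OF p]]]]], of v]
    by (simp add: z nabla_T_simps[OF z])
qed

lemma has_derivative_P:
  assumes z: "z \<in> S"
  shows "((\<lambda>r. P r (par z u r) (par z x r) (par z y r) (par z w r)) has_derivative (\<lambda>v. Q z v u x y w)) (at z)"
proof -
  have p: "has_cov (par z a) (\<lambda>_. 0) z" for a by (rule has_cov_par[OF z])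
  show ?thesis unfolding P_def
    by (rule has_derivative_eq_rhs[OF has_cov_g[OF z has_cov_nabla_T[OF z p p p] p]])
      (simp add: Q_def nabla_T_simps[OF z] g_simps[OF z] z)
qed

lemma Q_skew: assumes z: "z \<in> S"
  shows "Q z v x u y w = - Q z v u x y w" "Q z v u y x w = - Q z v u x y w" "Q z v u x w y = - Q z v u x y w"
proof -
  note D = has_derivative_add[OF has_derivative_P[OF z] has_derivative_P[OF z]]
  have 1: "P r (par z x r) (par z u r) (par z y r) (par z w r) + P r (par z u r) (par z x r) (par z y r) (par z w r) = 0"
    and 2: "P r (par z u r) (par z y r) (par z x r) (par z w r) + P r (par z u r) (par z x r) (par z y r) (par z w r) = 0"
    and 3: "P r (par z u r) (par z x r) (par z w r) (par z y r) + P r (par z u r) (par z x r) (par z y r) (par z w r) = 0"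
    if r: "r \<in> S" for r
    using P_skew12[OF r] P_skew23[OF r] P_skew34[OF r] by (metis add.left_inverse)+
  show "Q z v x u y w = - Q z v u x y w"
    using has_derivative_zero_on[OF z 1 D, of v] by simp
  show "Q z v u y x w = - Q z v u x y w"
    using has_derivative_zero_on[OF z 2 D, of v] by simp
  show "Q z v u x w y = - Q z v u x y w"
    using has_derivative_zero_on[OF z 3 D, of v] by simp
qed

text \<open>The derivative of \<open>3P = -\<sigma>\<close>: each of the two torsion factors in each of the three terms of \<open>\<sigma>\<close>
  is differentiated once.\<close>

lemma three_Q:
  assumes z: "z \<in> S"
  shows "3 * Q z v u x y w = - (P z v u x (torsion_of z y w) + P z v y w (torsion_of z u x)
     + P z v x y (torsion_of z u w) + P z v u w (torsion_of z x y)
     + P z v y u (torsion_of z x w) + P z v x w (torsion_of z y u))"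
proof -
  have p: "has_cov (par z a) (\<lambda>_. 0) z" for a by (rule has_cov_par[OF z])
  note T = has_cov_T[OF z p p]
  let ?f = "\<lambda>r. 3 * P r (par z u r) (par z x r) (par z y r) (par z w r) + sigma r (par z u r) (par z x r) (par z y r) (par z w r)"
  have zero: "?f r = 0" if "r \<in> S" for r
    using three_P[OF that] by simp
  have D: "(?f has_derivative (\<lambda>v. 3 * Q z v u x y w +
      (P z v u x (torsion_of z y w) + P z v y w (torsion_of z u x)
     + P z v x y (torsion_of z u w) + P z v u w (torsion_of z x y)
     + P z v y u (torsion_of z x w) + P z v x w (torsion_of z y u)))) (at z)"
    unfolding sigma_def
    by (rule has_derivative_eq_rhs[OF has_derivative_add[OF has_derivative_mult_right[OF has_derivative_P[OF z]]
       has_derivative_add[OF has_derivative_add[OF has_cov_g[OF z T T] has_cov_g[OF z T T]] has_cov_g[OF z T T]]]])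
      (simp add: fun_eq_iff P_def torsion_simps[OF z] g_simps[OF z] z g_sym[OF z, of "torsion_of z _ _" "nabla_T z _ _ _"])
  from has_derivative_zero_on[OF z zero D, of v] show ?thesis by simp
qed

lemma ricci_H:
  assumes z: "z \<in> S"
  shows "Q z v u x y w - Q z u v x y w =
    - (H z (Rop z v u x) y w + H z x (Rop z v u y) w + H z x y (Rop z v u w)) - P z (torsion_of z v u) x y w"
proof -
  have "Q z v u x y w - Q z u v x y w = g z (nabla2_T z v u x y - nabla2_T z u v x y) w"
    by (simp add: Q_def g_simps[OF z])
  also have "\<dots> = g z (Rop z v u (torsion_of z x y)) w - H z (Rop z v u x) y w - H z x (Rop z v u y) w - P z (torsion_of z v u) x y w"
    unfolding ricci_identity_torsion[OF z] by (simp add: g_simps[OF z] H_def P_def)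
  finally show ?thesis by (simp add: Rop_metric_skew[OF z] H_def)
qed

end

section \<open>Complexified components in a unitary frame\<close>

text \<open>A pair \<open>(b, x)\<close> stands for the complex tangent vector \<open>x - iJx\<close> of type \<open>(1,0)\<close> if \<open>b\<close> is false and
  for its conjugate \<open>x + iJx\<close> if \<open>b\<close> is true; \<open>ev\<close> evaluates the complex linear extension of a real
  linear function on it, and \<open>ext3\<close>, \<open>ext4\<close>, \<open>ext5\<close> do so in every argument. Since \<open>ev\<close> is linear
  and evaluations in different arguments commute, identities between real tensors pass to the extensions.\<close>

definition sgi :: "bool \<Rightarrow> complex" where
  "sgi b = (if b then \<i> else - \<i>)"

definition ev :: "bool \<times> (complex^'n::finite) \<Rightarrow> (complex^'n \<Rightarrow> complex) \<Rightarrow> complex" where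
  "ev a f = f (snd a) + sgi (fst a) * f (Jop (snd a))"

definition bar :: "bool \<times> 'a \<Rightarrow> bool \<times> 'a" where
  "bar a = (\<not> fst a, snd a)"

lemma ev_simps:
  "ev a (\<lambda>x. f x + h x) = ev a f + ev a h"
  "ev a (\<lambda>x. f x - h x) = ev a f - ev a h"
  "ev a (\<lambda>x. - f x) = - ev a f"
  "ev a (\<lambda>x. c * f x) = c * ev a f"
  "ev a (\<lambda>x. f x * c) = ev a f * c"
  "ev a (\<lambda>x. \<Sum>i\<in>I. F i x) = (\<Sum>i\<in>I. ev a (F i))"
  "ev a (\<lambda>x. 0) = 0"
  by (simp_all add: ev_def algebra_simps sum.distrib sum_distrib_left)

lemma ev_commute: "ev a (\<lambda>x. ev b (\<lambda>y. F x y)) = ev b (\<lambda>y. ev a (\<lambda>x. F x y))"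
  by (simp add: ev_def algebra_simps)

lemma cnj_sgi: "cnj (sgi b) = sgi (\<not> b)"
  by (simp add: sgi_def)

lemma cnj_ev: "cnj (ev a f) = ev (bar a) (\<lambda>x. cnj (f x))"
  by (simp add: ev_def bar_def cnj_sgi)

definition ext3 where
  "ext3 F a b c = ev a (\<lambda>x. ev b (\<lambda>y. ev c (\<lambda>w. complex_of_real (F x y w))))"
definition ext4 where
  "ext4 F a b c d = ev a (\<lambda>u. ext3 (F u) b c d)"
definition ext5 where
  "ext5 F a b c d e = ev a (\<lambda>u. ext4 (F u) b c d e)"

lemma ext3_minus: "ext3 (\<lambda>x y w. - F x y w) a b c = - ext3 F a b c"
  by (simp add: ext3_def ev_simps)
lemma ext4_minus: "ext4 (\<lambda>u x y w. - F u x y w) a b c d = - ext4 F a b c d"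
  by (simp add: ext4_def ext3_minus ev_simps)
lemma ext3_swap12: assumes "\<And>x y w. F y x w = - F x y w" shows "ext3 F b a c = - ext3 F a b c"
proof -
  have "ext3 F b a c = ext3 (\<lambda>x y w. F y x w) a b c"
    unfolding ext3_def by (rule ev_commute)
  moreover have "(\<lambda>x y w. F y x w) = (\<lambda>x y w. - F x y w)" by (intro ext) (rule assms)
  ultimately show ?thesis by (simp only: ext3_minus)
qed

lemma ext3_swap23: assumes "\<And>x y w. F x w y = - F x y w" shows "ext3 F a c b = - ext3 F a b c"
proof -
  have "ext3 F a c b = ext3 (\<lambda>x y w. F x w y) a b c"
    unfolding ext3_def by (subst ev_commute[of b c]) (rule refl)
  moreover have "(\<lambda>x y w. F x w y) = (\<lambda>x y w. - F x y w)" by (intro ext) (rule assms)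
  ultimately show ?thesis by (simp only: ext3_minus)
qed

lemma ext4_swap12: assumes "\<And>u x y w. F x u y w = - F u x y w" shows "ext4 F b a c d = - ext4 F a b c d"
proof -
  have "ext4 F b a c d = ext4 (\<lambda>u x y w. F x u y w) a b c d"
    unfolding ext4_def ext3_def by (rule ev_commute)
  moreover have "(\<lambda>u x y w. F x u y w) = (\<lambda>u x y w. - F u x y w)" by (intro ext) (rule assms)
  ultimately show ?thesis by (simp only: ext4_minus)
qed

lemma ext4_swap23: assumes "\<And>u x y w. F u y x w = - F u x y w" shows "ext4 F a c b d = - ext4 F a b c d"
  unfolding ext4_def by (subst ext3_swap12[OF assms]) (simp add: ev_simps)

lemma ext4_swap34: assumes "\<And>u x y w. F u x w y = - F u x y w" shows "ext4 F a b d c = - ext4 F a b c d"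
  unfolding ext4_def by (subst ext3_swap23[OF assms]) (simp add: ev_simps)

lemma ext5_swap23: assumes "\<And>v u x y w. F v x u y w = - F v u x y w" shows "ext5 F a c b d e = - ext5 F a b c d e"
  unfolding ext5_def by (subst ext4_swap12[OF assms]) (simp add: ev_simps)

lemma ext5_swap34: assumes "\<And>v u x y w. F v u y x w = - F v u x y w" shows "ext5 F a b d c e = - ext5 F a b c d e"
  unfolding ext5_def by (subst ext4_swap23[OF assms]) (simp add: ev_simps)

lemma ext5_swap45: assumes "\<And>v u x y w. F v u x w y = - F v u x y w" shows "ext5 F a b c e d = - ext5 F a b c d e"
  unfolding ext5_def by (subst ext4_swap34[OF assms]) (simp add: ev_simps)

lemma cnj_ext3: "cnj (ext3 F a b c) = ext3 F (bar a) (bar b) (bar c)"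
  by (simp add: ext3_def cnj_ev)
lemma cnj_ext4: "cnj (ext4 F a b c d) = ext4 F (bar a) (bar b) (bar c) (bar d)"
  by (simp add: ext4_def cnj_ev cnj_ext3)
context hermitian_connection
begin

text \<open>The Hermitian form \<open>g(x - iJx, y + iJy)\<close>, under the identification of real tangent vectors with
  vectors of type \<open>(1,0)\<close>.\<close>

definition h :: "complex^'n \<Rightarrow> complex^'n \<Rightarrow> complex^'n \<Rightarrow> complex" where
  "h z x y = Complex (2 * g z x y) (2 * g z x (Jop y))"

definition unitary :: "complex^'n \<Rightarrow> ('n \<Rightarrow> complex^'n) \<Rightarrow> bool" where
  "unitary z e \<longleftrightarrow> (\<forall>i j. h z (e i) (e j) = (if i = j then 1 else 0))"

lemma scale_eq: "c *s v = Re c *\<^sub>R v + Im c *\<^sub>R Jop (v :: complex^'n)"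
  by (auto simp: vec_eq_iff Jop_def complex_eq_iff)

lemma h_simps:
  assumes z: "z \<in> S"
  shows "h z (x + y) w = h z x w + h z y w" "h z w (x + y) = h z w x + h z w y"
    "h z (x - y) w = h z x w - h z y w" "h z w (x - y) = h z w x - h z w y"
    "h z (c *s x) w = c * h z x w" "h z w (c *s x) = cnj c * h z w x"
    "h z 0 w = 0" "h z w 0 = 0"
  using g_J[OF z, of x w] g_J_left[OF z, of x w]
  by (auto simp: h_def complex_eq_iff scale_eq g_simps[OF z] g_J[OF z] g_J_left[OF z] algebra_simps)

lemma h_cnj: assumes z: "z \<in> S" shows "h z y x = cnj (h z x y)"
  using g_sym[OF z, of x y] g_J_left[OF z, of x y] g_sym[OF z, of "Jop x" y]
  by (simp add: h_def complex_eq_iff)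

lemma h_sum: assumes z: "z \<in> S" and I: "finite I" shows "h z (\<Sum>i\<in>I. F i) w = (\<Sum>i\<in>I. h z (F i) w)"
  using I by (induction I rule: finite_induct) (simp_all add: h_simps[OF z])

lemma h_sum_right: assumes z: "z \<in> S" and I: "finite I" shows "h z w (\<Sum>i\<in>I. F i) = (\<Sum>i\<in>I. h z w (F i))"
  using I by (induction I rule: finite_induct) (simp_all add: h_simps[OF z])

lemma h_self: "z \<in> S \<Longrightarrow> x \<noteq> 0 \<Longrightarrow> h z x x \<noteq> 0" "z \<in> S \<Longrightarrow> x \<noteq> 0 \<Longrightarrow> h z x x = complex_of_real (Re (h z x x)) \<and> Re (h z x x) > 0"
proof -
  assume z: "z \<in> S" and x: "x \<noteq> 0"
  then show a: "h z x x = complex_of_real (Re (h z x x)) \<and> Re (h z x x) > 0"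
    using g_pos[OF z x] h_cnj[OF z, of x x] by (auto simp: h_def complex_eq_iff)
  then show "h z x x \<noteq> 0" by (metis less_numeral_extra(3) zero_complex.sel(1))
qed

text \<open>Gram-Schmidt: a vector outside the span of an orthonormal family has a nonzero component
  orthogonal to it.\<close>

lemma exists_h_orthogonal:
  assumes z: "z \<in> S" and I: "card I < CARD('n)" and on: "\<And>i j. i \<in> I \<Longrightarrow> j \<in> I \<Longrightarrow> h z (e i) (e j) = (if i = j then 1 else 0)"
    and fin: "finite (I :: 'i set)"
  shows "\<exists>v. v \<noteq> 0 \<and> (\<forall>i\<in>I. h z v (e i) = 0)"
proof -
  have "vec.dim (e ` I) \<le> card (e ` I)" by (rule vec.dim_le_card') (simp add: fin)
  also have "\<dots> \<le> card I" by (rule card_image_le[OF fin])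
  finally have "vec.dim (e ` I) < vec.dim (UNIV :: (complex^'n) set)" using I by (simp add: vec_dim_card card_cart_basis)
  then have "vec.span (e ` I) \<noteq> UNIV" by (metis less_irrefl vec.dim_span)
  then obtain x where x: "x \<notin> vec.span (e ` I)" by blast
  define v where "v = x - (\<Sum>i\<in>I. h z x (e i) *s e i)"
  have "(\<Sum>i\<in>I. h z x (e i) *s e i) \<in> vec.span (e ` I)"
    by (intro vec.span_sum vec.span_scale vec.span_base) auto
  then have "v \<noteq> 0" using x by (auto simp: v_def)
  moreover have "h z v (e j) = 0" if "j \<in> I" for j
  proof -
    have "h z v (e j) = h z x (e j) - (\<Sum>i\<in>I. h z x (e i) * (if i = j then 1 else 0))"
      using on that by (simp add: v_def h_simps[OF z] h_sum[OF z fin] cong: sum.cong)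
    then show ?thesis using that fin by (simp add: if_distrib[of "\<lambda>t. _ * t"] sum.delta cong: if_cong)
  qed
  ultimately show ?thesis by blast
qed

lemma h_normalise:
  assumes z: "z \<in> S" and v: "v \<noteq> 0"
  shows "\<exists>c. c \<noteq> 0 \<and> h z (c *s v) (c *s v) = 1"
proof -
  define r where "r = Re (h z v v)"
  have r: "h z v v = of_real r" "r > 0" using h_self(2)[OF z v] by (auto simp: r_def)
  define c where "c = complex_of_real (1 / sqrt r)"
  have "c * (cnj c * h z v v) = of_real ((1 / sqrt r) * ((1 / sqrt r) * r))"
    unfolding c_def r(1) complex_cnj_complex_of_real of_real_mult by (simp only: mult.assoc)
  also have "(1 / sqrt r) * ((1 / sqrt r) * r) = 1" using r(2) by (simp add: field_simps)
  finally show ?thesis using r(2) by (intro exI[of _ c]) (auto simp: h_simps[OF z] c_def)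
qed

lemma unitary_expansion:
  assumes z: "z \<in> S" and e: "unitary z e"
  shows "x = (\<Sum>\<^sub>U i. h z x (e i) *s e i)"
proof -
  define y where "y = x - (\<Sum>\<^sub>U i. h z x (e i) *s e i)"
  have o: "h z y (e j) = 0" for j
  proof -
    have "h z y (e j) = h z x (e j) - (\<Sum>\<^sub>U i. h z x (e i) * (if i = j then 1 else 0))"
      using e by (simp add: y_def h_simps[OF z] h_sum[OF z] unitary_def)
    then show ?thesis by (simp add: if_distrib[of "\<lambda>t. _ * t"] cong: if_cong)
  qed
  have "y = 0"
  proof (rule ccontr)
    assume y: "y \<noteq> 0"
    have inj: "inj e"
      using e by (auto simp: inj_def unitary_def) (metis zero_neq_one)
    have "vec.independent (e ` UNIV)"
      unfolding vec.independent_explicit_finite_subsets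
    proof (intro allI impI ballI)
      fix A u v assume A: "A \<subseteq> range e" "finite A" and s: "(\<Sum>v\<in>A. u v *s v) = 0" and v: "v \<in> A"
      from v A obtain j where j: "v = e j" by auto
      have "0 = h z (\<Sum>v\<in>A. u v *s v) (e j)" using s by (simp add: h_simps[OF z])
      also have "\<dots> = (\<Sum>w\<in>A. u w * h z w (e j))" by (simp add: h_sum[OF z A(2)] h_simps[OF z])
      also have "\<dots> = (\<Sum>w\<in>A. if w = v then u w else 0)"
      proof (intro sum.cong refl)
        fix w assume "w \<in> A"
        then obtain i where "w = e i" using A(1) by auto
        then show "u w * h z w (e j) = (if w = v then u w else 0)"
          using e j inj by (auto simp: unitary_def inj_def)
      qed
      also have "\<dots> = u v" using v A(2) by simp
      finally show "u v = 0" by simp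
    qed
    moreover have "y \<notin> vec.span (e ` UNIV)"
    proof
      assume "y \<in> vec.span (e ` UNIV)"
      then have "h z y y = 0"
        by (rule vec.span_induct) (auto simp: o vec.subspace_def h_simps[OF z])
      then show False using h_self(1)[OF z y] by simp
    qed
    ultimately have ind: "vec.independent (insert y (e ` UNIV))" and n: "y \<notin> e ` UNIV"
      using vec.independent_insertI vec.span_base by blast+
    have "card (insert y (e ` UNIV)) \<le> vec.dim (UNIV :: (complex^'n) set)"
      using vec.independent_card_le_dim[OF _ ind] by blast
    then show False using n by (simp add: vec_dim_card card_cart_basis card_image[OF inj])
  qed
  then show ?thesis by (simp add: y_def)
qed

text \<open>Orthonormal families whose members satisfy \<open>Pr\<close> are enlarged one vector at a time. The predicate
  \<open>Pr\<close> is trivial for arbitrary frames and is that of being an eigenvector for eigenframes; prescribed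
  vectors are kept on \<open>I0\<close>.\<close>

lemma extend_unitary:
  assumes z: "z \<in> S" and step: "\<And>I e. card I < CARD('n) \<Longrightarrow> I0 \<subseteq> I \<Longrightarrow>
      (\<And>i j. i \<in> I \<Longrightarrow> j \<in> I \<Longrightarrow> h z (e i) (e j) = (if i = j then 1 else 0)) \<Longrightarrow> (\<And>i. i \<in> I \<Longrightarrow> Pr (e i)) \<Longrightarrow>
      \<exists>v. v \<noteq> 0 \<and> (\<forall>i\<in>I. h z v (e i) = 0) \<and> (\<forall>c. c \<noteq> 0 \<longrightarrow> Pr (c *s v))"
    and start: "\<And>i j. i \<in> I0 \<Longrightarrow> j \<in> I0 \<Longrightarrow> h z (e0 i) (e0 j) = (if i = j then 1 else 0)" "\<And>i. i \<in> I0 \<Longrightarrow> Pr (e0 i)"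
  shows "\<exists>e. unitary z e \<and> (\<forall>i. Pr (e i)) \<and> (\<forall>i\<in>I0. e i = e0 i)"
proof -
  have "\<exists>e. (\<forall>i\<in>I0 \<union> I. \<forall>j\<in>I0 \<union> I. h z (e i) (e j) = (if i = j then 1 else 0)) \<and> (\<forall>i\<in>I0 \<union> I. Pr (e i)) \<and> (\<forall>i\<in>I0. e i = e0 i)"
    if "finite I" for I :: "'n set"
    using that
  proof (induction I rule: finite_induct)
    case empty
    show ?case using start by (intro exI[of _ e0]) auto
  next
    case (insert k I)
    then obtain e where e: "\<forall>i\<in>I0 \<union> I. \<forall>j\<in>I0 \<union> I. h z (e i) (e j) = (if i = j then 1 else 0)"
       "\<forall>i\<in>I0 \<union> I. Pr (e i)" "\<forall>i\<in>I0. e i = e0 i" by blast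
    show ?case
    proof (cases "k \<in> I0")
      case True
      then have "I0 \<union> insert k I = I0 \<union> I" by auto
      then show ?thesis using e by metis
    next
      case False
      then have k: "k \<notin> I0 \<union> I" using insert by auto
      then have "card (I0 \<union> I) < CARD('n)"
        by (intro psubset_card_mono) auto
      then obtain v where v: "v \<noteq> 0" "\<forall>i\<in>I0 \<union> I. h z v (e i) = 0" "\<forall>c. c \<noteq> 0 \<longrightarrow> Pr (c *s v)"
        using step[of "I0 \<union> I" e] e by auto
      obtain c where c: "c \<noteq> 0" "h z (c *s v) (c *s v) = 1" using h_normalise[OF z v(1)] by blast
      have 1: "h z (c *s v) (e i) = 0" "h z (e i) (c *s v) = 0" if "i \<in> I0 \<union> I" for i
      proof -
        show "h z (c *s v) (e i) = 0" using v(2) that by (simp add: h_simps[OF z])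
        then show "h z (e i) (c *s v) = 0" using h_cnj[OF z, of "e i" "c *s v"] by simp
      qed
      show ?thesis
        using e v c 1 k by (intro exI[of _ "e(k := c *s v)"]) auto
    qed
  qed
  from this[of UNIV] show ?thesis by (simp add: unitary_def)
qed

lemma exists_unitary:
  assumes z: "z \<in> S"
  shows "\<exists>e. unitary z e"
proof -
  have "\<exists>e. unitary z e \<and> (\<forall>i. (\<lambda>_. True) (e i)) \<and> (\<forall>i\<in>{}. e i = 0)"
  proof (rule extend_unitary[OF z])
    fix I :: "'n set" and e
    assume "card I < CARD('n)" "\<And>i j. i \<in> I \<Longrightarrow> j \<in> I \<Longrightarrow> h z (e i) (e j) = (if i = j then 1 else 0)"
    then show "\<exists>v. v \<noteq> 0 \<and> (\<forall>i\<in>I. h z v (e i) = 0) \<and> (\<forall>c. c \<noteq> 0 \<longrightarrow> True)"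
      using exists_h_orthogonal[OF z, of I e] by auto
  qed auto
  then show ?thesis by blast
qed

lemma ev_g:
  assumes z: "z \<in> S"
  shows "ev (True, x) (\<lambda>y. complex_of_real (g z k y)) = h z k x / 2"
    "ev (False, x) (\<lambda>y. complex_of_real (g z k y)) = cnj (h z k x) / 2"
  by (simp_all add: ev_def sgi_def h_def complex_eq_iff)

text \<open>Expansion of \<open>k\<close> in the basis \<open>e\<^sub>i - iJe\<^sub>i\<close>, \<open>e\<^sub>i + iJe\<^sub>i\<close> of the complexified tangent space, whose dual
  basis with respect to \<open>g\<close> consists of the conjugates. All contractions below use it.\<close>

lemma frame_expand:
  assumes z: "z \<in> S" and e: "unitary z e" and lin: "linear (\<phi> :: complex^'n \<Rightarrow> complex)"
  shows "\<phi> k = (\<Sum>\<^sub>U i. ev (False, e i) \<phi> * ev (True, e i) (\<lambda>y. complex_of_real (g z k y))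
                + ev (True, e i) \<phi> * ev (False, e i) (\<lambda>y. complex_of_real (g z k y)))"
proof -
  have "\<phi> k = \<phi> (\<Sum>\<^sub>U i. h z k (e i) *s e i)" using unitary_expansion[OF z e] by simp
  also have "\<dots> = (\<Sum>\<^sub>U i. Re (h z k (e i)) *\<^sub>R \<phi> (e i) + Im (h z k (e i)) *\<^sub>R \<phi> (Jop (e i)))"
    by (simp add: linear_sum[OF lin] scale_eq linear_add[OF lin] linear_cmul[OF lin])
  also have "\<dots> = (\<Sum>\<^sub>U i. ev (False, e i) \<phi> * ev (True, e i) (\<lambda>y. complex_of_real (g z k y))
                + ev (True, e i) \<phi> * ev (False, e i) (\<lambda>y. complex_of_real (g z k y)))"
    unfolding ev_g[OF z]
    by (intro sum.cong refl) (simp add: ev_def sgi_def complex_eq_iff field_simps)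
  finally show ?thesis .
qed

text \<open>If \<open>B\<close> maps two vectors of type \<open>(1,0)\<close> to one of type \<open>(1,0)\<close>, its pairing with a third one vanishes, because
  the complexified metric is zero on \<open>(1,0)\<close> vectors.\<close>

lemma no_pure_type_component:
  assumes z: "z \<in> S" and B: "\<And>x y. B (Jop x) y + B x (Jop y) = Jop (B x y - B (Jop x) (Jop y))"
  shows "ext3 (\<lambda>x y w. g z (B x y) w) (b, x) (b, y) (b, w) = 0"
proof -
  define A where "A = B x y - B (Jop x) (Jop y)"
  have 1: "g z (B x y) v = g z A v + g z (B (Jop x) (Jop y)) v"
     "g z (B (Jop x) y) v = g z (Jop A) v - g z (B x (Jop y)) v" for v
    using B[of x y] by (simp_all add: A_def g_simps[OF z] eq_diff_eq[symmetric])
  show ?thesis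
    unfolding ext3_def ev_def sgi_def
    by (cases b) (simp_all add: 1 g_simps[OF z] g_J[OF z] g_J_left[OF z] complex_eq_iff)
qed

end

locale bkl_frame = bkl_chart S g G
  for S :: "(complex^'n::finite) set" and g :: "'n local_metric" and G :: "'n local_conn" +
  fixes z :: "complex^'n" and e :: "'n \<Rightarrow> complex^'n"
  assumes z: "z \<in> S" and e: "unitary z e"
begin

abbreviation "pl i \<equiv> (False, e i)"
abbreviation "mi i \<equiv> (True, e i)"

definition "Hc = ext3 (H z)"
definition "Pc = ext4 (P z)"
definition "Qc = ext5 (Q z)"

lemma bar_simps [simp]: "bar (pl i) = mi i" "bar (mi i) = pl i"
  by (simp_all add: bar_def)

lemma Hc_skew: "Hc b a c = - Hc a b c" "Hc a c b = - Hc a b c"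
  unfolding Hc_def by (rule ext3_swap12[OF H_skew(1)[OF z]], rule ext3_swap23[OF H_skew(2)[OF z]])

lemma Hc_cyc: "Hc b c a = Hc a b c"
  by (simp add: Hc_skew(1)[of a b c] Hc_skew(2)[of b c a] del: minus_minus)

lemma Pc_skew: "Pc b a c d = - Pc a b c d" "Pc a c b d = - Pc a b c d" "Pc a b d c = - Pc a b c d"
  unfolding Pc_def by (rule ext4_swap12[OF P_skew12[OF z]], rule ext4_swap23[OF P_skew23[OF z]], rule ext4_swap34[OF P_skew34[OF z]])

lemma Qc_skew: "Qc a c b d f = - Qc a b c d f" "Qc a b d c f = - Qc a b c d f" "Qc a b c f d = - Qc a b c d f"
  unfolding Qc_def by (rule ext5_swap23[OF Q_skew(1)[OF z]], rule ext5_swap34[OF Q_skew(2)[OF z]], rule ext5_swap45[OF Q_skew(3)[OF z]])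

lemma cnj_Hc: "cnj (Hc a b c) = Hc (bar a) (bar b) (bar c)" unfolding Hc_def by (rule cnj_ext3)
lemma cnj_Pc: "cnj (Pc a b c d) = Pc (bar a) (bar b) (bar c) (bar d)" unfolding Pc_def by (rule cnj_ext4)
lemma Hc_type: "Hc (b, x) (b, y) (b, w) = 0"
  unfolding Hc_def H_def[abs_def] by (rule no_pure_type_component[OF z, where B = "torsion_of z", OF torsion_J[OF z]])

lemma Pc_type: "Pc a (b, x) (b, y) (b, w) = 0"
  unfolding Pc_def ext4_def P_def[abs_def] no_pure_type_component[OF z, where B = "nabla_T z _", OF nabla_T_J[OF z]] by (simp add: ev_simps)

lemma Qc_type: "Qc a a' (b, x) (b, y) (b, w) = 0"
  unfolding Qc_def ext5_def ext4_def Q_def[abs_def] no_pure_type_component[OF z, where B = "nabla2_T z _ _", OF nabla2_T_J[OF z]] by (simp add: ev_simps)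

lemma Pc_type': "Pc (b, x) a (b, y) (b, w) = 0" "Pc (b, x) (b, y) a (b, w) = 0" "Pc (b, x) (b, y) (b, w) a = 0"
  using Pc_skew(1)[of a "(b, x)" "(b, y)" "(b, w)"] Pc_skew(2)[of "(b, x)" a "(b, y)" "(b, w)"]
    Pc_skew(3)[of "(b, x)" "(b, y)" a "(b, w)"] by (simp_all add: Pc_type)

text \<open>Inserting a torsion vector into a tensor becomes a sum over the frame and its conjugate.\<close>

lemma linear_of_real: "linear f \<Longrightarrow> linear (\<lambda>x. complex_of_real (f x))"
  by (simp add: linear_iff scaleR_conv_of_real)

lemma linear_g: "linear (g z u)" "linear (\<lambda>u. g z u w)"
  using g_bilinear[OF z] by (auto simp: bilinear_def)

lemma linear_P4: "linear (P z u x y)"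
  unfolding P_def[abs_def] by (rule linear_g)
lemma linear_P1: "linear (\<lambda>u. P z u x y w)"
  unfolding P_def[abs_def] by (rule linear_compose[OF linear_nabla_T_first[OF z] linear_g(2), unfolded o_def])

lemma contract_HH:
  "ev a (\<lambda>x. ev b (\<lambda>y. ev c (\<lambda>w. ev d (\<lambda>v. complex_of_real (g z (torsion_of z x y) (torsion_of z w v))))))
   = (\<Sum>\<^sub>U i. Hc a b (pl i) * Hc c d (mi i) + Hc a b (mi i) * Hc c d (pl i))"
proof -
  have "complex_of_real (g z (torsion_of z x y) (torsion_of z w v)) = (\<Sum>i\<in>UNIV.
      ev (pl i) (\<lambda>k. complex_of_real (H z x y k)) * ev (mi i) (\<lambda>k. complex_of_real (H z w v k))
    + ev (mi i) (\<lambda>k. complex_of_real (H z x y k)) * ev (pl i) (\<lambda>k. complex_of_real (H z w v k)))" for x y w v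
    unfolding H_def by (rule frame_expand[OF z e linear_of_real[OF linear_g(1)]])
  then show ?thesis by (simp add: ev_simps Hc_def ext3_def)
qed

lemma contract_PH_last:
  "ev u (\<lambda>u. ev x (\<lambda>x. ev y (\<lambda>y. ev w (\<lambda>w. ev v (\<lambda>v. complex_of_real (P z u x y (torsion_of z w v)))))))
   = (\<Sum>\<^sub>U i. Pc u x y (pl i) * Hc w v (mi i) + Pc u x y (mi i) * Hc w v (pl i))"
proof -
  have "complex_of_real (P z u x y (torsion_of z w v)) = (\<Sum>i\<in>UNIV.
      ev (pl i) (\<lambda>k. complex_of_real (P z u x y k)) * ev (mi i) (\<lambda>k. complex_of_real (H z w v k))
    + ev (mi i) (\<lambda>k. complex_of_real (P z u x y k)) * ev (pl i) (\<lambda>k. complex_of_real (H z w v k)))" for u x y w v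
    unfolding H_def by (rule frame_expand[OF z e linear_of_real[OF linear_P4]])
  then show ?thesis by (simp add: ev_simps Hc_def Pc_def ext4_def ext3_def)
qed

lemma contract_PH_first:
  "ev v (\<lambda>v. ev u (\<lambda>u. ev x (\<lambda>x. ev y (\<lambda>y. ev w (\<lambda>w. complex_of_real (P z (torsion_of z v u) x y w))))))
   = (\<Sum>\<^sub>U i. Pc (pl i) x y w * Hc v u (mi i) + Pc (mi i) x y w * Hc v u (pl i))"
proof -
  have "complex_of_real (P z (torsion_of z v u) x y w) = (\<Sum>i\<in>UNIV.
      ev (pl i) (\<lambda>k. complex_of_real (P z k x y w)) * ev (mi i) (\<lambda>k. complex_of_real (H z v u k))
    + ev (mi i) (\<lambda>k. complex_of_real (P z k x y w)) * ev (pl i) (\<lambda>k. complex_of_real (H z v u k)))" for x y w u v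
    unfolding H_def by (rule frame_expand[OF z e linear_of_real[OF linear_P1]])
  then show ?thesis
    by (simp add: ev_simps Hc_def Pc_def ext4_def ext3_def ev_commute[of _ "pl _"] ev_commute[of _ "mi _"])
qed

lemma three_Pc:
  "3 * Pc a b c d = - (\<Sum>i\<in>UNIV.
      Hc a b (pl i) * Hc c d (mi i) + Hc a b (mi i) * Hc c d (pl i)
    + Hc b c (pl i) * Hc a d (mi i) + Hc b c (mi i) * Hc a d (pl i)
    + Hc c a (pl i) * Hc b d (mi i) + Hc c a (mi i) * Hc b d (pl i))"
proof -
  have 1: "complex_of_real (P z u x y w) * 3 = - (complex_of_real (g z (torsion_of z u x) (torsion_of z y w))
      + complex_of_real (g z (torsion_of z x y) (torsion_of z u w)) + complex_of_real (g z (torsion_of z y u) (torsion_of z x w)))" for u x y w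
  proof -
    have "complex_of_real (3 * P z u x y w) = complex_of_real (- sigma z u x y w)" by (simp only: three_P[OF z])
    then show ?thesis by (simp add: sigma_def mult.commute)
  qed
  have "3 * Pc a b c d = ev a (\<lambda>u. ev b (\<lambda>x. ev c (\<lambda>y. ev d (\<lambda>w. complex_of_real (P z u x y w) * 3))))"
    by (simp add: ev_simps Pc_def ext4_def ext3_def)
  also have "\<dots> = - (ev a (\<lambda>x. ev b (\<lambda>y. ev c (\<lambda>w. ev d (\<lambda>v. complex_of_real (g z (torsion_of z x y) (torsion_of z w v))))))
     + ev b (\<lambda>x. ev c (\<lambda>y. ev a (\<lambda>w. ev d (\<lambda>v. complex_of_real (g z (torsion_of z x y) (torsion_of z w v))))))
     + ev c (\<lambda>x. ev a (\<lambda>y. ev b (\<lambda>w. ev d (\<lambda>v. complex_of_real (g z (torsion_of z x y) (torsion_of z w v)))))))"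
    unfolding 1 by (simp only: ev_simps ev_commute[of b a] ev_commute[of c a] ev_commute[of c b])
  also have "\<dots> = - (\<Sum>i\<in>UNIV.
      Hc a b (pl i) * Hc c d (mi i) + Hc a b (mi i) * Hc c d (pl i)
    + Hc b c (pl i) * Hc a d (mi i) + Hc b c (mi i) * Hc a d (pl i)
    + Hc c a (pl i) * Hc b d (mi i) + Hc c a (mi i) * Hc b d (pl i))"
    unfolding contract_HH by (simp add: sum.distrib)
  finally show ?thesis .
qed

lemma three_Qc:
  "3 * Qc v a b c d = - (\<Sum>i\<in>UNIV.
      Pc v a b (pl i) * Hc c d (mi i) + Pc v a b (mi i) * Hc c d (pl i)
    + Pc v c d (pl i) * Hc a b (mi i) + Pc v c d (mi i) * Hc a b (pl i)
    + Pc v b c (pl i) * Hc a d (mi i) + Pc v b c (mi i) * Hc a d (pl i)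
    + Pc v a d (pl i) * Hc b c (mi i) + Pc v a d (mi i) * Hc b c (pl i)
    + Pc v c a (pl i) * Hc b d (mi i) + Pc v c a (mi i) * Hc b d (pl i)
    + Pc v b d (pl i) * Hc c a (mi i) + Pc v b d (mi i) * Hc c a (pl i))"
proof -
  have 1: "complex_of_real (Q z v u x y w) * 3 = - (
       complex_of_real (P z v u x (torsion_of z y w)) + complex_of_real (P z v y w (torsion_of z u x))
     + complex_of_real (P z v x y (torsion_of z u w)) + complex_of_real (P z v u w (torsion_of z x y))
     + complex_of_real (P z v y u (torsion_of z x w)) + complex_of_real (P z v x w (torsion_of z y u)))" for v u x y w
    using arg_cong[OF three_Q[OF z, of v u x y w], of complex_of_real] by (simp add: mult.commute)
  have "3 * Qc v a b c d = ev v (\<lambda>v. ev a (\<lambda>u. ev b (\<lambda>x. ev c (\<lambda>y. ev d (\<lambda>w. complex_of_real (Q z v u x y w) * 3)))))"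
    by (simp add: ev_simps Qc_def ext5_def ext4_def ext3_def)
  also have "\<dots> = - (
       ev v (\<lambda>u. ev a (\<lambda>x. ev b (\<lambda>y. ev c (\<lambda>w. ev d (\<lambda>v. complex_of_real (P z u x y (torsion_of z w v)))))))
     + ev v (\<lambda>u. ev c (\<lambda>x. ev d (\<lambda>y. ev a (\<lambda>w. ev b (\<lambda>v. complex_of_real (P z u x y (torsion_of z w v)))))))
     + ev v (\<lambda>u. ev b (\<lambda>x. ev c (\<lambda>y. ev a (\<lambda>w. ev d (\<lambda>v. complex_of_real (P z u x y (torsion_of z w v)))))))
     + ev v (\<lambda>u. ev a (\<lambda>x. ev d (\<lambda>y. ev b (\<lambda>w. ev c (\<lambda>v. complex_of_real (P z u x y (torsion_of z w v)))))))
     + ev v (\<lambda>u. ev c (\<lambda>x. ev a (\<lambda>y. ev b (\<lambda>w. ev d (\<lambda>v. complex_of_real (P z u x y (torsion_of z w v)))))))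
     + ev v (\<lambda>u. ev b (\<lambda>x. ev d (\<lambda>y. ev c (\<lambda>w. ev a (\<lambda>v. complex_of_real (P z u x y (torsion_of z w v))))))))"
    unfolding 1 by (simp only: ev_simps ev_commute[of b a] ev_commute[of c a] ev_commute[of c b]
       ev_commute[of d a] ev_commute[of d b] ev_commute[of d c])
  finally show ?thesis
    unfolding contract_PH_last by (simp add: sum.distrib)
qed

text \<open>On a pair of \<open>(1,0)\<close> directions the curvature vanishes and only the torsion term of the
  Ricci identity is left.\<close>

lemma ricci_Qc:
  "Qc (b, v) (b, u) x y w - Qc (b, u) (b, v) x y w
    = - (\<Sum>\<^sub>U i. Pc (pl i) x y w * Hc (b, v) (b, u) (mi i) + Pc (mi i) x y w * Hc (b, v) (b, u) (pl i))"
proof -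
  define F where "F v u = ev x (\<lambda>x. ev y (\<lambda>y. ev w (\<lambda>w. complex_of_real
     (H z (Rop z v u x) y w + H z x (Rop z v u y) w + H z x y (Rop z v u w)))))" for v u
  have F1: "F (Jop v) (Jop u) = F v u" for v u by (simp add: F_def Rop_JJ[OF z])
  have F2: "F v (Jop u) = - F (Jop v) u" for v u
    unfolding F_def Rop_J_right[OF z]
    by (simp add: H_def torsion_simps[OF z] g_simps[OF z] ev_simps)
  (* F changes sign when J is moved from one argument to the other, so it has no (2,0) part *)
  have Fz: "ev (b, v) (\<lambda>v. ev (b, u) (\<lambda>u. F v u)) = 0"
    by (simp add: ev_def F1[of v u] F2[of v u] sgi_def algebra_simps)
  have "Qc (b, v) (b, u) x y w - Qc (b, u) (b, v) x y w =
     ev (b, v) (\<lambda>v. ev (b, u) (\<lambda>u. ev x (\<lambda>x. ev y (\<lambda>y. ev w (\<lambda>w. complex_of_real (Q z v u x y w - Q z u v x y w))))))"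
    unfolding Qc_def ext5_def ext4_def ext3_def by (subst (2) ev_commute) (simp add: ev_simps)
  also have "\<dots> = - ev (b, v) (\<lambda>v. ev (b, u) (\<lambda>u. F v u)) -
     ev (b, v) (\<lambda>v. ev (b, u) (\<lambda>u. ev x (\<lambda>x. ev y (\<lambda>y. ev w (\<lambda>w. complex_of_real (P z (torsion_of z v u) x y w))))))"
    unfolding ricci_H[OF z] F_def by (simp add: ev_simps)
  finally show ?thesis unfolding contract_PH_first Fz by simp
qed

end

section \<open>The identities for torsion and its derivative in components\<close>

text \<open>Nested sums as sums over tuples, so that summation indices can be permuted by one reindexing.\<close>

lemma sum4_tuple: "(\<Sum>\<^sub>U a b c d. F a b c d)
    = (\<Sum>(a, b, c, d)\<in>(UNIV :: ('a::finite \<times> 'b::finite \<times> 'c::finite \<times> 'd::finite) set). F a b c d)"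
  by (simp add: sum.cartesian_product)

lemma sum5_tuple: "(\<Sum>\<^sub>U a b c d f. F a b c d f)
    = (\<Sum>(a, b, c, d, f)\<in>(UNIV :: ('a::finite \<times> 'b::finite \<times> 'c::finite \<times> 'd::finite \<times> 'e::finite) set). F a b c d f)"
  by (simp add: sum.cartesian_product)

lemma sum4_antisym_swaps:
  fixes F :: "'a::finite \<Rightarrow> 'a \<Rightarrow> 'a \<Rightarrow> 'a \<Rightarrow> complex"
  assumes "\<And>w y u m. F y w m u = - F w y u m"
  shows "(\<Sum>\<^sub>U w y u m. F w y u m) = 0"
proof -
  have "(\<Sum>\<^sub>U w y u m. F w y u m) = (\<Sum>\<^sub>U w y u m. - F w y u m)"
    unfolding sum4_tuple
    by (rule sum.reindex_bij_witness[of _ "\<lambda>(w, y, u, m). (y, w, m, u)" "\<lambda>(w, y, u, m). (y, w, m, u)"])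
      (auto simp: assms[symmetric])
  then have "2 * (\<Sum>\<^sub>U w y u m. F w y u m) = 0"
    unfolding sum_negf by algebra
  then show ?thesis by simp
qed

lemma sum4_antisym_rotation:
  fixes F :: "'a::finite \<Rightarrow> 'a \<Rightarrow> 'a \<Rightarrow> 'a \<Rightarrow> complex"
  assumes "\<And>w y u m. F u m w y = - F w y u m"
  shows "(\<Sum>\<^sub>U w y u m. F w y u m) = 0"
proof -
  have "(\<Sum>\<^sub>U w y u m. F w y u m) = (\<Sum>\<^sub>U w y u m. - F w y u m)"
    unfolding sum4_tuple
    by (rule sum.reindex_bij_witness[of _ "\<lambda>(w, y, u, m). (u, m, w, y)" "\<lambda>(w, y, u, m). (u, m, w, y)"])
      (auto simp: assms[symmetric])
  then have "2 * (\<Sum>\<^sub>U w y u m. F w y u m) = 0"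
    unfolding sum_negf by algebra
  then show ?thesis by simp
qed

lemma sum3_swap13: "(\<Sum>a\<in>A. \<Sum>b\<in>B. \<Sum>c\<in>C. F a b c) = (\<Sum>c\<in>C. \<Sum>b\<in>B. \<Sum>a\<in>A. F a b c)"
  by (subst sum.swap[of _ C B], subst (2) sum.swap, subst sum.swap[of _ B A]) (rule refl)

text \<open>Here \<open>t k i j\<close> is the \<open>e\<^sub>k\<close> component of the torsion of \<open>e\<^sub>i\<close> and \<open>e\<^sub>j\<close>, and \<open>p x y z w\<close> is \<open>P\<close> on
  \<open>e\<^sub>x\<close>, \<open>e\<^sub>y\<close> and the conjugates of \<open>e\<^sub>z\<close>, \<open>e\<^sub>w\<close>. The assumption \<open>p_eq\<close> is the \<open>(2,2)\<close> part of
  \<open>3P = -\<sigma>\<close>, \<open>jacobi\<close> its \<open>(3,1)\<close> part, where \<open>P\<close> vanishes.\<close>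

locale torsion_components =
  fixes t :: "'n::finite \<Rightarrow> 'n \<Rightarrow> 'n \<Rightarrow> complex" and p :: "'n \<Rightarrow> 'n \<Rightarrow> 'n \<Rightarrow> 'n \<Rightarrow> complex"
  assumes t_skew: "t k j i = - t k i j"
    and p_skew12: "p y x z w = - p x y z w" and p_skew34: "p x y w z = - p x y z w"
    and p_cnj: "cnj (p x y z w) = p z w x y"
    and p_eq: "3 * p x y z w = - (\<Sum>\<^sub>U k. t k x y * cnj (t k z w) - t z y k * cnj (t x w k)
        - cnj (t y z k) * t w x k + t z x k * cnj (t y w k) + cnj (t x z k) * t w y k)"
    and jacobi: "(\<Sum>\<^sub>U k. t k x y * t w k u + t k y u * t w k x + t k u x * t w k y) = 0"
    and cubic: "(\<Sum>\<^sub>U k. t w x k * p y u z k) + (\<Sum>\<^sub>U k. t z x k * p y u k w) =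
       7/4 * (\<Sum>\<^sub>U k. t k y u * p k x z w) - 1/4 * (\<Sum>\<^sub>U k. t k u x * p k y z w)
       - 1/4 * (\<Sum>\<^sub>U k. t k x y * p k u z w)"
begin

text \<open>Up to constants \<open>eta\<close> is the Lee form, \<open>rho\<close> its derivative in the conjugate directions; \<open>mu\<close> and
  \<open>tau\<close> are the contractions of torsion with \<open>P\<close> and with \<open>rho\<close> that the traces of \<open>cubic\<close> produce.\<close>

definition rho :: "'n \<Rightarrow> 'n \<Rightarrow> complex" where "rho y z = (\<Sum>\<^sub>U w. p y w z w)"
definition eta :: "'n \<Rightarrow> complex" where "eta k = (\<Sum>\<^sub>U x. t x x k)"
definition mu :: "'n \<Rightarrow> 'n \<Rightarrow> 'n \<Rightarrow> complex" where
  "mu x y z = (\<Sum>\<^sub>U k w. t k y w * p k x z w)"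
definition tau :: "'n \<Rightarrow> complex" where
  "tau x = (\<Sum>\<^sub>U k w. t k x w * rho k w)"

lemma jacobi_contracted:
  "(\<Sum>\<^sub>U w y u m. t m k w * cnj (t m y u) * t w y u
     - 2 * (t u k m * cnj (t w y m) * t w y u)) = 0"
proof -
  let ?S = "\<lambda>F. (\<Sum>w\<in>(UNIV::'n set). \<Sum>y\<in>(UNIV::'n set). \<Sum>u\<in>(UNIV::'n set). \<Sum>m\<in>(UNIV::'n set). F w y u m :: complex)"
  define J1 where "J1 = ?S (\<lambda>w y u m. t m k y * t w m u * cnj (t w y u))"
  define J2 where "J2 = ?S (\<lambda>w y u m. t m y u * t w m k * cnj (t w y u))"
  define J3 where "J3 = ?S (\<lambda>w y u m. t m u k * t w m y * cnj (t w y u))"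
  have "J1 + J2 + J3 = ?S (\<lambda>w y u m. (t m k y * t w m u + t m y u * t w m k + t m u k * t w m y) * cnj (t w y u))"
    by (simp add: J1_def J2_def J3_def sum.distrib distrib_right)
  also have "\<dots> = 0"
    by (simp add: sum_distrib_right[symmetric] jacobi)
  finally have 0: "J1 + J2 + J3 = 0" .
  have e1: "t u k m * t w u y * cnj (t w m y) = t u k m * cnj (t w y m) * t w y u"
    and e2: "- (t w y u * t m w k * cnj (t m y u)) = t m k w * cnj (t m y u) * t w y u"
    and e3: "t m k u * t w m y * cnj (t w u y) = t m u k * t w m y * cnj (t w y u)" for w y u m
    by (simp_all add: t_skew[of w u y] t_skew[of w m y] t_skew[of m w k] t_skew[of m u k])
  have 1: "?S (\<lambda>w y u m. t u k m * cnj (t w y m) * t w y u) = J1"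
    unfolding J1_def sum4_tuple
    by (rule sum.reindex_bij_witness[of _ "\<lambda>(w, y, u, m). (w, u, m, y)" "\<lambda>(w, y, u, m). (w, m, y, u)"])
      (auto simp: e1)
  have 2: "?S (\<lambda>w y u m. t m k w * cnj (t m y u) * t w y u) = - J2"
    unfolding J2_def sum4_tuple sum_negf[symmetric]
    by (rule sum.reindex_bij_witness[of _ "\<lambda>(w, y, u, m). (m, y, u, w)" "\<lambda>(w, y, u, m). (m, y, u, w)"])
      (auto simp: e2)
  have 3: "J3 = J1"
    unfolding J1_def J3_def sum4_tuple
    by (rule sum.reindex_bij_witness[of _ "\<lambda>(w, y, u, m). (w, u, y, m)" "\<lambda>(w, y, u, m). (w, u, y, m)"])
      (auto simp: e3)
  have "?S (\<lambda>w y u m. t m k w * cnj (t m y u) * t w y u - 2 * (t u k m * cnj (t w y m) * t w y u)) = - J2 - 2 * J1"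
    unfolding 1[symmetric] 2[symmetric] sum_distrib_left by (simp add: sum_subtractf)
  also have "- J2 - 2 * J1 = 0" using 0 unfolding 3 by algebra
  finally show ?thesis .
qed

text \<open>This contraction of \<open>P\<close> with the torsion is the derivative of \<open>|T|\<^sup>2\<close>. Substituting \<open>p_eq\<close>, two of the
  five terms vanish by antisymmetry under a permutation of the indices, and the other three add up to the
  contracted Jacobi identity.\<close>

lemma torsion_contraction: "(\<Sum>\<^sub>U w y u. p k w y u * t w y u) = 0"
proof -
  let ?S = "\<lambda>F. (\<Sum>w\<in>(UNIV::'n set). \<Sum>y\<in>(UNIV::'n set). \<Sum>u\<in>(UNIV::'n set). \<Sum>m\<in>(UNIV::'n set). F w y u m :: complex)"
  have z2: "?S (\<lambda>w y u m. t y w m * cnj (t k u m) * t w y u) = 0"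
  proof (rule sum4_antisym_swaps)
    show "t w y u * cnj (t k m u) * t y w m = - (t y w m * cnj (t k u m) * t w y u)" for w y u m
      by (simp add: t_skew[of k m u])
  qed
  have z5: "?S (\<lambda>w y u m. cnj (t k y m) * t u w m * t w y u) = 0"
  proof (rule sum4_antisym_rotation)
    show "cnj (t k m y) * t w u y * t u m w = - (cnj (t k y m) * t u w m * t w y u)" for w y u m
      by (simp add: t_skew[of k m y] t_skew[of w u y] t_skew[of u m w])
  qed
  have z4: "?S (\<lambda>w y u m. t y k m * cnj (t w u m) * t w y u) = - ?S (\<lambda>w y u m. t u k m * cnj (t w y m) * t w y u)"
  proof -
    have e: "- (t y k m * cnj (t w u m) * t w u y) = t y k m * cnj (t w u m) * t w y u" for w y u m
      by (simp add: t_skew[of w u y])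
    show ?thesis
      unfolding sum4_tuple sum_negf[symmetric]
      by (rule sum.reindex_bij_witness[of _ "\<lambda>(w, y, u, m). (w, u, y, m)" "\<lambda>(w, y, u, m). (w, u, y, m)"])
        (auto simp: e)
  qed
  have "3 * (\<Sum>\<^sub>U w y u. p k w y u * t w y u)
    = (\<Sum>\<^sub>U w y u. (3 * p k w y u) * t w y u)"
    by (simp add: sum_distrib_left mult.assoc)
  also have "\<dots> = - ?S (\<lambda>w y u m. (t m k w * cnj (t m y u) * t w y u - 2 * (t u k m * cnj (t w y m) * t w y u))
       - t y w m * cnj (t k u m) * t w y u + (t u k m * cnj (t w y m) * t w y u + t y k m * cnj (t w u m) * t w y u)
       + cnj (t k y m) * t u w m * t w y u)"
    unfolding p_eq sum_negf[symmetric] sum_distrib_right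
    by (intro sum.cong refl) (simp add: algebra_simps)
  also have "\<dots> = 0"
    using jacobi_contracted[of k] z2 z4 z5
    unfolding sum.distrib sum_subtractf sum_distrib_left[symmetric] by algebra
  finally show ?thesis by simp
qed

text \<open>The trace of \<open>cubic\<close> over \<open>u = w\<close>.\<close>

lemma mu_relation:
  "(\<Sum>\<^sub>U k. t z x k * rho y k) - mu y x z = 7/4 * mu x y z + 1/4 * mu y x z - 1/4 * (\<Sum>\<^sub>U k. t k x y * rho k z)"
proof -
  have 1: "(\<Sum>\<^sub>U u k. t u x k * p y u z k) = - mu y x z"
    unfolding mu_def sum_negf[symmetric] by (intro sum.cong refl) (subst p_skew12, simp)
  have 2: "(\<Sum>\<^sub>U u k. t z x k * p y u k u) = (\<Sum>\<^sub>U k. t z x k * rho y k)"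
    by (subst sum.swap) (simp add: rho_def sum_distrib_left)
  have 3: "(\<Sum>\<^sub>U u k. t k y u * p k x z u) = mu x y z"
    by (subst sum.swap) (simp add: mu_def)
  have 4: "(\<Sum>\<^sub>U u k. t k u x * p k y z u) = - mu y x z"
    by (subst sum.swap) (simp add: mu_def sum_negf[symmetric] t_skew[of _ _ x])
  have 5: "(\<Sum>\<^sub>U u k. t k x y * p k u z u) = (\<Sum>\<^sub>U k. t k x y * rho k z)"
    by (subst sum.swap) (simp add: rho_def sum_distrib_left)
  have "(\<Sum>\<^sub>U u. (\<Sum>\<^sub>U k. t u x k * p y u z k) + (\<Sum>\<^sub>U k. t z x k * p y u k u)) =
     (\<Sum>\<^sub>U u. 7/4 * (\<Sum>\<^sub>U k. t k y u * p k x z u) - 1/4 * (\<Sum>\<^sub>U k. t k u x * p k y z u)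
       - 1/4 * (\<Sum>\<^sub>U k. t k x y * p k u z u))"
    by (intro sum.cong refl cubic)
  then have "- mu y x z + (\<Sum>\<^sub>U k. t z x k * rho y k) = 7/4 * mu x y z - 1/4 * (- mu y x z)
      - 1/4 * (\<Sum>\<^sub>U k. t k x y * rho k z)"
    unfolding sum.distrib sum_subtractf sum_distrib_left[symmetric] 1 2 3 4 5 .
  then show ?thesis by (simp add: algebra_simps)
qed

lemma mu_trace_last: "(\<Sum>\<^sub>U y. mu x y y) = 0"
proof -
  have "(\<Sum>\<^sub>U y. mu x y y) = (\<Sum>\<^sub>U k y w. t k y w * p k x y w)"
    unfolding mu_def by (rule sum.swap)
  also have "\<dots> = - (\<Sum>\<^sub>U k y w. p x k y w * t k y w)"
    unfolding sum_negf[symmetric] by (intro sum.cong refl) (subst p_skew12, simp)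
  finally show ?thesis by (simp add: torsion_contraction)
qed

lemma mu_trace_first: "(\<Sum>\<^sub>U y. mu y x y) = - tau x"
proof -
  have "(\<Sum>\<^sub>U y. mu y x y) = (\<Sum>\<^sub>U k w y. t k x w * p k y y w)"
    unfolding mu_def by (subst sum.swap) (intro sum.cong refl sum.swap)
  also have "\<dots> = - tau x"
    unfolding tau_def rho_def sum_negf[symmetric] sum_distrib_left
    by (intro sum.cong refl) (subst p_skew34, simp)
  finally show ?thesis .
qed

text \<open>The trace of \<open>mu_relation\<close> over \<open>z = y\<close> reads \<open>2 tau = -tau/2\<close>, since the traces of \<open>mu\<close> are \<open>0\<close> and
  \<open>-tau\<close>. The trace over \<open>z = x\<close> then gives \<open>eta_rho\<close>.\<close>

lemma tau_zero: "tau x = 0"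
proof -
  have "(\<Sum>\<^sub>U y. (\<Sum>\<^sub>U k. t y x k * rho y k) - mu y x y) =
     (\<Sum>\<^sub>U y. 7/4 * mu x y y + 1/4 * mu y x y - 1/4 * (\<Sum>\<^sub>U k. t k x y * rho k y))"
    by (intro sum.cong refl mu_relation)
  moreover have "(\<Sum>\<^sub>U y k. t k x y * rho k y) = tau x"
    unfolding tau_def by (rule sum.swap)
  ultimately have "tau x + tau x = - (1/4) * tau x - 1/4 * tau x"
    unfolding sum.distrib sum_subtractf sum_distrib_left[symmetric] mu_trace_last mu_trace_first tau_def[symmetric]
    by simp
  then have "4 * tau x = - tau x" by (simp add: field_simps)
  then have "5 * tau x = 0" by algebra
  then show ?thesis by simp
qed

lemma eta_rho: "(\<Sum>\<^sub>U k. eta k * rho y k) = 0"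
proof -
  have "(\<Sum>\<^sub>U x. (\<Sum>\<^sub>U k. t x x k * rho y k) - mu y x x) =
     (\<Sum>\<^sub>U x. 7/4 * mu x y x + 1/4 * mu y x x - 1/4 * (\<Sum>\<^sub>U k. t k x y * rho k x))"
    by (intro sum.cong refl mu_relation)
  moreover have "(\<Sum>\<^sub>U x k. t k x y * rho k x) = - tau y"
    unfolding tau_def sum_negf[symmetric]
    by (subst sum.swap) (simp add: t_skew[of _ _ y] sum_negf)
  moreover have "(\<Sum>\<^sub>U x k. t x x k * rho y k) = (\<Sum>\<^sub>U k. eta k * rho y k)"
    unfolding eta_def sum_distrib_right by (rule sum.swap)
  ultimately show ?thesis
    unfolding sum.distrib sum_subtractf sum_distrib_left[symmetric] mu_trace_last mu_trace_first tau_zero by simp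
qed

text \<open>The summand is twice a component of the second covariant derivative of \<open>H\<close> (\<open>two_qc\<close> below), so
  the contraction is a divergence of \<open>rho\<close>; it consists of \<open>tau\<close> and of \<open>torsion_contraction\<close>.\<close>

lemma divergence_zero:
  "(\<Sum>\<^sub>U u y. - (\<Sum>\<^sub>U m. t m u x * p m y u y) + (\<Sum>\<^sub>U m. t m x y * p m u u y)
     - (\<Sum>\<^sub>U m. t m y u * p m x u y)) = 0"
proof -
  have 1: "(\<Sum>\<^sub>U u y m. t m u x * p m y u y) = - tau x"
  proof -
    have "(\<Sum>\<^sub>U u y m. t m u x * p m y u y) = (\<Sum>\<^sub>U u m. t m u x * rho m u)"
      unfolding rho_def sum_distrib_left by (intro sum.cong refl sum.swap)
    also have "\<dots> = - tau x"
      unfolding tau_def sum_negf[symmetric] by (subst sum.swap) (simp add: t_skew[of _ _ x] sum_negf)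
    finally show ?thesis .
  qed
  have 2: "(\<Sum>\<^sub>U u y m. t m x y * p m u u y) = - tau x"
    unfolding mu_trace_first[symmetric] mu_def by (intro sum.cong refl sum.swap)
  have 3: "(\<Sum>\<^sub>U u y m. t m y u * p m x u y) = 0"
  proof -
    have "(\<Sum>\<^sub>U u y m. t m y u * p m x u y) = (\<Sum>\<^sub>U m y u. t m y u * p m x u y)"
      by (rule sum3_swap13)
    also have "\<dots> = (\<Sum>\<^sub>U m y u. p x m y u * t m y u)"
      by (intro sum.cong refl) (subst p_skew12, subst p_skew34, simp)
    finally show ?thesis by (simp add: torsion_contraction)
  qed
  show ?thesis using 1 2 3 by (simp add: sum.distrib sum_subtractf sum_negf tau_zero)
qed

context
  assumes rho_zero: "\<And>y z. rho y z = 0"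
begin

lemma mu_zero: "mu x y z = 0"
proof -
  have a: "5 * mu y x z = - 7 * mu x y z" for x y
  proof -
    have "- 4 * mu y x z = mu y x z + 7 * mu x y z"
      using mu_relation[of z x y] by (simp add: rho_zero field_simps)
    then show ?thesis by algebra
  qed
  have "25 * mu x y z = 49 * mu x y z" using a[of x y] a[of y x] by algebra
  then show ?thesis by simp
qed

text \<open>The trace of \<open>cubic\<close> over \<open>x = z\<close>, where everything else is a contraction \<open>mu\<close> or \<open>rho\<close>.\<close>

lemma eta_contraction: "(\<Sum>\<^sub>U x k. t w x k * p y u x k) = - (\<Sum>\<^sub>U k. eta k * p y u k w)"
proof -
  have "(\<Sum>\<^sub>U x. (\<Sum>\<^sub>U k. t w x k * p y u x k) + (\<Sum>\<^sub>U k. t x x k * p y u k w)) =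
       (\<Sum>\<^sub>U x. 7/4 * (\<Sum>\<^sub>U k. t k y u * p k x x w) - 1/4 * (\<Sum>\<^sub>U k. t k u x * p k y x w)
       - 1/4 * (\<Sum>\<^sub>U k. t k x y * p k u x w))"
    by (intro sum.cong refl cubic)
  moreover have "(\<Sum>\<^sub>U x k. t x x k * p y u k w) = (\<Sum>\<^sub>U k. eta k * p y u k w)"
    unfolding eta_def sum_distrib_right by (rule sum.swap)
  moreover have "(\<Sum>\<^sub>U x k. t k y u * p k x x w) = (\<Sum>\<^sub>U k. - t k y u * rho k w)"
    unfolding rho_def sum_distrib_left
    by (subst sum.swap) (intro sum.cong refl, subst p_skew34, simp)
  moreover have "(\<Sum>\<^sub>U x k. t k u x * p k y x w) = - mu y u w"
    unfolding mu_def sum_negf[symmetric]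
    by (subst sum.swap) (intro sum.cong refl, subst p_skew34, simp)
  moreover have "(\<Sum>\<^sub>U x k. t k x y * p k u x w) = mu u y w"
    unfolding mu_def
    by (subst sum.swap) (intro sum.cong refl, subst p_skew34, subst t_skew, simp)
  ultimately show ?thesis
    unfolding sum.distrib sum_subtractf sum_distrib_left[symmetric] rho_zero mu_zero by (simp add: add_eq_0_iff)
qed

text \<open>Pair \<open>3P = -\<sigma>\<close> with \<open>P\<close>. Four of the five terms contain a contraction \<open>mu\<close>. The first one is, by
  \<open>eta_contraction\<close>, the Lee form applied to \<open>torsion_contraction\<close>.\<close>

lemma p_zero: "p x y z w = 0"
proof -
  let ?T = "\<lambda>F. (\<Sum>x\<in>(UNIV::'n set). \<Sum>y\<in>(UNIV::'n set). \<Sum>z\<in>(UNIV::'n set). \<Sum>w\<in>(UNIV::'n set). \<Sum>k\<in>(UNIV::'n set). F x y z w k :: complex)"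
  have 1: "?T (\<lambda>x y z w k. p x y z w * (cnj (t k x y) * t k z w)) = 0"
  proof -
    have "?T (\<lambda>x y z w k. p x y z w * (cnj (t k x y) * t k z w)) =
      (\<Sum>\<^sub>U x y k z w. p x y z w * (cnj (t k x y) * t k z w))"
      unfolding sum5_tuple
      by (rule sum.reindex_bij_witness[of _ "\<lambda>(x, y, k, z, w). (x, y, z, w, k)" "\<lambda>(x, y, z, w, k). (x, y, k, z, w)"]) auto
    also have "\<dots> = (\<Sum>\<^sub>U x y k. cnj (t k x y) * (\<Sum>\<^sub>U z w. t k z w * p x y z w))"
      unfolding sum_distrib_left by (intro sum.cong refl) simp
    also have "\<dots> = - (\<Sum>\<^sub>U x y k m. eta m * (cnj (t k x y) * p x y m k))"
      unfolding eta_contraction sum_negf[symmetric] mult_minus_right sum_distrib_left by (intro sum.cong refl) simp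
    also have "\<dots> = - (\<Sum>\<^sub>U m k x y. eta m * (cnj (t k x y) * p x y m k))"
      unfolding sum4_tuple neg_equal_iff_equal
      by (rule sum.reindex_bij_witness[of _ "\<lambda>(m, k, x, y). (x, y, k, m)" "\<lambda>(x, y, k, m). (m, k, x, y)"]) auto
    also have "\<dots> = - (\<Sum>\<^sub>U m. eta m * cnj (\<Sum>\<^sub>U k x y. p m k x y * t k x y))"
      unfolding sum_distrib_left cnj_sum complex_cnj_mult p_cnj by (simp add: mult_ac)
    finally show ?thesis by (simp add: torsion_contraction)
  qed
  have inner: "(\<Sum>\<^sub>U a b. t a b k * p a y z b) = 0" for k y z
  proof -
    have "(\<Sum>\<^sub>U a b. t a b k * p a y z b) = - mu y k z"
      unfolding mu_def sum_negf[symmetric] by (intro sum.cong refl) (subst t_skew, simp)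
    then show ?thesis by (simp add: mu_zero)
  qed
  have 2: "?T (\<lambda>x y z w k. p x y z w * (cnj (t z y k) * t x w k)) = 0"
  proof -
    have "?T (\<lambda>x y z w k. p x y z w * (cnj (t z y k) * t x w k)) =
      (\<Sum>\<^sub>U y z k x w. cnj (t z y k) * (t x w k * p x y z w))"
      unfolding sum5_tuple
      by (rule sum.reindex_bij_witness[of _ "\<lambda>(y, z, k, x, w). (x, y, z, w, k)" "\<lambda>(x, y, z, w, k). (y, z, k, x, w)"]) auto
    then show ?thesis by (simp add: sum_distrib_left[symmetric] inner)
  qed
  have 3: "?T (\<lambda>x y z w k. p x y z w * (t y z k * cnj (t w x k))) = 0"
  proof -
    have e: "p x y z w = p y x w z" for x y z w by (subst p_skew12, subst p_skew34) simp
    have "?T (\<lambda>x y z w k. p x y z w * (t y z k * cnj (t w x k))) =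
      (\<Sum>\<^sub>U x w k y z. cnj (t w x k) * (t y z k * p y x w z))"
      unfolding sum5_tuple
      by (rule sum.reindex_bij_witness[of _ "\<lambda>(x, w, k, y, z). (x, y, z, w, k)" "\<lambda>(x, y, z, w, k). (x, w, k, y, z)"]) (auto simp: e[symmetric])
    then show ?thesis by (simp add: sum_distrib_left[symmetric] inner)
  qed
  have inner4: "(\<Sum>\<^sub>U y w. t y w k * p x y z w) = 0" for k x z
  proof -
    have "(\<Sum>\<^sub>U y w. t y w k * p x y z w) = - (\<Sum>\<^sub>U y w. t y w k * p y x z w)"
      unfolding sum_negf[symmetric] by (intro sum.cong refl) (subst p_skew12, simp)
    then show ?thesis by (simp add: inner)
  qed
  have inner5: "(\<Sum>\<^sub>U x z. t x z k * p x y z w) = 0" for k y w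
  proof -
    have "(\<Sum>\<^sub>U x z. t x z k * p x y z w) = - (\<Sum>\<^sub>U x z. t x z k * p x y w z)"
      unfolding sum_negf[symmetric] by (intro sum.cong refl) (subst p_skew34, simp)
    then show ?thesis by (simp add: inner)
  qed
  have 4: "?T (\<lambda>x y z w k. p x y z w * (cnj (t z x k) * t y w k)) = 0"
  proof -
    have "?T (\<lambda>x y z w k. p x y z w * (cnj (t z x k) * t y w k)) =
      (\<Sum>\<^sub>U x z k y w. cnj (t z x k) * (t y w k * p x y z w))"
      unfolding sum5_tuple
      by (rule sum.reindex_bij_witness[of _ "\<lambda>(x, z, k, y, w). (x, y, z, w, k)" "\<lambda>(x, y, z, w, k). (x, z, k, y, w)"]) auto
    then show ?thesis by (simp add: sum_distrib_left[symmetric] inner4)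
  qed
  have 5: "?T (\<lambda>x y z w k. p x y z w * (t x z k * cnj (t w y k))) = 0"
  proof -
    have "?T (\<lambda>x y z w k. p x y z w * (t x z k * cnj (t w y k))) =
      (\<Sum>\<^sub>U y w k x z. cnj (t w y k) * (t x z k * p x y z w))"
      unfolding sum5_tuple
      by (rule sum.reindex_bij_witness[of _ "\<lambda>(y, w, k, x, z). (x, y, z, w, k)" "\<lambda>(x, y, z, w, k). (y, w, k, x, z)"]) auto
    then show ?thesis by (simp add: sum_distrib_left[symmetric] inner5)
  qed
  have "(\<Sum>\<^sub>U x y z w. p x y z w * cnj (3 * p x y z w))
    = - ?T (\<lambda>x y z w k. p x y z w * (cnj (t k x y) * t k z w) - p x y z w * (cnj (t z y k) * t x w k)
       - p x y z w * (t y z k * cnj (t w x k)) + p x y z w * (cnj (t z x k) * t y w k) + p x y z w * (t x z k * cnj (t w y k)))"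
    unfolding p_eq sum_negf[symmetric]
    by (intro sum.cong refl) (simp add: sum_distrib_left sum_negf[symmetric], intro sum.cong refl, simp add: algebra_simps)
  also have "\<dots> = 0" using 1 2 3 4 5 by (simp add: sum.distrib sum_subtractf)
  finally have "(\<Sum>\<^sub>U x y z w. p x y z w * cnj (3 * p x y z w)) = 0" .
  moreover have "p x y z w * cnj (3 * p x y z w) = complex_of_real (3 * (norm (p x y z w))\<^sup>2)" for x y z w
    by (simp only: of_real_mult complex_norm_square) simp
  ultimately have "complex_of_real (\<Sum>\<^sub>U x y z w. 3 * (norm (p x y z w))\<^sup>2) = 0"
    by (simp only: of_real_sum)
  then have "(\<Sum>\<^sub>U x y z w. 3 * (norm (p x y z w))\<^sup>2) = 0"
    by (simp only: of_real_eq_0_iff)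
  then show ?thesis
    by (simp add: sum_nonneg_eq_0_iff sum_nonneg)
qed

end
end

section \<open>Comparison of the two formulas for the second derivative\<close>

context bkl_frame
begin

definition tc :: "'n \<Rightarrow> 'n \<Rightarrow> 'n \<Rightarrow> complex" where "tc k i j = Hc (pl i) (pl j) (mi k)"
definition pc :: "'n \<Rightarrow> 'n \<Rightarrow> 'n \<Rightarrow> 'n \<Rightarrow> complex" where "pc x y u w = Pc (pl x) (pl y) (mi u) (mi w)"
definition qc :: "'n \<Rightarrow> 'n \<Rightarrow> 'n \<Rightarrow> 'n \<Rightarrow> 'n \<Rightarrow> complex" where "qc u x y v w = Qc (pl u) (pl x) (pl y) (mi v) (mi w)"

lemma Hc_table:
  "Hc (pl a) (pl b) (pl c) = 0" "Hc (mi a) (mi b) (mi c) = 0"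
  "Hc (pl a) (pl b) (mi c) = tc c a b" "Hc (pl a) (mi b) (pl c) = tc b c a" "Hc (mi a) (pl b) (pl c) = tc a b c"
  "Hc (mi a) (mi b) (pl c) = cnj (tc c a b)" "Hc (mi a) (pl b) (mi c) = cnj (tc b c a)" "Hc (pl a) (mi b) (mi c) = cnj (tc a b c)"
  unfolding tc_def cnj_Hc bar_simps by (simp_all only: Hc_type) (metis Hc_cyc)+

lemma tc_skew: "tc k j i = - tc k i j" unfolding tc_def by (rule Hc_skew)

lemma Pc_table:
  "Pc (pl x) (pl y) (mi u) (mi w) = pc x y u w" "Pc (pl x) (mi u) (pl y) (mi w) = - pc x y u w"
  "Pc (pl x) (mi u) (mi w) (pl y) = pc x y u w" "Pc (mi u) (pl x) (pl y) (mi w) = pc x y u w"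
  "Pc (mi u) (pl x) (mi w) (pl y) = - pc x y u w" "Pc (mi u) (mi w) (pl x) (pl y) = pc x y u w"
proof -
  show 1: "Pc (pl x) (pl y) (mi u) (mi w) = pc x y u w" for x y u w by (simp add: pc_def)
  show 2: "Pc (pl x) (mi u) (pl y) (mi w) = - pc x y u w" for x y u w
    using Pc_skew(2)[of "pl x" "mi u" "pl y" "mi w"] 1 by simp
  show 3: "Pc (pl x) (mi u) (mi w) (pl y) = pc x y u w" for x y u w
    using Pc_skew(3)[of "pl x" "mi u" "mi w" "pl y"] 2 by simp
  show 4: "Pc (mi u) (pl x) (pl y) (mi w) = pc x y u w" for x y u w
    using Pc_skew(1)[of "mi u" "pl x" "pl y" "mi w"] 2 by simp
  show 5: "Pc (mi u) (pl x) (mi w) (pl y) = - pc x y u w" for x y u w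
    using Pc_skew(3)[of "mi u" "pl x" "mi w" "pl y"] 4 by simp
  show "Pc (mi u) (mi w) (pl x) (pl y) = pc x y u w"
    using Pc_skew(2)[of "mi u" "mi w" "pl x" "pl y"] 5 by simp
qed

lemmas Pc_zero = Pc_type Pc_type'

lemma pc_skew12: "pc y x u w = - pc x y u w" unfolding pc_def by (rule Pc_skew)
lemma pc_skew34: "pc x y w u = - pc x y u w" unfolding pc_def by (rule Pc_skew)
lemma pc_cnj: "cnj (pc x y u w) = pc u w x y"
  unfolding pc_def cnj_Pc by (simp add: Pc_table)

lemma pc_eq: "3 * pc x y v w = - (\<Sum>\<^sub>U k. tc k x y * cnj (tc k v w) - tc v y k * cnj (tc x w k)
        - cnj (tc y v k) * tc w x k + tc v x k * cnj (tc y w k) + cnj (tc x v k) * tc w y k)"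
  unfolding pc_def three_Pc neg_equal_iff_equal
proof (intro sum.cong refl)
  fix i
  show "Hc (pl x) (pl y) (pl i) * Hc (mi v) (mi w) (mi i) + Hc (pl x) (pl y) (mi i) * Hc (mi v) (mi w) (pl i) +
         Hc (pl y) (mi v) (pl i) * Hc (pl x) (mi w) (mi i) + Hc (pl y) (mi v) (mi i) * Hc (pl x) (mi w) (pl i) +
         Hc (mi v) (pl x) (pl i) * Hc (pl y) (mi w) (mi i) + Hc (mi v) (pl x) (mi i) * Hc (pl y) (mi w) (pl i) =
      tc i x y * cnj (tc i v w) - tc v y i * cnj (tc x w i)
        - cnj (tc y v i) * tc w x i + tc v x i * cnj (tc y w i) + cnj (tc x v i) * tc w y i"
    by (simp add: Hc_table tc_skew[of v i y] tc_skew[of w i x] tc_skew[of x i v] tc_skew[of w i y])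
qed

lemma tc_jacobi: "(\<Sum>\<^sub>U k. tc k x y * tc w k u + tc k y u * tc w k x + tc k u x * tc w k y) = 0"
proof -
  have "3 * Pc (pl x) (pl y) (pl u) (mi w) = 0" by (simp add: Pc_zero)
  then show ?thesis
    unfolding three_Pc by (simp add: Hc_table)
qed

lemma qc_ricci: "qc u x y v w - qc x u y v w = - (\<Sum>\<^sub>U k. tc k u x * pc k y v w)"
  unfolding qc_def ricci_Qc by (simp add: Hc_table Pc_table mult.commute)

lemma qc_skew: "qc u y x v w = - qc u x y v w"
  unfolding qc_def by (rule Qc_skew)

text \<open>A tensor that is skew in its last arguments is determined by its skew part in the first two, exactly
  as a metric connection is determined by its torsion. Here that skew part is the torsion
  term of the Ricci identity.\<close>

lemma two_qc: "2 * qc u x y v w = - (\<Sum>\<^sub>U k. tc k u x * pc k y v w) + (\<Sum>\<^sub>U k. tc k x y * pc k u v w)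
    - (\<Sum>\<^sub>U k. tc k y u * pc k x v w)"
  using qc_ricci[of u x y v w] qc_ricci[of x y u v w] qc_ricci[of y u x v w]
    qc_skew[of u y x v w] qc_skew[of x u y v w] qc_skew[of y x u v w] by algebra

lemma three_qc: "3 * qc u x y v w = (\<Sum>\<^sub>U k. tc k x y * pc k u v w)
    - ((\<Sum>\<^sub>U k. tc w x k * pc y u v k) + (\<Sum>\<^sub>U k. tc v x k * pc y u k w))
    - ((\<Sum>\<^sub>U k. tc w y k * pc u x v k) + (\<Sum>\<^sub>U k. tc v y k * pc u x k w))"
  unfolding qc_def three_Qc sum_negf[symmetric] sum.distrib[symmetric] sum_subtractf[symmetric]
proof (intro sum.cong refl)
  fix i
  show "- (Pc (pl u) (pl x) (pl y) (pl i) * Hc (mi v) (mi w) (mi i) + Pc (pl u) (pl x) (pl y) (mi i) * Hc (mi v) (mi w) (pl i) +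
       Pc (pl u) (mi v) (mi w) (pl i) * Hc (pl x) (pl y) (mi i) + Pc (pl u) (mi v) (mi w) (mi i) * Hc (pl x) (pl y) (pl i) +
       Pc (pl u) (pl y) (mi v) (pl i) * Hc (pl x) (mi w) (mi i) + Pc (pl u) (pl y) (mi v) (mi i) * Hc (pl x) (mi w) (pl i) +
       Pc (pl u) (pl x) (mi w) (pl i) * Hc (pl y) (mi v) (mi i) + Pc (pl u) (pl x) (mi w) (mi i) * Hc (pl y) (mi v) (pl i) +
       Pc (pl u) (mi v) (pl x) (pl i) * Hc (pl y) (mi w) (mi i) + Pc (pl u) (mi v) (pl x) (mi i) * Hc (pl y) (mi w) (pl i) +
       Pc (pl u) (pl y) (mi w) (pl i) * Hc (mi v) (pl x) (mi i) + Pc (pl u) (pl y) (mi w) (mi i) * Hc (mi v) (pl x) (pl i)) =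
     tc i x y * pc i u v w - (tc w x i * pc y u v i + tc v x i * pc y u i w) - (tc w y i * pc u x v i + tc v y i * pc u x i w)"
    by (simp add: Hc_table Pc_table Pc_zero pc_skew12[of u i] pc_skew12[of u y] pc_skew34[of _ _ w i]
        tc_skew[of w i x] tc_skew[of v i y] tc_skew[of w i y] tc_skew[of v i x] algebra_simps)
qed

text \<open>Eliminating the second derivative between \<open>two_qc\<close> and \<open>three_qc\<close> leaves three linear equations, one for
  each cyclic permutation of \<open>x\<close>, \<open>y\<close>, \<open>u\<close>, which determine \<open>E\<close> from \<open>f\<close>.\<close>

lemma tc_cubic: "(\<Sum>\<^sub>U k. tc w x k * pc y u v k) + (\<Sum>\<^sub>U k. tc v x k * pc y u k w) =
       7/4 * (\<Sum>\<^sub>U k. tc k y u * pc k x v w) - 1/4 * (\<Sum>\<^sub>U k. tc k u x * pc k y v w)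
       - 1/4 * (\<Sum>\<^sub>U k. tc k x y * pc k u v w)"
proof -
  define E where "E x y u = (\<Sum>\<^sub>U k. tc w x k * pc y u v k) + (\<Sum>\<^sub>U k. tc v x k * pc y u k w)" for x y u
  define f where "f x y u = (\<Sum>\<^sub>U k. tc k x y * pc k u v w)" for x y u
  have a: "2 * qc u x y v w = - f u x y + f x y u - f y u x" for x y u unfolding f_def by (rule two_qc)
  have b: "3 * qc u x y v w = f x y u - E x y u - E y u x" for x y u unfolding f_def E_def by (rule three_qc)
  have r: "- 2 * E x y u - 2 * E y u x = f x y u - 3 * f y u x - 3 * f u x y" for x y u
    using a[of u x y] b[of u x y] by algebra
  have "4 * E x y u = 7 * f y u x - f u x y - f x y u"
    using r[of x y u] r[of y u x] r[of u x y] by algebra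
  then have "(1/4) * (4 * E x y u) = (1/4) * (7 * f y u x - f u x y - f x y u)" by (rule arg_cong)
  then have "E x y u = 7/4 * f y u x - 1/4 * f u x y - 1/4 * f x y u"
    by (simp add: algebra_simps)
  then show ?thesis unfolding E_def f_def .
qed

sublocale torsion_components tc pc
  by unfold_locales (rule tc_skew pc_skew12 pc_skew34 pc_cnj pc_eq tc_jacobi tc_cubic)+

end

section \<open>The Lee form and the Lee vector field\<close>

text \<open>The Lee form is a trace over the tangent space, in which no metric occurs; it is therefore
  differentiated in a fixed basis.\<close>

definition rtrace :: "('v::euclidean_space \<Rightarrow> 'v) \<Rightarrow> real" where
  "rtrace L = (\<Sum>b\<in>Basis. L b \<bullet> b)"

lemma rtrace_commute:
  fixes A B :: "'v::euclidean_space \<Rightarrow> 'v"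
  assumes A: "linear A" and B: "linear B"
  shows "rtrace (\<lambda>x. A (B x)) = rtrace (\<lambda>x. B (A x))"
proof -
  have e: "A (B x) \<bullet> y = (\<Sum>c\<in>Basis. (B x \<bullet> c) * (A c \<bullet> y))" if "linear A" "linear B" for A B :: "'v \<Rightarrow> 'v" and x y
  proof -
    have "A (B x) = A (\<Sum>c\<in>Basis. (B x \<bullet> c) *\<^sub>R c)" by (simp add: euclidean_representation)
    also have "\<dots> = (\<Sum>c\<in>Basis. (B x \<bullet> c) *\<^sub>R A c)" using that by (simp add: linear_sum linear_cmul)
    finally show ?thesis by (simp add: inner_sum_left)
  qed
  have "rtrace (\<lambda>x. A (B x)) = (\<Sum>b\<in>Basis. \<Sum>c\<in>Basis. (B b \<bullet> c) * (A c \<bullet> b))"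
    by (simp add: rtrace_def e[OF A B])
  also have "\<dots> = (\<Sum>c\<in>Basis. \<Sum>b\<in>Basis. (B b \<bullet> c) * (A c \<bullet> b))" by (rule sum.swap)
  also have "\<dots> = rtrace (\<lambda>x. B (A x))"
    by (simp add: rtrace_def e[OF B A] mult.commute)
  finally show ?thesis .
qed

lemma rtrace_linear:
  "rtrace (\<lambda>x. L x + M x) = rtrace L + rtrace M" "rtrace (\<lambda>x. L x - M x) = rtrace L - rtrace M"
  "rtrace (\<lambda>x. c *\<^sub>R L x) = c * rtrace L"
  by (simp_all add: rtrace_def inner_add_left inner_diff_left sum.distrib sum_subtractf sum_distrib_left)

lemma differentiable_det:
  fixes A :: "'v::real_normed_vector \<Rightarrow> complex^'n^'n"
  assumes "\<And>i j. (\<lambda>z. A z $ i $ j) differentiable (at p)"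
  shows "(\<lambda>z. det (A z)) differentiable (at p)"
proof -
  have prod: "(\<lambda>z. \<Prod>i\<in>I. A z $ i $ s i) differentiable (at p)" if "finite I" for s :: "'n \<Rightarrow> 'n" and I :: "'n set"
    using that by (induction I rule: finite_induct) (auto intro!: assms differentiable_mult)
  show ?thesis unfolding det_def
    by (intro differentiable_sum ballI differentiable_mult differentiable_const prod) (simp_all add: finite_permutations)
qed

lemma vec_axis_expansion: "(y :: complex^'n::finite) = (\<Sum>\<^sub>U i. Re (y $ i) *\<^sub>R axis i 1 + Im (y $ i) *\<^sub>R Jop (axis i 1))"
  by (simp add: vec_eq_iff Jop_def axis_def if_distrib[of "\<lambda>t. _ * t"] if_distrib[of "\<lambda>t. _ *\<^sub>R t"] sum.distrib complex_eq_iff cong: if_cong)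

context bkl_chart
begin

definition lee :: "complex^'n \<Rightarrow> complex^'n \<Rightarrow> real" where
  "lee z y = rtrace (\<lambda>x. Jop (torsion_of z x y))"
definition nabla_lee :: "complex^'n \<Rightarrow> complex^'n \<Rightarrow> complex^'n \<Rightarrow> real" where
  "nabla_lee z u y = rtrace (\<lambda>x. Jop (nabla_T z u x y))"
definition nabla2_lee :: "complex^'n \<Rightarrow> complex^'n \<Rightarrow> complex^'n \<Rightarrow> complex^'n \<Rightarrow> real" where
  "nabla2_lee z v u y = rtrace (\<lambda>x. Jop (nabla2_T z v u x y))"

text \<open>Covariant differentiation commutes with traces: the two terms with Christoffel symbols are traces of a
  commutator.\<close>

lemma has_derivative_rtrace:
  assumes p: "p \<in> S" and F: "\<And>b. has_cov (\<lambda>w. F w b) (\<lambda>u. F' u b + F p (G p u b)) p" and lin: "linear (F p)"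
  shows "((\<lambda>w. rtrace (F w)) has_derivative (\<lambda>u. rtrace (F' u))) (at p)"
proof -
  have "((\<lambda>w. rtrace (F w)) has_derivative (\<lambda>u. \<Sum>b\<in>Basis. (F' u b + F p (G p u b) - G p u (F p b)) \<bullet> b)) (at p)"
    unfolding rtrace_def by (intro has_derivative_sum has_derivative_inner_left has_cov_D[OF F])
  moreover have "(\<Sum>b\<in>Basis. (F' u b + F p (G p u b) - G p u (F p b)) \<bullet> b) = rtrace (F' u)" for u
    using rtrace_commute[OF lin linear_G(2)[OF p], of u]
    by (simp add: rtrace_def inner_add_left inner_diff_left sum.distrib sum_subtractf)
  ultimately show ?thesis by simp
qed

lemma has_cov_const: "has_cov (\<lambda>_. c) (\<lambda>x. G p x c) p" by (simp add: has_cov_def)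

lemma linear_torsion: "z \<in> S \<Longrightarrow> linear (\<lambda>x. torsion_of z x y)" "z \<in> S \<Longrightarrow> linear (torsion_of z x)"
  using torsion_bilinear by (auto simp: bilinear_def)

lemma linear_nabla_T: "z \<in> S \<Longrightarrow> linear (\<lambda>x. nabla_T z u x y)" "z \<in> S \<Longrightarrow> linear (nabla_T z u x)"
  using nabla_T_bilinear by (auto simp: bilinear_def)

lemma linear_J: "linear f \<Longrightarrow> linear (\<lambda>x. Jop (f x))"
  using linear_compose[OF _ linear_Jop] by (simp add: o_def)

lemma has_derivative_lee:
  assumes p: "p \<in> S" and a: "has_cov a A p"
  shows "((\<lambda>w. lee w (a w)) has_derivative (\<lambda>u. nabla_lee p u (a p) + lee p (A u))) (at p)"
proof -
  have "((\<lambda>w. rtrace (\<lambda>x. Jop (torsion_of w x (a w)))) has_derivative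
     (\<lambda>u. rtrace (\<lambda>x. Jop (nabla_T p u x (a p)) + Jop (torsion_of p x (A u))))) (at p)"
  proof (rule has_derivative_rtrace[OF p])
    show "has_cov (\<lambda>w. Jop (torsion_of w b (a w)))
       (\<lambda>u. Jop (nabla_T p u b (a p)) + Jop (torsion_of p b (A u)) + Jop (torsion_of p (G p u b) (a p))) p" for b
      using has_cov_J[OF p has_cov_T[OF p has_cov_const a, of b]] by (simp add: add_ac)
  qed (rule linear_J[OF linear_torsion(1)[OF p]])
  then show ?thesis by (simp add: lee_def nabla_lee_def rtrace_linear)
qed

lemma has_derivative_nabla_lee:
  assumes p: "p \<in> S" and c: "has_cov c C p" and a: "has_cov a A p"
  shows "((\<lambda>w. nabla_lee w (c w) (a w)) has_derivative
     (\<lambda>v. nabla2_lee p v (c p) (a p) + nabla_lee p (C v) (a p) + nabla_lee p (c p) (A v))) (at p)"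
proof -
  have "((\<lambda>w. rtrace (\<lambda>x. Jop (nabla_T w (c w) x (a w)))) has_derivative
     (\<lambda>v. rtrace (\<lambda>x. Jop (nabla2_T p v (c p) x (a p)) + Jop (nabla_T p (C v) x (a p)) + Jop (nabla_T p (c p) x (A v))))) (at p)"
  proof (rule has_derivative_rtrace[OF p])
    show "has_cov (\<lambda>w. Jop (nabla_T w (c w) b (a w)))
       (\<lambda>v. Jop (nabla2_T p v (c p) b (a p)) + Jop (nabla_T p (C v) b (a p)) + Jop (nabla_T p (c p) b (A v))
          + Jop (nabla_T p (c p) (G p v b) (a p))) p" for b
      using has_cov_J[OF p has_cov_nabla_T[OF p c has_cov_const a, of b]] by (simp add: add_ac)
  qed (rule linear_J[OF linear_nabla_T(1)[OF p]])
  then show ?thesis by (simp add: nabla_lee_def nabla2_lee_def rtrace_linear)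
qed

lemma linear_lee: "z \<in> S \<Longrightarrow> linear (lee z)"
  by (rule linearI) (simp_all add: lee_def torsion_simps rtrace_linear)

lemma linear_nabla_lee: "z \<in> S \<Longrightarrow> linear (nabla_lee z u)" "z \<in> S \<Longrightarrow> linear (\<lambda>u. nabla_lee z u y)"
  by (rule linearI; simp add: nabla_lee_def nabla_T_simps rtrace_linear)+

text \<open>The dual of the Lee form. In the complex coordinates of the chart it solves a linear system whose
  matrix is that of the Hermitian form; by Cramer's rule the solution depends differentiably on the
  point.\<close>

lemma lee_vector_exists:
  "\<exists>E. \<forall>w\<in>S. (\<forall>y. g w (E w) y = lee w y) \<and> E differentiable (at w)"
proof -
  define M where "M w = (\<chi> i j. h w (axis i 1) (axis j 1))" for w
  define f where "f w = (\<chi> i. Complex (2 * lee w (axis i 1)) (- 2 * lee w (Jop (axis i 1))))" for w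
  define d where "d k w = det (\<chi> i j. if j = k then f w $ i else M w $ i $ j) / det (M w)" for k w
  define E where "E w = (\<Sum>\<^sub>U k. Re (d k w) *\<^sub>R axis k 1 - Im (d k w) *\<^sub>R Jop (axis k 1))" for w
  have hM: "(M w *v c) $ i = h w (axis i 1) (\<Sum>\<^sub>U k. cnj (c $ k) *s axis k 1)" if w: "w \<in> S" for w c i
    by (simp add: M_def matrix_vector_mult_def h_sum_right[OF w] h_simps[OF w] mult.commute)
  have sum_axis: "(\<Sum>\<^sub>U k. c $ k *s axis k 1) = c" for c :: "complex^'n"
    by (simp add: vec_eq_iff axis_def if_distrib[of "\<lambda>t. _ * t"] cong: if_cong)
  have det: "det (M w) \<noteq> 0" if w: "w \<in> S" for w
  proof -
    have "c = 0" if "M w *v c = 0" for c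
    proof -
      define v where "v = (\<Sum>\<^sub>U k. cnj (c $ k) *s axis k (1::complex))"
      have 0: "h w (axis i 1) v = 0" for i using hM[OF w, of c i] that by (simp add: v_def)
      have "h w v v = h w (\<Sum>\<^sub>U k. v $ k *s axis k 1) v" by (simp add: sum_axis)
      also have "\<dots> = 0" by (simp add: h_sum[OF w] h_simps[OF w] 0)
      finally have v: "v = 0" using h_self(1)[OF w] by blast
      have "v $ k = cnj (c $ k)" for k
        using sum_axis[of "\<chi> k. cnj (c $ k)"] by (simp add: v_def vec_eq_iff)
      then show ?thesis using v by (simp add: vec_eq_iff)
    qed
    then have "\<exists>B. B ** M w = mat 1" using matrix_left_invertible_ker by blast
    then show ?thesis
      using invertible_left_inverse invertible_det_nz by blast
  qed
  have gE: "g w (E w) y = lee w y" if w: "w \<in> S" for w y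
  proof -
    define c where "c = (\<chi> k. d k w)"
    have "M w *v c = f w" using cramer[OF det[OF w], of c "f w"] by (simp add: c_def d_def)
    moreover have "(\<Sum>\<^sub>U k. cnj (c $ k) *s axis k 1) = E w"
      by (simp add: E_def c_def scale_eq)
    ultimately have hE: "h w (axis i 1) (E w) = f w $ i" for i using hM[OF w, of c i] by simp
    have 1: "g w (E w) (axis i 1) = lee w (axis i 1)" for i
      using hE[of i] by (simp add: h_def f_def g_sym[OF w, of "E w"])
    have 2: "g w (E w) (Jop (axis i 1)) = lee w (Jop (axis i 1))" for i
      using hE[of i] by (simp add: h_def f_def g_sym[OF w, of "E w"] g_J_left[OF w])
    have lg: "linear (g w (E w))" using g_bilinear[OF w] by (simp add: bilinear_def)
    show ?thesis
      by (subst (1 2) vec_axis_expansion[of y])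
        (simp add: linear_sum[OF lg] linear_add[OF lg] linear_cmul[OF lg] linear_sum[OF linear_lee[OF w]]
           linear_add[OF linear_lee[OF w]] linear_cmul[OF linear_lee[OF w]] 1 2)
  qed
  have dE: "E differentiable (at w)" if w: "w \<in> S" for w
  proof -
    have cplx: "(\<lambda>z. Complex (a z) (b z)) differentiable (at w)"
      if "a differentiable (at w)" "b differentiable (at w)" for a b :: "complex^'n \<Rightarrow> real"
      unfolding Complex_eq using that
      by (intro differentiable_add differentiable_mult differentiable_const)
         (auto simp: differentiable_def intro: has_derivative_of_real)
    have dg: "(\<lambda>z. g z u v) differentiable (at w)" for u v
      using has_derivative_g_const[OF w] by (auto simp: differentiable_def)
    have dl: "(\<lambda>z. lee z y) differentiable (at w)" for y
      using has_derivative_lee[OF w has_cov_const] by (auto simp: differentiable_def)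
    have dM: "(\<lambda>z. M z $ i $ j) differentiable (at w)" for i j
      unfolding M_def h_def by (simp, intro cplx differentiable_mult differentiable_const dg)
    have df: "(\<lambda>z. f z $ i) differentiable (at w)" for i
      unfolding f_def by (simp, intro cplx differentiable_mult differentiable_minus differentiable_const dl)
    have dd: "d k differentiable (at w)" for k
    proof -
      have "(\<lambda>x. if j = k then f x $ i else M x $ i $ j) differentiable (at w)" for i j
        by (cases "j = k") (simp_all add: dM df)
      then show ?thesis unfolding d_def[abs_def]
        by (intro differentiable_divide differentiable_det det[OF w]) (simp_all add: dM)
    qed
    have "(\<lambda>z. Re (d k z)) differentiable (at w)" "(\<lambda>z. Im (d k z)) differentiable (at w)" for k
      using dd[of k] unfolding differentiable_def by (auto intro: has_derivative_Re has_derivative_Im)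
    then show ?thesis unfolding E_def[abs_def]
      by (intro differentiable_sum ballI differentiable_diff differentiable_scaleR differentiable_const) auto
  qed
  show ?thesis using gE dE by blast
qed

end

section \<open>The torsion is parallel\<close>

lemma ev_J: assumes "\<And>y. f (Jop (Jop y)) = - f y" shows "ev a (\<lambda>y. f (Jop y)) = - sgi (fst a) * ev a f"
  using assms by (simp add: ev_def sgi_def algebra_simps)

lemma (in hermitian_connection) linear_nabla2_T:
  assumes z: "z \<in> S"
  shows "linear (\<lambda>x. nabla2_T z v u x y)" "linear (nabla2_T z v u x)"
proof -
  have d: "(\<lambda>w. nabla_T w u x y) differentiable (at z)" for x y
    using has_derivative_nabla_T[OF z] unfolding differentiable_def by blast
  have lin: "linear (\<lambda>x. nabla_T w u x y)" "linear (nabla_T w u x)" if "w \<in> S" for w u x y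
    using nabla_T_bilinear[OF that] by (auto simp: bilinear_def)
  have 1: "linear (\<lambda>x. frechet_derivative (\<lambda>w. nabla_T w u x y) (at z) v)"
    by (rule linear_frechet_derivative_family[OF open_S z, where L = "\<lambda>w x. nabla_T w u x y", OF lin(1) d])
  have 2: "linear (\<lambda>y. frechet_derivative (\<lambda>w. nabla_T w u x y) (at z) v)"
    by (rule linear_frechet_derivative_family[OF open_S z, where L = "\<lambda>w. nabla_T w u x", OF lin(2) d])
  show "linear (\<lambda>x. nabla2_T z v u x y)"
    by (rule linearI) (simp_all add: nabla2_T_def linear_add[OF 1] linear_cmul[OF 1] nabla_T_simps[OF z] G_simps[OF z]
       scaleR_diff_right scaleR_add_right)
  show "linear (nabla2_T z v u x)"
    by (rule linearI) (simp_all add: nabla2_T_def linear_add[OF 2] linear_cmul[OF 2] nabla_T_simps[OF z] G_simps[OF z]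
       scaleR_diff_right scaleR_add_right)
qed

context bkl_frame
begin

lemma rtrace_frame:
  assumes K: "linear K"
  shows "complex_of_real (rtrace K) = (\<Sum>\<^sub>U j. ev (pl j) (\<lambda>x. ev (mi j) (\<lambda>y. complex_of_real (g z (K x) y)))
     + ev (mi j) (\<lambda>x. ev (pl j) (\<lambda>y. complex_of_real (g z (K x) y))))"
proof -
  have gK: "complex_of_real (g z (K x) y) = (\<Sum>b\<in>Basis. complex_of_real (K x \<bullet> b) * complex_of_real (g z b y))" for x y
  proof -
    have "g z (K x) y = g z (\<Sum>b\<in>Basis. (K x \<bullet> b) *\<^sub>R b) y" by (simp add: euclidean_representation)
    also have "\<dots> = (\<Sum>b\<in>Basis. (K x \<bullet> b) * g z b y)"
      by (simp add: linear_sum[OF linear_g(2)] linear_cmul[OF linear_g(2)])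
    finally show ?thesis by simp
  qed
  have lin: "linear (\<lambda>k. complex_of_real (K k \<bullet> b))" for b
    by (rule linear_of_real) (use K in \<open>simp add: linear_iff inner_add_left\<close>)
  have "complex_of_real (rtrace K) = (\<Sum>b\<in>Basis. complex_of_real (K b \<bullet> b))" by (simp add: rtrace_def)
  also have "\<dots> = (\<Sum>b\<in>Basis. \<Sum>\<^sub>U j. ev (pl j) (\<lambda>k. complex_of_real (K k \<bullet> b)) * ev (mi j) (\<lambda>y. complex_of_real (g z b y))
      + ev (mi j) (\<lambda>k. complex_of_real (K k \<bullet> b)) * ev (pl j) (\<lambda>y. complex_of_real (g z b y)))"
    by (intro sum.cong refl frame_expand[OF z e lin])
  also have "\<dots> = (\<Sum>\<^sub>U j. \<Sum>b\<in>Basis. ev (pl j) (\<lambda>k. complex_of_real (K k \<bullet> b)) * ev (mi j) (\<lambda>y. complex_of_real (g z b y))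
      + ev (mi j) (\<lambda>k. complex_of_real (K k \<bullet> b)) * ev (pl j) (\<lambda>y. complex_of_real (g z b y)))"
    by (rule sum.swap)
  finally show ?thesis unfolding gK by (simp add: ev_simps sum.distrib)
qed

lemma rtrace_J_frame:
  assumes L: "linear L"
  shows "complex_of_real (rtrace (\<lambda>x. Jop (L x))) = (\<Sum>\<^sub>U j. \<i> * ev (pl j) (\<lambda>x. ev (mi j) (\<lambda>y. complex_of_real (g z (L x) y)))
     - \<i> * ev (mi j) (\<lambda>x. ev (pl j) (\<lambda>y. complex_of_real (g z (L x) y))))"
proof -
  have J: "ev a (\<lambda>y. complex_of_real (g z (Jop u) y)) = sgi (fst a) * ev a (\<lambda>y. complex_of_real (g z u y))" for a u
    using ev_J[of "\<lambda>y. complex_of_real (g z u y)" a]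
    by (simp add: g_J_left[OF z] ev_simps g_simps[OF z])
  show ?thesis
    unfolding rtrace_frame[OF linear_J[OF L]] J by (simp add: ev_simps sgi_def)
qed

definition "NLc a b = ev a (\<lambda>u. ev b (\<lambda>y. complex_of_real (nabla_lee z u y)))"

lemma lee_frame: "ev b (\<lambda>y. complex_of_real (lee z y)) = (\<Sum>\<^sub>U j. \<i> * Hc (pl j) b (mi j) - \<i> * Hc (mi j) b (pl j))"
  unfolding lee_def rtrace_J_frame[OF linear_torsion(1)[OF z]]
  by (simp add: ev_simps Hc_def ext3_def H_def ev_commute[of b])

lemma NLc_frame: "NLc a b = (\<Sum>\<^sub>U j. \<i> * Pc a (pl j) b (mi j) - \<i> * Pc a (mi j) b (pl j))"
  unfolding NLc_def nabla_lee_def rtrace_J_frame[OF linear_nabla_T(1)[OF z]]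
  by (simp add: ev_simps Pc_def ext4_def ext3_def P_def ev_commute[of b])

lemma nabla2_lee_frame: "ev a (\<lambda>v. ev b (\<lambda>u. ev c (\<lambda>y. complex_of_real (nabla2_lee z v u y))))
   = (\<Sum>\<^sub>U j. \<i> * Qc a b (pl j) c (mi j) - \<i> * Qc a b (mi j) c (pl j))"
  unfolding nabla2_lee_def rtrace_J_frame[OF linear_nabla2_T(1)[OF z]]
  by (simp add: ev_simps Qc_def ext5_def ext4_def ext3_def Q_def ev_commute[of c])

lemma rho_cnj: "cnj (rho k i) = rho i k"
  unfolding rho_def by (simp add: pc_cnj)

lemma NLc_table: "NLc (mi i) (pl k) = - 2 * \<i> * rho k i" "NLc (mi i) (mi k) = 0"
proof -
  show "NLc (mi i) (pl k) = - 2 * \<i> * rho k i"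
    unfolding NLc_frame Pc_table rho_def sum_distrib_left
    by (intro sum.cong refl) (subst pc_skew12, simp)
  show "NLc (mi i) (mi k) = 0" unfolding NLc_frame by (simp add: Pc_zero)
qed

lemma lee_mi: "ev (mi k) (\<lambda>y. complex_of_real (lee z y)) = - 2 * \<i> * cnj (eta k)"
  unfolding lee_frame Hc_table eta_def cnj_sum sum_distrib_left
proof (intro sum.cong refl)
  fix j show "\<i> * cnj (tc j k j) - \<i> * cnj (tc j j k) = - 2 * \<i> * cnj (tc j j k)"
    by (simp add: tc_skew[of j k j])
qed

lemma ev_real_zero: "ev (mi i) (\<lambda>u. complex_of_real (f u)) = 0 \<Longrightarrow> ev (pl i) (\<lambda>u. complex_of_real (f u)) = 0"
  using cnj_ev[of "mi i" "\<lambda>u. complex_of_real (f u)"] by simp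

lemma real_linear_zero:
  assumes f: "linear f" and 0: "\<And>i. ev (mi i) (\<lambda>u. complex_of_real (f u)) = 0"
  shows "f u = 0"
  using frame_expand[OF z e linear_of_real[OF f], of u] 0 ev_real_zero[OF 0] by simp

text \<open>In components this is \<open>eta_rho\<close>.\<close>

lemma nabla_lee_of_lee_vector:
  assumes E: "\<And>y. g z E y = lee z y"
  shows "nabla_lee z u E = 0"
proof (rule real_linear_zero[OF linear_nabla_lee(2)[OF z]])
  fix i
  have "complex_of_real (nabla_lee z u E) = (\<Sum>k\<in>UNIV.
      ev (pl k) (\<lambda>y. complex_of_real (nabla_lee z u y)) * ev (mi k) (\<lambda>y. complex_of_real (lee z y))
    + ev (mi k) (\<lambda>y. complex_of_real (nabla_lee z u y)) * ev (pl k) (\<lambda>y. complex_of_real (lee z y)))" for u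
    using frame_expand[OF z e linear_of_real[OF linear_nabla_lee(1)[OF z]], of u E] unfolding E .
  then have "ev (mi i) (\<lambda>u. complex_of_real (nabla_lee z u E)) = (\<Sum>k\<in>UNIV.
      NLc (mi i) (pl k) * ev (mi k) (\<lambda>y. complex_of_real (lee z y))
    + NLc (mi i) (mi k) * ev (pl k) (\<lambda>y. complex_of_real (lee z y)))"
    by (simp add: ev_simps NLc_def)
  also have "\<dots> = - 4 * cnj (\<Sum>\<^sub>U k. eta k * rho i k)"
    unfolding NLc_table lee_mi cnj_sum sum_distrib_left
    by (intro sum.cong refl) (simp add: rho_cnj)
  finally show "ev (mi i) (\<lambda>u. complex_of_real (nabla_lee z u E)) = 0" by (simp add: eta_rho)
qed

lemma Qc_zero: "Qc v (mi i) (pl j) (mi k) (mi l) = 0" "Qc v (mi i) (mi j) (mi k) (pl l) = 0"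
  using Qc_skew(1)[of v "mi i" "pl j" "mi k" "mi l"] Qc_skew(2)[of v "mi i" "mi j" "mi k" "pl l"]
    Qc_skew(3)[of v "mi i" "mi j" "mi k" "pl l"]  Qc_skew(2)[of v "mi i" "mi j" "pl l" "mi k"]
    Qc_skew(1)[of v "mi i" "pl l" "mi j" "mi k"]
  by (simp_all add: Qc_type)

lemma Qc_table: "Qc (pl i) (mi a) (pl j) (pl k) (mi b) = qc i j k a b" "Qc (pl i) (mi a) (mi b) (pl k) (pl j) = qc i k j a b"
proof -
  show 1: "Qc (pl i) (mi a) (pl j) (pl k) (mi b) = qc i j k a b" for i j k a b
    using Qc_skew(1)[of "pl i" "mi a" "pl j" "pl k" "mi b"] Qc_skew(2)[of "pl i" "pl j" "mi a" "pl k" "mi b"]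
    by (simp add: qc_def)
  show "Qc (pl i) (mi a) (mi b) (pl k) (pl j) = qc i k j a b"
    using Qc_skew(2)[of "pl i" "mi a" "mi b" "pl k" "pl j"] Qc_skew(3)[of "pl i" "mi a" "pl k" "mi b" "pl j"] 1[of i a k j b]
    by simp
qed

text \<open>In components the second derivative of the Lee form is a trace of the second derivative of \<open>H\<close>, and this
  contraction is \<open>divergence_zero\<close>.\<close>

lemma divergence_nabla_lee:
  assumes E: "\<And>y. g z E y = lee z y"
  shows "(\<Sum>\<^sub>U i. ev (pl i) (\<lambda>v. ev (mi i) (\<lambda>u. complex_of_real (nabla2_lee z v u E)))) = 0"
proof -
  have lin: "linear (nabla2_lee z v u)" for v u
    by (rule linearI) (simp_all add: nabla2_lee_def linear_add[OF linear_nabla2_T(2)[OF z]] linear_cmul[OF linear_nabla2_T(2)[OF z]] rtrace_linear)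
  have "complex_of_real (nabla2_lee z v u E) = (\<Sum>k\<in>UNIV.
      ev (pl k) (\<lambda>y. complex_of_real (nabla2_lee z v u y)) * ev (mi k) (\<lambda>y. complex_of_real (lee z y))
    + ev (mi k) (\<lambda>y. complex_of_real (nabla2_lee z v u y)) * ev (pl k) (\<lambda>y. complex_of_real (lee z y)))" for v u
    using frame_expand[OF z e linear_of_real[OF lin], of v u E] unfolding E .
  then have "(\<Sum>\<^sub>U i. ev (pl i) (\<lambda>v. ev (mi i) (\<lambda>u. complex_of_real (nabla2_lee z v u E)))) =
     (\<Sum>\<^sub>U i k.
      ev (pl i) (\<lambda>v. ev (mi i) (\<lambda>u. ev (pl k) (\<lambda>y. complex_of_real (nabla2_lee z v u y)))) * ev (mi k) (\<lambda>y. complex_of_real (lee z y))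
    + ev (pl i) (\<lambda>v. ev (mi i) (\<lambda>u. ev (mi k) (\<lambda>y. complex_of_real (nabla2_lee z v u y)))) * ev (pl k) (\<lambda>y. complex_of_real (lee z y)))"
    by (simp add: ev_simps)
  also have "\<dots> = (\<Sum>\<^sub>U i k. (\<Sum>\<^sub>U j. - (2 * qc i k j i j)) * (\<i> * ev (mi k) (\<lambda>y. complex_of_real (lee z y))))"
  proof (intro sum.cong refl)
    fix i k
    have "(\<Sum>\<^sub>U j. \<i> * Qc (pl i) (mi i) (pl j) (pl k) (mi j) - \<i> * Qc (pl i) (mi i) (mi j) (pl k) (pl j)) = (\<Sum>\<^sub>U j. - (2 * qc i k j i j)) * \<i>"
      unfolding Qc_table sum_distrib_right
    proof (intro sum.cong refl)
      fix j show "\<i> * qc i j k i j - \<i> * qc i k j i j = - (2 * qc i k j i j) * \<i>" by (subst qc_skew) simp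
    qed
    then show "ev (pl i) (\<lambda>v. ev (mi i) (\<lambda>u. ev (pl k) (\<lambda>y. complex_of_real (nabla2_lee z v u y)))) * ev (mi k) (\<lambda>y. complex_of_real (lee z y))
    + ev (pl i) (\<lambda>v. ev (mi i) (\<lambda>u. ev (mi k) (\<lambda>y. complex_of_real (nabla2_lee z v u y)))) * ev (pl k) (\<lambda>y. complex_of_real (lee z y))
     = (\<Sum>\<^sub>U j. - (2 * qc i k j i j)) * (\<i> * ev (mi k) (\<lambda>y. complex_of_real (lee z y)))"
      unfolding nabla2_lee_frame by (simp add: Qc_zero mult.assoc)
  qed
  also have "\<dots> = (\<Sum>\<^sub>U k. (\<Sum>\<^sub>U i j. - (2 * qc i k j i j)) * (\<i> * ev (mi k) (\<lambda>y. complex_of_real (lee z y))))"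
    by (subst sum.swap) (simp add: sum_distrib_right)
  also have "\<dots> = 0"
  proof (intro sum.neutral ballI)
    fix k
    have "(\<Sum>\<^sub>U i j. 2 * qc i k j i j) = 0"
      unfolding two_qc by (rule divergence_zero)
    then have "(\<Sum>\<^sub>U i j. - (2 * qc i k j i j)) = 0" unfolding sum_negf by simp
    then show "(\<Sum>\<^sub>U i j. - (2 * qc i k j i j)) * (\<i> * ev (mi k) (\<lambda>y. complex_of_real (lee z y))) = 0"
      by simp
  qed
  finally show ?thesis .
qed

end

lemma (in bkl_chart) nabla_lee_of_lee_vector_everywhere:
  assumes "w \<in> S" "\<And>y. g w E y = lee w y"
  shows "nabla_lee w u E = 0"
proof -
  obtain e where "unitary w e" using exists_unitary[OF assms(1)] by blast
  then interpret bkl_frame S g G w e by unfold_locales (use assms in auto)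
  show ?thesis by (rule nabla_lee_of_lee_vector[OF assms(2)])
qed

context bkl_frame
begin

text \<open>Differentiate the identity \<open>nabla_lee_of_lee_vector\<close> along the Lee vector field, whose covariant
  derivative \<open>D\<close> is the metric dual of \<open>nabla_lee\<close>, and trace over the frame. The second derivatives of the Lee form drop
  out, and the sum of the squared lengths of \<open>D\<close> on the frame remains.\<close>

lemma rho_vanishes: "rho k i = 0"
proof -
  obtain E where gE: "\<And>w y. w \<in> S \<Longrightarrow> g w (E w) y = lee w y" and dE: "\<And>w. w \<in> S \<Longrightarrow> E differentiable (at w)"
    using lee_vector_exists by blast
  define D where "D u = frechet_derivative E (at z) u + G z u (E z)" for u
  have covE: "has_cov E D z"
    unfolding has_cov_def D_def using dE[OF z] frechet_derivative_works by fastforce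
  have par: "has_cov (par z a) (\<lambda>_. 0) z" for a by (rule has_cov_par[OF z])
  have gD: "g z (D u) y = nabla_lee z u y" for u y
  proof -
    have "((\<lambda>w. g w (E w) (par z y w) - lee w (par z y w)) has_derivative
       (\<lambda>u. g z (D u) (par z y z) + g z (E z) 0 - (nabla_lee z u (par z y z) + lee z 0))) (at z)"
      by (intro has_derivative_diff has_cov_g[OF z covE par] has_derivative_lee[OF z par])
    from has_derivative_zero_on[OF z _ this, of u] gE
    show ?thesis by (simp add: z g_simps[OF z] linear_0[OF linear_lee[OF z]])
  qed
  have key: "nabla2_lee z v u (E z) + g z (D u) (D v) = 0" for v u
  proof -
    have "((\<lambda>w. nabla_lee w (par z u w) (E w)) has_derivative
       (\<lambda>v. nabla2_lee z v (par z u z) (E z) + nabla_lee z 0 (E z) + nabla_lee z (par z u z) (D v))) (at z)"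
      by (rule has_derivative_nabla_lee[OF z par covE])
    from has_derivative_zero_on[OF z _ this, of v] nabla_lee_of_lee_vector_everywhere[OF _ gE]
    show ?thesis by (simp add: z gD linear_0[OF linear_nabla_lee(2)[OF z]])
  qed
  have linD: "D (a + b) = D a + D b" "D (- a) = - D a" for a b
    using has_derivative_linear[OF iffD1[OF frechet_derivative_works dE[OF z]]]
    by (simp_all add: D_def linear_add linear_neg G_simps[OF z])
  have sq: "ev (pl j) (\<lambda>v. ev (mi j) (\<lambda>u. complex_of_real (g z (D u) (D v))))
    = complex_of_real (g z (D (e j)) (D (e j)) + g z (D (Jop (e j))) (D (Jop (e j))))" for j
    using g_sym[OF z, of "D (e j)" "D (Jop (e j))"] by (simp add: ev_def sgi_def algebra_simps)
  have "0 = (\<Sum>\<^sub>U j. ev (pl j) (\<lambda>v. ev (mi j) (\<lambda>u. complex_of_real (nabla2_lee z v u (E z) + g z (D u) (D v)))))"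
    by (simp add: key ev_simps)
  also have "\<dots> = (\<Sum>\<^sub>U j. ev (pl j) (\<lambda>v. ev (mi j) (\<lambda>u. complex_of_real (g z (D u) (D v)))))"
    by (simp add: ev_simps sum.distrib divergence_nabla_lee[OF gE[OF z]])
  also have "\<dots> = complex_of_real (\<Sum>\<^sub>U j. g z (D (e j)) (D (e j)) + g z (D (Jop (e j))) (D (Jop (e j))))"
    by (simp add: sq)
  finally have "(\<Sum>\<^sub>U j. g z (D (e j)) (D (e j)) + g z (D (Jop (e j))) (D (Jop (e j)))) = 0"
    by (rule iffD1[OF of_real_eq_0_iff, OF sym])
  moreover have nn: "g z v v \<ge> 0" for v
    using g_pos[OF z, of v] by (cases "v = 0") (auto simp: g_simps[OF z])
  ultimately have "g z (D (e i)) (D (e i)) + g z (D (Jop (e i))) (D (Jop (e i))) = 0"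
    by (simp add: sum_nonneg_eq_0_iff)
  then have "D (e i) = 0 \<and> D (Jop (e i)) = 0"
    using nn g_pos[OF z] by (smt (verit))
  then have "NLc (mi i) (pl k) = 0"
    unfolding NLc_def gD[symmetric] by (simp add: ev_def g_simps[OF z])
  then show ?thesis by (simp add: NLc_table)
qed

lemma pc_vanishes: "pc x y u w = 0"
  by (rule p_zero[OF rho_vanishes])

lemma Pc_vanishes: "Pc (b1, e x) (b2, e y) (b3, e u) (b4, e w) = 0"
  by (cases b1; cases b2; cases b3; cases b4) (simp_all add: Pc_zero Pc_table pc_vanishes)

end

section \<open>Linear algebra: corank one and eigenvectors\<close>

text \<open>If a row vanishes and some other row depends on the remaining ones, the rows span a space
  of codimension at least two.\<close>

lemma rank_left_kernel:
  fixes M :: "complex^'n^'n::finite"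
  assumes r: "rank M = CARD('n) - 1" and row: "row n0 M = 0" and c: "(\<Sum>\<^sub>U i. c i *s row i M) = 0" and m: "m \<noteq> n0"
  shows "c m = 0"
proof (rule ccontr)
  assume cm: "c m \<noteq> 0"
  let ?R = "(\<lambda>i. row i M) ` (UNIV - {m, n0})"
  have "(\<Sum>\<^sub>U i. c i *s row i M) = c m *s row m M + (\<Sum>i\<in>UNIV - {m}. c i *s row i M)"
    by (rule sum.remove) auto
  then have "c m *s row m M = - (\<Sum>i\<in>UNIV - {m}. c i *s row i M)" using c by (simp add: eq_neg_iff_add_eq_0)
  also have "(\<Sum>i\<in>UNIV - {m}. c i *s row i M) = c n0 *s row n0 M + (\<Sum>i\<in>UNIV - {m} - {n0}. c i *s row i M)"
    by (rule sum.remove) (use m in auto)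
  also have "UNIV - {m} - {n0} = UNIV - {m, n0}" by auto
  finally have "c m *s row m M = - (\<Sum>i\<in>UNIV - {m, n0}. c i *s row i M)" by (simp add: row)
  moreover have "- (\<Sum>i\<in>UNIV - {m, n0}. c i *s row i M) \<in> vec.span ?R"
    by (intro vec.span_neg vec.span_sum vec.span_scale vec.span_base) auto
  ultimately have "inverse (c m) *s (c m *s row m M) \<in> vec.span ?R" by (simp only: vec.span_scale)
  then have rm: "row m M \<in> vec.span ?R" using cm by simp
  have "rows M \<subseteq> vec.span ?R"
  proof
    fix x assume "x \<in> rows M"
    then obtain i where i: "x = row i M" by (auto simp: rows_def)
    consider "i = m" | "i = n0" | "i \<in> UNIV - {m, n0}" by auto
    then show "x \<in> vec.span ?R"
      by cases (auto simp: i rm row vec.span_zero intro: vec.span_base)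
  qed
  then have "vec.dim (rows M) \<le> card ?R" by (intro vec.dim_le_card) auto
  also have "\<dots> \<le> card (UNIV - {m, n0})" by (rule card_image_le) simp
  also have "\<dots> = CARD('n) - 2" using m by (simp add: card_Diff_subset)
  finally have "CARD('n) - 1 \<le> CARD('n) - 2" using r by (simp add: row_rank_def_gen)
  moreover have "CARD('n) \<ge> 2"
    using m card_mono[of UNIV "{m, n0}"] by simp
  ultimately show False by linarith
qed

lemma exists_left_kernel:
  fixes M :: "complex^'n^'n::finite"
  assumes r: "rank M < CARD('n)"
  shows "\<exists>c. (\<Sum>\<^sub>U i. c i *s row i M) = 0 \<and> (\<exists>i. c i \<noteq> 0)"
proof (rule ccontr)
  assume "\<not> ?thesis"
  then have "\<forall>c. (\<Sum>\<^sub>U i. c i *s row i M) = 0 \<longrightarrow> (\<forall>i. c i = 0)" by blast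
  then have "\<exists>B. M ** B = mat 1" by (simp add: matrix_right_invertible_independent_rows)
  then have "\<exists>B. B ** M = mat 1" using matrix_left_right_inverse by blast
  then have "vec.span (rows M) = UNIV" by (simp add: matrix_left_invertible_span_rows_gen)
  then have "rank M = CARD('n)"
    unfolding row_rank_def_gen by (metis vec.dim_span vec_dim_card)
  then show False using r by simp
qed

text \<open>A complex-linear endomorphism has an eigenvector in every nonzero invariant subspace: take a
  polynomial \<open>q\<close> of least degree with \<open>q(L) w = 0\<close> and split off a linear factor.\<close>

lemma eigenvector_in_invariant_subspace:
  fixes L :: "complex^'n::finite \<Rightarrow> complex^'n"
  assumes add: "\<And>x y. L (x + y) = L x + L y" and sc: "\<And>c x. L (c *s x) = c *s L x"
    and W: "vec.subspace W" and inv: "\<And>x. x \<in> W \<Longrightarrow> L x \<in> W" and w: "w \<in> W" "w \<noteq> 0"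
  shows "\<exists>u\<in>W. u \<noteq> 0 \<and> (\<exists>c. L u = c *s u)"
proof -
  define pe where "pe q = (\<Sum>i\<le>degree q. coeff q i *s (L ^^ i) w)" for q :: "complex poly"
  have bound: "pe q = (\<Sum>i\<le>n. coeff q i *s (L ^^ i) w)" if "degree q \<le> n" for q n
    unfolding pe_def using that by (intro sum.mono_neutral_left) (auto simp: coeff_eq_0)
  have L0: "L 0 = 0" using sc[of 0 0] by simp
  have Lsum: "L (\<Sum>i\<in>I. F i) = (\<Sum>i\<in>I. L (F i))" if "finite I" for I :: "nat set" and F
    using that by (induction I rule: finite_induct) (auto simp: add L0)
  have iter: "(L ^^ i) w \<in> W" for i by (induction i) (auto simp: w inv)
  have peW: "pe q \<in> W" for q unfolding pe_def
    by (intro vec.subspace_sum[OF W] vec.subspace_scale[OF W] iter)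
  have factor: "pe ([:- a, 1:] * r) = L (pe r) - a *s pe r" for a r
  proof -
    let ?n = "degree r"
    have pr: "pe r = (\<Sum>i\<le>Suc ?n. coeff r i *s (L ^^ i) w)" by (rule bound) simp
    have d: "degree ([:- a, 1:] * r) \<le> Suc ?n"
      using degree_mult_le[of "[:- a, 1:]" r] by simp
    have c: "coeff ([:- a, 1:] * r) i = (case i of 0 \<Rightarrow> 0 | Suc j \<Rightarrow> coeff r j) - a * coeff r i" for i
      by (simp add: coeff_pCons split: nat.split)
    have "pe ([:- a, 1:] * r) = (\<Sum>i\<le>Suc ?n. (case i of 0 \<Rightarrow> 0 | Suc j \<Rightarrow> coeff r j) *s (L ^^ i) w) - (\<Sum>i\<le>Suc ?n. (a * coeff r i) *s (L ^^ i) w)"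
      unfolding bound[OF d] c by (simp only: vector_sub_rdistrib sum_subtractf)
    also have "(\<Sum>i\<le>Suc ?n. (case i of 0 \<Rightarrow> 0 | Suc j \<Rightarrow> coeff r j) *s (L ^^ i) w) = (\<Sum>i\<le>?n. coeff r i *s L ((L ^^ i) w))"
      by (subst sum.atMost_Suc_shift) simp
    also have "\<dots> = L (pe r)" unfolding pe_def by (simp add: Lsum sc)
    also have "(\<Sum>i\<le>Suc ?n. (a * coeff r i) *s (L ^^ i) w) = a *s pe r"
      unfolding pr vec.scale_sum_right by (simp only: vector_smult_assoc)
    finally show ?thesis .
  qed
  have claim: "pe q = 0 \<Longrightarrow> q \<noteq> 0 \<Longrightarrow> \<exists>u\<in>W. u \<noteq> 0 \<and> (\<exists>c. L u = c *s u)" for q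
  proof (induction "degree q" arbitrary: q rule: less_induct)
    case less
    show ?case
    proof (cases "degree q = 0")
      case True
      then have "coeff q 0 *s w = 0" "coeff q 0 \<noteq> 0"
        using less.prems leading_coeff_0_iff[of q] by (auto simp: pe_def)
      then show ?thesis using w by simp
    next
      case False
      then obtain a where "poly q a = 0"
        using fundamental_theorem_of_algebra[of q] by (auto simp: constant_degree)
      then obtain r where q: "q = [:- a, 1:] * r" by (metis dvdE poly_eq_0_iff_dvd)
      have r: "r \<noteq> 0" using less.prems q by auto
      have dr: "degree r < degree q" unfolding q using r by (subst degree_mult_eq) auto
      show ?thesis
      proof (cases "pe r = 0")
        case True
        then show ?thesis using less.hyps[OF dr] r by blast
      next
        case False
        have "L (pe r) = a *s pe r" using factor[of a r] less.prems q by simp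
        then show ?thesis using False peW by blast
      qed
    qed
  qed
  let ?n = "CARD('n)"
  have "\<exists>q. q \<noteq> 0 \<and> pe q = 0"
  proof (cases "inj_on (\<lambda>i. (L ^^ i) w) {..?n}")
    case False
    then obtain i j where ij: "i \<noteq> j" "(L ^^ i) w = (L ^^ j) w" by (auto simp: inj_on_def)
    define q where "q = monom (1::complex) i - monom 1 j"
    have "coeff q i = 1" using ij by (simp add: q_def)
    then have "q \<noteq> 0" by auto
    moreover have "pe q = 0"
    proof -
      have "degree q \<le> i + j" unfolding q_def
        by (rule order.trans[OF degree_diff_le_max]) (simp add: degree_monom_eq)
      then have "pe q = (\<Sum>k\<le>i + j. (if k = i then (L ^^ i) w else 0) - (if k = j then (L ^^ j) w else 0))"
        unfolding bound[OF \<open>degree q \<le> i + j\<close>] by (intro sum.cong refl) (auto simp: q_def ij)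
      then show ?thesis using ij by (simp add: sum_subtractf)
    qed
    ultimately show ?thesis by blast
  next
    case True
    let ?V = "(\<lambda>i. (L ^^ i) w) ` {..?n}"
    have "card ?V = Suc ?n" using card_image[OF True] by simp
    moreover have "vec.dim ?V \<le> ?n" using vec.dim_subset[of ?V UNIV] by (simp add: vec_dim_card card_cart_basis)
    ultimately have "vec.dependent ?V" using vec.dim_eq_card_independent[of ?V] by fastforce
    then obtain t u where tu: "finite t" "t \<subseteq> ?V" "(\<Sum>v\<in>t. u v *s v) = 0" "\<exists>v\<in>t. u v \<noteq> 0"
      unfolding vec.dependent_explicit by blast
    define I where "I = {i\<in>{..?n}. (L ^^ i) w \<in> t}"
    have tI: "t = (\<lambda>i. (L ^^ i) w) ` I" using tu(2) by (auto simp: I_def)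
    have injI: "inj_on (\<lambda>i. (L ^^ i) w) I" using True by (rule inj_on_subset) (auto simp: I_def)
    define q where "q = (\<Sum>i\<in>I. monom (u ((L ^^ i) w)) i)"
    have fI: "finite I" by (simp add: I_def)
    have cq: "coeff q k = (if k \<in> I then u ((L ^^ k) w) else 0)" for k
      unfolding q_def by (simp add: coeff_sum fI)
    have "degree q \<le> ?n" by (rule degree_le) (auto simp: cq I_def)
    then have "pe q = (\<Sum>k\<le>?n. if k \<in> I then u ((L ^^ k) w) *s (L ^^ k) w else 0)"
      unfolding bound[OF \<open>degree q \<le> ?n\<close>] by (intro sum.cong refl) (auto simp: cq)
    also have "\<dots> = (\<Sum>k\<in>I. u ((L ^^ k) w) *s (L ^^ k) w)"
      by (subst sum.inter_restrict[symmetric]) (auto simp: I_def intro!: sum.cong)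
    also have "\<dots> = (\<Sum>v\<in>t. u v *s v)" unfolding tI by (subst sum.reindex[OF injI]) simp
    finally have "pe q = 0" using tu(3) by simp
    moreover obtain i where "i \<in> I" "u ((L ^^ i) w) \<noteq> 0" using tu(4) tI by auto
    then have "q \<noteq> 0" using cq[of i] by auto
    ultimately show ?thesis by blast
  qed
  then show ?thesis using claim by blast
qed

section \<open>Weights of a complex Lie algebra with a one-dimensional complement of the commutator\<close>

text \<open>Structure constants \<open>t\<close> of the \<open>(1,0)\<close> vectors in a unitary frame that diagonalises \<open>ad e\<^sub>n\<^sub>0\<close>, with \<open>e\<^sub>n\<^sub>0\<close>
  orthogonal to all brackets. The Jacobi identity of the complexified tangent space splits into
  \<open>jacobi10\<close>, for three vectors of type \<open>(1,0)\<close>, and \<open>jacobi11\<close>, where two arguments are conjugated.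
  \<open>B_kernel\<close> says that \<open>e\<^sub>n\<^sub>0\<close> spans the kernel of \<open>B\<close>.\<close>

locale cartan_components =
  fixes t :: "'n::finite \<Rightarrow> 'n \<Rightarrow> 'n \<Rightarrow> complex" and lam :: "'n \<Rightarrow> complex" and n0 :: 'n
  assumes skew: "t k j i = - t k i j"
    and jacobi10: "(\<Sum>\<^sub>U k. t k x y * t w k u + t k y u * t w k x + t k u x * t w k y) = 0"
    and jacobi11: "(\<Sum>\<^sub>U k. t k x y * cnj (t k z w) - t z y k * cnj (t x w k)
        - cnj (t y z k) * t w x k + t z x k * cnj (t y w k) + cnj (t x z k) * t w y k) = 0"
    and diag: "t k n0 j = (if k = j then lam j else 0)"
    and kern: "t n0 i j = 0"
    and B_kernel: "(\<And>j. (\<Sum>\<^sub>U i. c i * (\<Sum>\<^sub>U q k. t j q k * cnj (t i q k))) = 0) \<Longrightarrow> m \<noteq> n0 \<Longrightarrow> c m = 0"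
begin

lemma diag': "t k j n0 = (if k = j then - lam j else 0)"
  using skew[of k j n0] diag[of k j] by simp

lemma lam_n0: "lam n0 = 0"
  using diag[of n0 n0] kern by simp

lemma weight: "t y z w \<noteq> 0 \<Longrightarrow> lam y = lam z + lam w"
proof -
  assume nz: "t y z w \<noteq> 0"
  have "0 = (\<Sum>\<^sub>U k. t k n0 y * cnj (t k z w) - t z y k * cnj (t n0 w k)
        - cnj (t y z k) * t w n0 k + t z n0 k * cnj (t y w k) + cnj (t n0 z k) * t w y k)"
    by (simp add: jacobi11)
  also have "\<dots> = (\<Sum>\<^sub>U k. (if k = y then lam y * cnj (t y z w) else 0) - (if k = w then lam w * cnj (t y z w) else 0)
     + (if k = z then lam z * cnj (t y w z) else 0))"
    by (intro sum.cong refl) (auto simp: diag kern)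
  also have "\<dots> = lam y * cnj (t y z w) - lam w * cnj (t y z w) + lam z * cnj (t y w z)"
    by (simp add: sum.distrib sum_subtractf)
  finally have "lam y * cnj (t y z w) - lam w * cnj (t y z w) + lam z * cnj (t y w z) = 0" by simp
  then have "lam y * cnj (t y z w) - lam w * cnj (t y z w) - lam z * cnj (t y z w) = 0"
    by (simp add: skew[of y w z])
  then have "(lam y - (lam z + lam w)) * cnj (t y z w) = 0" by (simp add: algebra_simps)
  then show ?thesis using nz by (simp only: mult_eq_0_iff complex_cnj_zero_iff) simp
qed

definition eta :: "'n \<Rightarrow> complex" where "eta k = (\<Sum>\<^sub>U x. t x x k)"

text \<open>The trace of \<open>ad\<close> vanishes on commutators.\<close>

lemma eta_commutator: "(\<Sum>\<^sub>U k. eta k * t k x y) = 0"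
proof -
  have "0 = (\<Sum>\<^sub>U w k. t k x y * t w k w + t k y w * t w k x + t k w x * t w k y)"
    by (simp add: jacobi10)
  also have "\<dots> = (\<Sum>\<^sub>U w k. t k x y * t w k w) + (\<Sum>\<^sub>U w k. t k y w * t w k x) + (\<Sum>\<^sub>U w k. t k w x * t w k y)"
    by (simp only: sum.distrib)
  also have "(\<Sum>\<^sub>U w k. t k w x * t w k y) = - (\<Sum>\<^sub>U w k. t k y w * t w k x)"
    unfolding sum_negf[symmetric]
    by (subst sum.swap) (intro sum.cong refl, subst skew, simp)
  also have "(\<Sum>\<^sub>U w k. t k x y * t w k w) = - (\<Sum>\<^sub>U k. eta k * t k x y)"
    unfolding eta_def sum_negf[symmetric] sum_distrib_right
    by (subst sum.swap) (intro sum.cong refl, subst skew, simp)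
  finally show ?thesis by simp
qed

text \<open>By \<open>eta_commutator\<close> the conjugate of \<open>eta\<close> is in the kernel of \<open>B\<close>, which \<open>e\<^sub>n\<^sub>0\<close> spans.\<close>

lemma eta_zero: "m \<noteq> n0 \<Longrightarrow> eta m = 0"
proof -
  assume m: "m \<noteq> n0"
  have "(\<Sum>\<^sub>U i. cnj (eta i) * (\<Sum>\<^sub>U q k. t j q k * cnj (t i q k))) = 0" for j
  proof -
    have "(\<Sum>\<^sub>U i. cnj (eta i) * (\<Sum>\<^sub>U q k. t j q k * cnj (t i q k)))
      = (\<Sum>\<^sub>U i q k. t j q k * cnj (eta i * t i q k))"
      by (simp add: sum_distrib_left mult_ac)
    also have "\<dots> = (\<Sum>\<^sub>U q k i. t j q k * cnj (eta i * t i q k))"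
      by (subst sum.swap) (intro sum.cong refl sum.swap)
    also have "\<dots> = (\<Sum>\<^sub>U q k. t j q k * cnj (\<Sum>\<^sub>U i. eta i * t i q k))"
      by (simp add: sum_distrib_left)
    finally show ?thesis by (simp add: eta_commutator)
  qed
  from B_kernel[of "\<lambda>i. cnj (eta i)", OF this m] show ?thesis by simp
qed

definition ell :: "'n \<Rightarrow> real" where "ell y = - Re (lam y * cnj (eta n0))"

text \<open>The trace of \<open>jacobi11\<close> over \<open>x = z\<close>: the two terms of type \<open>A\<close> cancel, and
  \<open>B\<close> equals the Hermitian part of \<open>ad\<close> of the Lee vector, a multiple of \<open>e\<^sub>n\<^sub>0\<close>.\<close>

lemma B_diagonal:
  "(\<Sum>\<^sub>U q k. t w q k * cnj (t y q k)) = (if y = w then complex_of_real (2 * ell y) else 0)"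
proof -
  have "0 = (\<Sum>\<^sub>U x k. t k x y * cnj (t k x w) - t x y k * cnj (t x w k)
        - cnj (t y x k) * t w x k + t x x k * cnj (t y w k) + cnj (t x x k) * t w y k)"
    by (simp add: jacobi11)
  also have "\<dots> = (\<Sum>\<^sub>U x k. t k x y * cnj (t k x w)) - (\<Sum>\<^sub>U x k. t x y k * cnj (t x w k))
     - (\<Sum>\<^sub>U x k. t w x k * cnj (t y x k)) + (\<Sum>\<^sub>U x k. t x x k * cnj (t y w k))
     + (\<Sum>\<^sub>U x k. cnj (t x x k) * t w y k)"
    by (simp add: sum.distrib sum_subtractf mult.commute)
  also have "(\<Sum>\<^sub>U x k. t k x y * cnj (t k x w)) = (\<Sum>\<^sub>U x k. t x y k * cnj (t x w k))"
  proof (subst sum.swap, intro sum.cong refl)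
    fix a b show "t a b y * cnj (t a b w) = t a y b * cnj (t a w b)" by (simp add: skew[of a b y] skew[of a b w])
  qed
  also have "(\<Sum>\<^sub>U x k. t x x k * cnj (t y w k)) = (\<Sum>\<^sub>U k. eta k * cnj (t y w k))"
    unfolding eta_def sum_distrib_right by (rule sum.swap)
  also have "\<dots> = (\<Sum>\<^sub>U k. if k = n0 then eta n0 * cnj (t y w n0) else 0)"
    by (intro sum.cong refl) (auto simp: eta_zero)
  also have "(\<Sum>\<^sub>U x k. cnj (t x x k) * t w y k) = (\<Sum>\<^sub>U k. cnj (eta k) * t w y k)"
    unfolding eta_def sum_distrib_right cnj_sum by (rule sum.swap)
  also have "\<dots> = (\<Sum>\<^sub>U k. if k = n0 then cnj (eta n0) * t w y n0 else 0)"
    by (intro sum.cong refl) (auto simp: eta_zero)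
  finally have "(\<Sum>\<^sub>U q k. t w q k * cnj (t y q k)) = eta n0 * cnj (t y w n0) + cnj (eta n0) * t w y n0"
    by (simp add: algebra_simps)
  also have "\<dots> = (if y = w then complex_of_real (2 * ell y) else 0)"
    by (auto simp: diag' ell_def complex_eq_iff)
  finally show ?thesis .
qed

lemma ell_pos: assumes y: "y \<noteq> n0" shows "ell y > 0"
proof -
  have "complex_of_real (\<Sum>\<^sub>U q k. (norm (t y q k))\<^sup>2) = complex_of_real (2 * ell y)"
    using B_diagonal[of y y] by (simp add: complex_norm_square[symmetric])
  then have "2 * ell y = (\<Sum>\<^sub>U q k. (norm (t y q k))\<^sup>2)" by (simp only: of_real_eq_iff)
  then have "ell y \<ge> 0" by (smt (verit) sum_nonneg zero_le_power2)
  moreover have "ell y \<noteq> 0"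
  proof
    assume "ell y = 0"
    then have "(\<Sum>\<^sub>U i. (if i = y then 1 else 0) * (\<Sum>\<^sub>U q k. t j q k * cnj (t i q k))) = 0" for j
      unfolding B_diagonal by (auto simp: intro!: sum.neutral)
    from B_kernel[of "\<lambda>i. if i = y then 1 else 0", OF this y] show False by simp
  qed
  ultimately show ?thesis by simp
qed

lemma lam_nonzero: "y \<noteq> n0 \<Longrightarrow> lam y \<noteq> 0"
  using ell_pos[of y] by (auto simp: ell_def)

lemma ell_weight: "t y z w \<noteq> 0 \<Longrightarrow> ell y = ell z + ell w"
  using weight[of y z w] by (simp add: ell_def algebra_simps)

lemma t_diag_zero: "k \<noteq> n0 \<Longrightarrow> t i i k = 0"
  using ell_weight[of i i k] ell_pos[of k] by fastforce

text \<open>The component of \<open>jacobi11\<close> on \<open>e\<^sub>i\<close>, \<open>e\<^sub>j\<close> and their conjugates. It compares the lengths of the brackets of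
  \<open>e\<^sub>i\<close> with \<open>e\<^sub>j\<close> and with the conjugate of \<open>e\<^sub>j\<close>, as the representation theory of \<open>sl(2)\<close> does for root strings.\<close>

lemma norm_identity:
  shows "(\<Sum>\<^sub>U k. (norm (t k i j))\<^sup>2) + 2 * Re (lam i * cnj (lam j))
     = (\<Sum>\<^sub>U k. (norm (t i j k))\<^sup>2 + (norm (t j i k))\<^sup>2)"
proof -
  have z: "t i i k * cnj (t j j k) = (if k = n0 then lam i * cnj (lam j) else 0)" for k
    by (auto simp: t_diag_zero diag')
  have z': "cnj (t i i k) * t j j k = (if k = n0 then cnj (lam i) * lam j else 0)" for k
    by (auto simp: t_diag_zero diag')
  have "0 = (\<Sum>\<^sub>U k. t k i j * cnj (t k i j) - t i j k * cnj (t i j k) - t j i k * cnj (t j i k)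
     + t i i k * cnj (t j j k) + cnj (t i i k) * t j j k)"
    using jacobi11[of i j i j] by (simp add: mult.commute)
  also have "\<dots> = complex_of_real ((\<Sum>\<^sub>U k. (norm (t k i j))\<^sup>2) - (\<Sum>\<^sub>U k. (norm (t i j k))\<^sup>2 + (norm (t j i k))\<^sup>2)
      + 2 * Re (lam i * cnj (lam j)))"
    unfolding z z' complex_norm_square[symmetric]
    by (simp add: sum.distrib sum_subtractf complex_eq_iff)
  finally have "(\<Sum>\<^sub>U k. (norm (t k i j))\<^sup>2) - (\<Sum>\<^sub>U k. (norm (t i j k))\<^sup>2 + (norm (t j i k))\<^sup>2)
      + 2 * Re (lam i * cnj (lam j)) = 0" by (rule iffD1[OF of_real_eq_0_iff, OF sym])
  then show ?thesis by simp
qed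

text \<open>For two equal weights a bracket with the conjugate has weight zero, so the right-hand side of
  \<open>norm_identity\<close> is zero and the left-hand side positive.\<close>

lemma lam_distinct:
  assumes "i \<noteq> n0" "j \<noteq> n0" "lam i = lam j"
  shows "i = j"
proof (rule ccontr)
  assume ij: "i \<noteq> j"
  have "t i j k = 0" "t j i k = 0" for k
  proof -
    show "t i j k = 0"
      using ij assms weight[of i j k] lam_nonzero[of k] diag'[of i j] by (cases "k = n0") auto
    show "t j i k = 0"
      using ij assms weight[of j i k] lam_nonzero[of k] diag'[of j i] by (cases "k = n0") auto
  qed
  then have "(\<Sum>\<^sub>U k. (norm (t k i j))\<^sup>2) + 2 * Re (lam i * cnj (lam i)) = 0"
    using norm_identity[of i j] assms by simp
  moreover have "Re (lam i * cnj (lam i)) > 0" using lam_nonzero[OF assms(1)]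
    by (simp add: complex_neq_0 power2_eq_square)
  moreover have "(\<Sum>\<^sub>U k. (norm (t k i j))\<^sup>2) \<ge> 0" by (simp add: sum_nonneg)
  ultimately show False by linarith
qed

lemma exists_other: "CARD('n) \<ge> 2 \<Longrightarrow> \<exists>k. k \<noteq> n0"
proof (rule ccontr)
  assume card: "CARD('n) \<ge> 2" and "\<nexists>k. k \<noteq> n0"
  then have "(UNIV :: 'n set) \<subseteq> {n0}" by auto
  from card_mono[OF _ this] card show False by simp
qed

lemma adjoint_faithful:
  assumes x: "\<And>q k. (\<Sum>\<^sub>U i. t q i k * x i) = 0" and card: "CARD('n) \<ge> 2"
  shows "x i = 0"
proof -
  have nz: "x q = 0" if "q \<noteq> n0" for q
  proof -
    have "(\<Sum>\<^sub>U i. t q i n0 * x i) = (\<Sum>\<^sub>U i. if i = q then - lam q * x q else 0)"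
      by (intro sum.cong refl) (auto simp: diag')
    then show ?thesis using x[of q n0] lam_nonzero[OF that] by simp
  qed
  obtain k where k: "k \<noteq> n0"
    using exists_other card by auto
  have "(\<Sum>\<^sub>U i. t k i k * x i) = (\<Sum>\<^sub>U i. if i = n0 then lam k * x n0 else 0)"
    by (intro sum.cong refl) (auto simp: diag nz)
  then have "x n0 = 0" using x[of k k] lam_nonzero[OF k] by simp
  then show ?thesis using nz by (cases "i = n0") auto
qed

text \<open>Otherwise the weights \<open>\<lambda>\<^sub>j\<close> with \<open>j\<close> different from \<open>n0\<close> and \<open>a\<close> all lie on the ray orthogonal to
  \<open>\<lambda>\<^sub>a\<close> in the half plane, and there are at least two of them. By \<open>norm_identity\<close> the difference of the
  two smallest is again a weight on this ray, so it is the smallest one; then the corresponding structure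
  constant is of the form \<open>t j2 j1 j1\<close>, which is zero.\<close>

lemma weights_not_on_ray:
  assumes card: "CARD('n) \<ge> 4" and a: "a \<noteq> n0"
    and perp: "\<And>j. j \<noteq> n0 \<Longrightarrow> j \<noteq> a \<Longrightarrow> Re (lam a * cnj (lam j)) = 0"
  shows False
proof -
  define J where "J = UNIV - {a, n0}"
  have "card J = CARD('n) - 2" using a by (simp add: J_def card_Diff_subset)
  then have cJ: "card J \<ge> 2" using card by simp
  then have neJ: "J \<noteq> {}" by auto
  have fJ: "finite J" by simp
  obtain j1 where j1: "j1 \<in> J" "\<And>j. j \<in> J \<Longrightarrow> ell j1 \<le> ell j"
    using arg_min_least[OF fJ neJ, of _ ell] arg_min_if_finite(1)[OF fJ neJ, of ell] by blast
  have neJ1: "J - {j1} \<noteq> {}"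
  proof
    assume "J - {j1} = {}"
    then have "J \<subseteq> {j1}" by auto
    from card_mono[OF _ this] cJ show False by simp
  qed
  obtain j2 where j2: "j2 \<in> J - {j1}" "\<And>j. j \<in> J - {j1} \<Longrightarrow> ell j2 \<le> ell j"
    using arg_min_least[OF finite_Diff[OF fJ] neJ1, of _ ell] arg_min_if_finite(1)[OF finite_Diff[OF fJ] neJ1, of ell] by blast
  have n: "j1 \<noteq> n0" "j1 \<noteq> a" "j2 \<noteq> n0" "j2 \<noteq> a" "j1 \<noteq> j2" using j1 j2 by (auto simp: J_def)
  have la: "lam a \<noteq> 0" by (rule lam_nonzero[OF a])
  (* lam j = i * b j * lam a with b j real; b and ell induce the same order up to the sign of s *)
  define b where "b j = Im (lam j / lam a)" for j
  have lb: "lam j = \<i> * b j * lam a" if "Re (lam a * cnj (lam j)) = 0" for j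
  proof -
    have "Re (lam j / lam a) = 0"
      using that by (simp add: Re_divide mult.commute add.commute)
    then have "lam j / lam a = \<i> * b j" by (simp add: b_def complex_eq_iff)
    then show ?thesis using la by (simp add: field_simps)
  qed
  define s where "s = - Re (\<i> * lam a * cnj (eta n0))"
  have eb: "ell j = b j * s" if "Re (lam a * cnj (lam j)) = 0" for j
    unfolding ell_def by (subst lb[OF that]) (simp add: s_def algebra_simps)
  have e1: "b j1 * s > 0" and e2: "b j2 * s > 0"
    using ell_pos[OF n(1)] ell_pos[OF n(3)] eb perp n by simp_all
  then have bb: "b j1 * b j2 > 0" by (metis zero_less_mult_iff not_less_iff_gr_or_eq mult_less_0_iff)
  have "Re (lam j1 * cnj (lam j2)) = b j1 * b j2 * (norm (lam a))\<^sup>2"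
    unfolding lb[OF perp[OF n(1,2)]] lb[OF perp[OF n(3,4)]] cmod_power2
    by (simp add: power2_eq_square algebra_simps)
  then have "Re (lam j1 * cnj (lam j2)) > 0" using bb la by simp
  moreover have "(\<Sum>\<^sub>U k. (norm (t k j1 j2))\<^sup>2) \<ge> 0" by (simp add: sum_nonneg)
  ultimately have "(\<Sum>\<^sub>U k. (norm (t j1 j2 k))\<^sup>2 + (norm (t j2 j1 k))\<^sup>2) > 0"
    using norm_identity[of j1 j2] by linarith
  then obtain k where k: "t j1 j2 k \<noteq> 0 \<or> t j2 j1 k \<noteq> 0"
    by (metis (no_types, lifting) less_irrefl norm_zero power_zero_numeral add.right_neutral sum.neutral)
  have k0: "k \<noteq> n0" using k n diag' by auto
  have "t j1 j2 k = 0"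
    using ell_weight[of j1 j2 k] ell_pos[OF k0] j1(2)[of j2] j2(1) by fastforce
  then have t21: "t j2 j1 k \<noteq> 0" using k by simp
  have lk: "lam k = lam j2 - lam j1" using weight[OF t21] by simp
  have "Re (lam a * cnj (lam k)) = 0" unfolding lk using perp[OF n(1,2)] perp[OF n(3,4)] by (simp add: algebra_simps)
  then have "k \<noteq> a" using la by (auto simp: complex_neq_0 power2_eq_square)
  then have kJ: "k \<in> J" using k0 by (simp add: J_def)
  have "ell k < ell j2" using ell_weight[OF t21] ell_pos[OF n(1)] by simp
  then have "k = j1" using j2(2)[of k] kJ by force
  then have "t j2 j1 j1 \<noteq> 0" using t21 by simp
  then show False using skew[of j2 j1 j1] by simp
qed

text \<open>Each operator with matrix \<open>r v u\<close> is a derivation; it annihilates \<open>e\<^sub>n\<^sub>0\<close> and therefore commutes with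
  \<open>ad e\<^sub>n\<^sub>0\<close>, so it is diagonal because the weights are distinct. The symmetries of \<open>r\<close> leave only the
  entries with four equal indices. If \<open>r a a a a\<close> is not zero, the derivation that scales
  \<open>e\<^sub>a\<close> alone forces \<open>e\<^sub>a\<close> to have zero brackets with every other \<open>e\<^sub>j\<close> and its conjugate, so by \<open>norm_identity\<close> all other weights are
  orthogonal to \<open>\<lambda>\<^sub>a\<close>.\<close>

lemma kaehler_derivation_zero:
  fixes r :: "'n \<Rightarrow> 'n \<Rightarrow> 'n \<Rightarrow> 'n \<Rightarrow> complex"
  assumes card: "CARD('n) \<ge> 4"
    and sym1: "\<And>x y z w. r x y z w = r z y x w" and cnj_r: "\<And>x y z w. cnj (r x y z w) = r y x w z"
    and der: "\<And>v u i j k. (\<Sum>\<^sub>U m. r v u i m * t k m j + r v u j m * t k i m) = (\<Sum>\<^sub>U m. t m i j * r v u m k)"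
  shows "r x y z w = 0"
proof -
  have sym2: "r x y z w = r x w z y" for x y z w
    using arg_cong[OF sym1[of y x w z], of cnj] by (simp add: cnj_r)
  (* the derivation property on e_n0 and e_j, where the brackets are known *)
  have eq0: "(\<Sum>\<^sub>U m. r v u n0 m * t k m j) + r v u j k * lam k = lam j * r v u j k" for v u j k
  proof -
    have "(\<Sum>\<^sub>U m. r v u j m * t k n0 m) = (\<Sum>\<^sub>U m. if m = k then r v u j k * lam k else 0)"
      by (intro sum.cong refl) (auto simp: diag)
    moreover have "(\<Sum>\<^sub>U m. t m n0 j * r v u m k) = (\<Sum>\<^sub>U m. if m = j then lam j * r v u j k else 0)"
      by (intro sum.cong refl) (auto simp: diag)
    ultimately show ?thesis using der[of v u n0 k j] by (simp add: sum.distrib)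
  qed
  have jn0: "r v u j n0 = 0" if "j \<noteq> n0" for v u j
    using eq0[of v u n0 j] lam_nonzero[OF that] by (simp add: kern lam_n0)
  have n0j: "r v u n0 j = 0" if "j \<noteq> n0" for v u j
    using jn0[OF that, of u v] cnj_r[of u v j n0] by simp
  have first: "(\<Sum>\<^sub>U m. r v u n0 m * t k m j) = (if k = j then r v u n0 n0 * lam j else 0)" for v u k j
  proof -
    have "(\<Sum>\<^sub>U m. r v u n0 m * t k m j) = (\<Sum>\<^sub>U m. if m = n0 then r v u n0 n0 * t k n0 j else 0)"
      by (intro sum.cong refl) (auto simp: n0j)
    then show ?thesis by (simp add: diag)
  qed
  obtain j0 where j0: "j0 \<noteq> n0"
    using exists_other card by auto
  have n0n0: "r v u n0 n0 = 0" for v u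
    using eq0[of v u j0 j0] lam_nonzero[OF j0] by (simp add: first)
  have offdiag: "r v u j k = 0" if "j \<noteq> k \<or> j = n0" for v u j k
  proof (cases "j = n0 \<or> k = n0")
    case True
    then show ?thesis using that jn0 n0j n0n0 by metis
  next
    case False
    have "r v u j k * lam k = lam j * r v u j k"
      using eq0[of v u k j, unfolded first n0n0 mult_zero_left if_cancel] by simp
    then have "(lam j - lam k) * r v u j k = 0" by algebra
    moreover have "lam j \<noteq> lam k" using lam_distinct[of j k] False that by auto
    ultimately show ?thesis by simp
  qed
  have one: "r x y z w = 0" if "\<not> (x = y \<and> y = z \<and> z = w \<and> w \<noteq> n0)" for x y z w
  proof (rule ccontr)
    assume nz: "r x y z w \<noteq> 0"
    have "z = w" "z \<noteq> n0" using nz offdiag by blast+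
    moreover have "x = w" using nz offdiag[of x w z y] sym1[of x y z w] by metis
    moreover have "z = y" using nz offdiag[of z y x w] sym2[of x y z w] by metis
    ultimately show False using that by simp
  qed
  have "r a a a a = 0" if a: "a \<noteq> n0" for a
  proof (rule ccontr)
    assume nz: "r a a a a \<noteq> 0"
    have d: "t k i j = 0" if "(if k = a then 1 else 0) \<noteq> (if i = a then 1 else 0) + (if j = a then 1 else (0::complex))" for i j k
    proof -
      have 1: "(\<Sum>\<^sub>U m. r a a i m * t k m j) = (if i = a then r a a a a * t k i j else 0)"
      proof -
        have "(\<Sum>\<^sub>U m. r a a i m * t k m j) = (\<Sum>\<^sub>U m. if m = a then (if i = a then r a a a a * t k i j else 0) else 0)"
          by (intro sum.cong refl) (auto simp: one)
        then show ?thesis by simp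
      qed
      have 2: "(\<Sum>\<^sub>U m. r a a j m * t k i m) = (if j = a then r a a a a * t k i j else 0)"
      proof -
        have "(\<Sum>\<^sub>U m. r a a j m * t k i m) = (\<Sum>\<^sub>U m. if m = a then (if j = a then r a a a a * t k i j else 0) else 0)"
          by (intro sum.cong refl) (auto simp: one)
        then show ?thesis by simp
      qed
      have 3: "(\<Sum>\<^sub>U m. t m i j * r a a m k) = (if k = a then r a a a a * t k i j else 0)"
      proof -
        have "(\<Sum>\<^sub>U m. t m i j * r a a m k) = (\<Sum>\<^sub>U m. if m = a then (if k = a then r a a a a * t k i j else 0) else 0)"
          by (intro sum.cong refl) (auto simp: one)
        then show ?thesis by simp
      qed
      have "r a a a a * (t k i j * ((if i = a then 1 else 0) + (if j = a then 1 else 0) - (if k = a then 1 else 0))) = 0"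
        using der[of a a i k j] 1 2 3 by (auto simp: sum.distrib algebra_simps split: if_splits)
      then have "t k i j * ((if i = a then 1 else 0) + (if j = a then 1 else 0) - (if k = a then 1 else 0)) = 0"
        using nz by simp
      then show ?thesis using that by (simp del: mult_eq_0_iff)
    qed
    have "Re (lam a * cnj (lam j)) = 0" if j: "j \<noteq> n0" "j \<noteq> a" for j
    proof -
      have "t k a j = 0" for k
        using d[of k a j] ell_weight[of a a j] ell_pos[OF j(1)] j by (cases "k = a") auto
      moreover have "t a j k = 0" for k
        using d[of a j k] ell_weight[of a j a] ell_pos[OF j(1)] j by (cases "k = a") auto
      moreover have "t j a k = 0" for k
        using d[of j a k] diag'[of j a] j by (cases "k = n0") auto
      ultimately show ?thesis using norm_identity[of a j] by simp
    qed
    from weights_not_on_ray[OF card a this] show False .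
  qed
  then show ?thesis using one by metis
qed

end

section \<open>Flatness and faithfulness at a point\<close>

context bkl_frame
begin

lemma complex_linear_zero:
  assumes f: "linear (f :: complex^'n \<Rightarrow> complex)" and 0: "\<And>b i. ev (b, e i) f = 0"
  shows "f u = 0"
  using frame_expand[OF z e f, of u] 0 by simp

lemma linear_ev: "(\<And>u. linear (\<lambda>w. F u w)) \<Longrightarrow> linear (\<lambda>w. ev a (\<lambda>u. F u w :: complex))"
  by (auto simp: ev_def linear_iff algebra_simps)

lemma P_vanishes: "P z u x y w = 0"
proof -
  let ?P = "\<lambda>u x y w. complex_of_real (P z u x y w)"
  have l2: "linear (\<lambda>x. P z u x y w)" and l3: "linear (\<lambda>y. P z u x y w)" for u x y w
    unfolding P_def[abs_def]
    by (rule linear_compose[OF linear_nabla_T(1)[OF z] linear_g(2), unfolded o_def],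
        rule linear_compose[OF linear_nabla_T(2)[OF z] linear_g(2), unfolded o_def])
  have 4: "ev (a, e i) (\<lambda>u. ev (b, e j) (\<lambda>x. ev (c, e k) (\<lambda>y. ?P u x y w))) = 0" for a b c i j k w
  proof (rule complex_linear_zero[where f = "\<lambda>w. ev (a, e i) (\<lambda>u. ev (b, e j) (\<lambda>x. ev (c, e k) (\<lambda>y. ?P u x y w)))"])
    show "linear (\<lambda>w. ev (a, e i) (\<lambda>u. ev (b, e j) (\<lambda>x. ev (c, e k) (\<lambda>y. ?P u x y w))))"
      by (intro linear_ev linear_of_real linear_P4)
    show "ev (d, e l) (\<lambda>w. ev (a, e i) (\<lambda>u. ev (b, e j) (\<lambda>x. ev (c, e k) (\<lambda>y. ?P u x y w)))) = 0" for d l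
      using Pc_vanishes[of a i b j c k d l]
      by (simp add: Pc_def ext4_def ext3_def ev_commute[of "(d, e l)"])
  qed
  have 3: "ev (a, e i) (\<lambda>u. ev (b, e j) (\<lambda>x. ?P u x y w)) = 0" for a b i j y w
  proof (rule complex_linear_zero[where f = "\<lambda>y. ev (a, e i) (\<lambda>u. ev (b, e j) (\<lambda>x. ?P u x y w))"])
    show "linear (\<lambda>y. ev (a, e i) (\<lambda>u. ev (b, e j) (\<lambda>x. ?P u x y w)))"
      by (intro linear_ev linear_of_real l3)
    show "ev (c, e k) (\<lambda>y. ev (a, e i) (\<lambda>u. ev (b, e j) (\<lambda>x. ?P u x y w))) = 0" for c k
      using 4 by (simp add: ev_commute[of "(c, e k)"])
  qed
  have 2: "ev (a, e i) (\<lambda>u. ?P u x y w) = 0" for a i x y w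
  proof (rule complex_linear_zero[where f = "\<lambda>x. ev (a, e i) (\<lambda>u. ?P u x y w)"])
    show "linear (\<lambda>x. ev (a, e i) (\<lambda>u. ?P u x y w))"
      by (intro linear_ev linear_of_real l2)
    show "ev (b, e j) (\<lambda>x. ev (a, e i) (\<lambda>u. ?P u x y w)) = 0" for b j
      using 3 by (simp add: ev_commute[of "(b, e j)"])
  qed
  have "?P u x y w = 0"
    by (rule complex_linear_zero[where f = "\<lambda>u. ?P u x y w"]) (intro linear_of_real linear_P1, rule 2)
  then show ?thesis by simp
qed

end

context bkl_chart
begin

lemma nabla_T_zero:
  assumes z: "z \<in> S"
  shows "nabla_T z u x y = 0"
proof -
  obtain e where "unitary z e" using exists_unitary[OF z] by blast
  then interpret bkl_frame S g G z e by unfold_locales (use z in auto)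
  have "\<forall>w. g z (nabla_T z u x y) w = g z 0 w"
    using P_vanishes by (simp add: P_def g_simps[OF z])
  then show ?thesis using g_eq_iff[OF z] by blast
qed

lemma nabla2_T_zero:
  assumes z: "z \<in> S"
  shows "nabla2_T z v u x y = 0"
proof -
  have "((\<lambda>w. nabla_T w u x y) has_derivative (\<lambda>v. 0)) (at z)"
    by (rule has_derivative_transform_within_open[OF _ open_S z, of "\<lambda>_. 0"]) (auto simp: nabla_T_zero)
  then have "frechet_derivative (\<lambda>w. nabla_T w u x y) (at z) v = 0"
    using frechet_derivative_at by metis
  then show ?thesis by (simp add: nabla2_T_def nabla_T_zero[OF z] G_simps[OF z])
qed

lemma Rop_derivation:
  assumes z: "z \<in> S"
  shows "Rop z v u (torsion_of z x y) = torsion_of z (Rop z v u x) y + torsion_of z x (Rop z v u y)"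
  using ricci_identity_torsion[OF z, of v u x y] by (simp add: nabla2_T_zero[OF z] nabla_T_zero[OF z] algebra_simps)

text \<open>The torsion on vectors of type \<open>(1,0)\<close>, transported to real tangent vectors by \<open>x \<mapsto> x - iJx\<close>; it is
  complex bilinear for the complex structure \<open>J\<close>.\<close>

definition br :: "complex^'n \<Rightarrow> complex^'n \<Rightarrow> complex^'n \<Rightarrow> complex^'n" where
  "br z x y = torsion_of z x y - torsion_of z (Jop x) (Jop y)"

lemma br_simps:
  assumes z: "z \<in> S"
  shows "br z (x + y) w = br z x w + br z y w" "br z w (x + y) = br z w x + br z w y"
    "br z (Jop x) w = Jop (br z x w)" "br z w (Jop x) = Jop (br z w x)"
    "br z (c *s x) w = c *s br z x w" "br z w (c *s x) = c *s br z w x" "br z 0 w = 0" "br z w 0 = 0"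
proof -
  show a: "br z (x + y) w = br z x w + br z y w" for x y w by (simp add: br_def torsion_simps[OF z])
  show b: "br z w (x + y) = br z w x + br z w y" for x y w by (simp add: br_def torsion_simps[OF z])
  show J1: "br z (Jop x) w = Jop (br z x w)" for x w
    unfolding br_def torsion_J[OF z, symmetric] by (simp add: torsion_simps[OF z])
  show J2: "br z w (Jop x) = Jop (br z w x)" for x w
    unfolding br_def torsion_J[OF z, symmetric] by (simp add: torsion_simps[OF z])
  have s1: "br z (r *\<^sub>R x) w = r *\<^sub>R br z x w" and s2: "br z w (r *\<^sub>R x) = r *\<^sub>R br z w x" for r x w
    by (simp_all add: br_def torsion_simps[OF z] scaleR_diff_right)
  show "br z (c *s x) w = c *s br z x w" "br z w (c *s x) = c *s br z w x"
    by (simp_all add: scale_eq a b J1 J2 s1 s2)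
  show "br z 0 w = 0" "br z w 0 = 0" by (simp_all add: br_def torsion_simps[OF z])
qed

lemma br_anti: "br z x w = - br z w x"
  by (simp add: br_def torsion_anti[of z x w] torsion_anti[of z "Jop x"])

text \<open>Half of the curvature operator of \<open>v - iJv\<close> and \<open>u + iJu\<close> on vectors of type \<open>(1,0)\<close>, under the same
  identification.\<close>

definition Zop :: "complex^'n \<Rightarrow> complex^'n \<Rightarrow> complex^'n \<Rightarrow> complex^'n \<Rightarrow> complex^'n" where
  "Zop z v u x = Rop z v u x + Jop (Rop z v (Jop u) x)"

lemma Rop_linear:
  assumes z: "z \<in> S"
  shows "Rop z v u (x + y) = Rop z v u x + Rop z v u y" "Rop z v u (r *\<^sub>R x) = r *\<^sub>R Rop z v u x"
    "Rop z v u (x - y) = Rop z v u x - Rop z v u y"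
  by (simp_all add: Rop_def dG_simps[OF z] G_simps[OF z] scaleR_add_right scaleR_diff_right)

lemma Zop_simps:
  assumes z: "z \<in> S"
  shows "Zop z v u (x + y) = Zop z v u x + Zop z v u y" "Zop z v u (c *s x) = c *s Zop z v u x"
  by (simp_all add: Zop_def Rop_linear[OF z] scale_eq Rop_J[OF z] algebra_simps)

lemma Zop_derivation:
  assumes z: "z \<in> S"
  shows "Zop z v u (br z x y) = br z (Zop z v u x) y + br z x (Zop z v u y)"
proof -
  have R: "Rop z v u (br z x y) = br z (Rop z v u x) y + br z x (Rop z v u y)" for v u x y
    by (simp add: br_def Rop_linear[OF z] Rop_derivation[OF z] Rop_J[OF z])
  show ?thesis by (simp add: Zop_def R br_simps[OF z])
qed

lemma Zop_sym: "z \<in> S \<Longrightarrow> Zop z v u x = Zop z x u v"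
  unfolding Zop_def by (rule kaehler_like)

lemma h_Rop_skew: assumes z: "z \<in> S" shows "h z (Rop z v u x) y = - h z x (Rop z v u y)"
  by (simp add: h_def complex_eq_iff Rop_metric_skew[OF z] Rop_J[OF z])

lemma h_J: assumes z: "z \<in> S" shows "h z (Jop x) y = \<i> * h z x y" "h z x (Jop y) = - \<i> * h z x y"
  using h_simps(5)[OF z, of \<i> x y] h_simps(6)[OF z, of x \<i> y] by (simp_all add: Jop_def)

lemma h_Zop_cnj:
  assumes z: "z \<in> S"
  shows "cnj (h z (Zop z v u x) y) = h z (Zop z u v y) x"
proof -
  have "h z (Zop z v u x) y = - h z x (Rop z v u y) - \<i> * h z x (Rop z v (Jop u) y)"
    by (simp add: Zop_def h_simps[OF z] h_J[OF z] h_Rop_skew[OF z])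
  then have "cnj (h z (Zop z v u x) y) = - h z (Rop z v u y) x + \<i> * h z (Rop z v (Jop u) y) x"
    by (simp add: h_cnj[OF z, of _ x])
  moreover have "h z (Zop z u v y) x = h z (Rop z u v y) x + \<i> * h z (Rop z u (Jop v) y) x"
    by (simp add: Zop_def h_simps[OF z] h_J[OF z])
  moreover have "Rop z u v y = - Rop z v u y" by (rule Rop_skew)
  moreover have "Rop z u (Jop v) y = Rop z v (Jop u) y"
    using Rop_J_right[OF z, of u v y] Rop_skew[of z v "Jop u" y] by simp
  moreover have "h z (- a) x = - h z a x" for a using h_simps(5)[OF z, of "-1" a x] by simp
  ultimately show ?thesis by simp
qed

text \<open>The hypothesis says \<open>R(v,u) = -J R(v,Ju)\<close>. The right-hand side is symmetric in \<open>u\<close> and \<open>v\<close> because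
  \<open>R\<close> is invariant under \<open>J\<close>, the left-hand side is skew.\<close>

lemma Rop_zero_if_Zop_zero:
  assumes z: "z \<in> S" and Z: "\<And>v u x. Zop z v u x = 0"
  shows "Rop z v u x = 0"
proof -
  have a: "Rop z v u x = - Jop (Rop z v (Jop u) x)" for v u using Z[of v u x] by (simp add: Zop_def eq_neg_iff_add_eq_0)
  have "Rop z u v x = - Jop (Rop z u (Jop v) x)" by (rule a)
  also have "Rop z u (Jop v) x = Rop z v (Jop u) x"
    using Rop_J_right[OF z, of u v x] Rop_skew[of z v "Jop u" x] by simp
  also have "- Jop (Rop z v (Jop u) x) = Rop z v u x" by (rule a[symmetric])
  finally have "- Rop z v u x = Rop z v u x" using Rop_skew[of z u v x] by simp
  then have "2 *\<^sub>R Rop z v u x = 0" unfolding scaleR_2 by (metis add.left_inverse)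
  then show ?thesis by simp
qed

end

lemma (in bkl_frame) tc_eq_br: "tc k i j = h z (br z (e i) (e j)) (e k)"
proof -
  have "tc k i j = ev (pl i) (\<lambda>x. ev (pl j) (\<lambda>y. h z (torsion_of z x y) (e k) / 2))"
    unfolding tc_def Hc_def ext3_def H_def ev_g(1)[OF z] by (rule refl)
  also have "\<dots> = (h z (br z (e i) (e j)) (e k) - \<i> * h z (torsion_of z (Jop (e i)) (e j) + torsion_of z (e i) (Jop (e j))) (e k)) / 2"
    by (simp add: ev_def sgi_def br_def h_simps[OF z] algebra_simps add_divide_distrib diff_divide_distrib)
  also have "\<dots> = h z (br z (e i) (e j)) (e k)"
    unfolding torsion_J[OF z] br_def[symmetric] by (simp add: h_J[OF z])
  finally show ?thesis .
qed

lemma (in bkl_frame) tc_jacobi11: "(\<Sum>\<^sub>U k. tc k x y * cnj (tc k v w) - tc v y k * cnj (tc x w k)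
        - cnj (tc y v k) * tc w x k + tc v x k * cnj (tc y w k) + cnj (tc x v k) * tc w y k) = 0"
  using pc_eq[of x y v w] by (simp add: pc_vanishes)

lemma (in bkl_frame) frame_linear:
  assumes "\<And>x y. f (x + y) = f x + f y" "\<And>c x. f (c *s x) = c * f x"
  shows "f x = (\<Sum>\<^sub>U i. h z x (e i) * f (e i))"
proof -
  have f0: "f 0 = 0" using assms(2)[of 0 0] by simp
  have "f (\<Sum>i\<in>I. F i) = (\<Sum>i\<in>I. f (F i))" if "finite I" for I :: "'n set" and F
    using that by (induction I rule: finite_induct) (auto simp: assms f0)
  then have "f (\<Sum>\<^sub>U i. h z x (e i) *s e i) = (\<Sum>\<^sub>U i. h z x (e i) * f (e i))" by (simp add: assms)
  then show ?thesis using unitary_expansion[OF z e, of x] by simp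
qed

context bkl_chart
begin

text \<open>For a unit vector \<open>v\<close> orthogonal to all brackets, one component of the Jacobi identity says that
  \<open>ad v\<close> is a normal operator (the fact \<open>normal\<close>), so each of its eigenvectors is an eigenvector of the adjoint
  operator with the conjugate eigenvalue. Orthogonal complements of eigenvectors are therefore invariant.\<close>

lemma adjoint_eigenvector:
  assumes z: "z \<in> S" and v: "h z v v = 1" and ker: "\<And>x y. h z (br z x y) v = 0"
    and eig: "br z v u = c *s u"
  shows "h z (br z v x) u = c * h z x u"
proof -
  fix n0 :: 'n
  have "\<exists>e. unitary z e \<and> (\<forall>i. (\<lambda>_. True) (e i)) \<and> (\<forall>i\<in>{n0}. e i = v)"
  proof (rule extend_unitary[OF z])
    fix I :: "'n set" and e
    assume "card I < CARD('n)" "\<And>i j. i \<in> I \<Longrightarrow> j \<in> I \<Longrightarrow> h z (e i) (e j) = (if i = j then 1 else 0)"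
    then show "\<exists>v. v \<noteq> 0 \<and> (\<forall>i\<in>I. h z v (e i) = 0) \<and> (\<forall>c. c \<noteq> 0 \<longrightarrow> True)"
      using exists_h_orthogonal[OF z, of I e] by auto
  qed (auto simp: v)
  then obtain e where fr: "unitary z e" "e n0 = v" by auto
  interpret bkl_frame S g G z e by unfold_locales (use z fr in auto)
  have k0: "tc n0 i j = 0" for i j by (simp add: tc_eq_br fr ker)
  have normal: "(\<Sum>\<^sub>U k. tc k n0 y * cnj (tc k n0 w)) = (\<Sum>\<^sub>U k. cnj (tc y n0 k) * tc w n0 k)" for y w
    using tc_jacobi11[of n0 y n0 w] by (simp add: k0 sum_subtractf)
  define b where "b k = h z (e k) u" for k
  define a where "a k = h z (br z v (e k)) u" for k
  have b': "h z u (e k) = cnj (b k)" for k unfolding b_def by (rule h_cnj[OF z])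
  have u: "u = (\<Sum>\<^sub>U k. cnj (b k) *s e k)" using unitary_expansion[OF z fr(1), of u] by (simp add: b')
  have a_eq: "a k = (\<Sum>\<^sub>U w. b w * tc w n0 k)" for k
    unfolding a_def by (subst u) (simp add: h_sum_right[OF z] h_simps[OF z] tc_eq_br fr)
  have Lu: "(\<Sum>\<^sub>U y. cnj (b y) * tc k n0 y) = c * cnj (b k)" for k
  proof -
    have "h z (br z v u) (e k) = (\<Sum>\<^sub>U y. h z u (e y) * h z (br z v (e y)) (e k))"
      by (rule frame_linear) (simp_all add: br_simps[OF z] h_simps[OF z])
    then show ?thesis by (simp add: eig h_simps[OF z] b' tc_eq_br fr)
  qed
  let ?B = "\<Sum>\<^sub>U k. b k * cnj (b k)"
  have 1: "(\<Sum>\<^sub>U k. a k * cnj (a k)) = c * cnj c * ?B"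
  proof -
    have "(\<Sum>\<^sub>U k. a k * cnj (a k)) = (\<Sum>\<^sub>U k w y. b w * cnj (b y) * (cnj (tc y n0 k) * tc w n0 k))"
      unfolding a_eq cnj_sum sum_product by (simp add: mult_ac)
    also have "\<dots> = (\<Sum>\<^sub>U w y k. b w * cnj (b y) * (cnj (tc y n0 k) * tc w n0 k))"
      by (subst sum.swap) (intro sum.cong refl sum.swap)
    also have "\<dots> = (\<Sum>\<^sub>U w y k. b w * cnj (b y) * (tc k n0 y * cnj (tc k n0 w)))"
      unfolding sum_distrib_left[symmetric] normal ..
    also have "\<dots> = (\<Sum>\<^sub>U k w y. b w * cnj (b y) * (tc k n0 y * cnj (tc k n0 w)))"
      by (subst (2) sum.swap) (intro sum.cong refl sum.swap)
    also have "\<dots> = (\<Sum>\<^sub>U k. (\<Sum>\<^sub>U y. cnj (b y) * tc k n0 y) * cnj (\<Sum>\<^sub>U w. cnj (b w) * tc k n0 w))"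
      unfolding cnj_sum sum_product by (subst sum.swap) (simp add: mult_ac)
    also have "\<dots> = c * cnj c * ?B"
      unfolding Lu sum_distrib_left by (simp add: mult_ac)
    finally show ?thesis .
  qed
  have 2: "(\<Sum>\<^sub>U k. a k * cnj (b k)) = c * ?B"
  proof -
    have "h z (br z v u) u = (\<Sum>\<^sub>U k. h z u (e k) * h z (br z v (e k)) u)"
      by (rule frame_linear) (simp_all add: br_simps[OF z] h_simps[OF z])
    moreover have "h z u u = (\<Sum>\<^sub>U k. h z u (e k) * h z (e k) u)"
      by (rule frame_linear) (simp_all add: h_simps[OF z])
    ultimately show ?thesis by (simp add: eig h_simps[OF z] b' a_def[symmetric] b_def[symmetric] mult.commute)
  qed
  have 3: "(\<Sum>\<^sub>U k. b k * cnj (a k)) = cnj c * ?B"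
    using arg_cong[OF 2, of cnj] by (simp add: mult.commute)
  have "(\<Sum>\<^sub>U k. (a k - c * b k) * cnj (a k - c * b k)) = (\<Sum>\<^sub>U k. a k * cnj (a k)) - cnj c * (\<Sum>\<^sub>U k. a k * cnj (b k))
     - c * (\<Sum>\<^sub>U k. b k * cnj (a k)) + c * cnj c * ?B"
    by (simp add: sum_distrib_left sum_subtractf[symmetric] sum.distrib[symmetric] algebra_simps)
  also have "\<dots> = 0" unfolding 1 2 3 by (simp add: algebra_simps)
  finally have "complex_of_real (\<Sum>\<^sub>U k. (norm (a k - c * b k))\<^sup>2) = 0"
    by (simp only: complex_norm_square of_real_sum)
  then have "(\<Sum>\<^sub>U k. (norm (a k - c * b k))\<^sup>2) = 0" by (simp only: of_real_eq_0_iff)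
  then have ab: "a k = c * b k" for k by (simp add: sum_nonneg_eq_0_iff)
  have "h z (br z v x) u = (\<Sum>\<^sub>U k. h z x (e k) * a k)"
    unfolding a_def by (rule frame_linear) (simp_all add: br_simps[OF z] h_simps[OF z])
  also have "\<dots> = c * (\<Sum>\<^sub>U k. h z x (e k) * b k)" by (simp add: ab sum_distrib_left mult_ac)
  also have "(\<Sum>\<^sub>U k. h z x (e k) * b k) = h z x u"
    unfolding b_def by (rule frame_linear[symmetric]) (simp_all add: h_simps[OF z])
  finally show ?thesis .
qed

lemma exists_eigenframe:
  assumes z: "z \<in> S" and v: "h z v v = 1" and ker: "\<And>x y. h z (br z x y) v = 0"
  shows "\<exists>e lam. unitary z e \<and> e n0 = v \<and> (\<forall>j. br z v (e j) = lam j *s e j)"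
proof -
  have "\<exists>e. unitary z e \<and> (\<forall>i. \<exists>c. br z v (e i) = c *s e i) \<and> (\<forall>i\<in>{n0}. e i = v)"
  proof (rule extend_unitary[OF z])
    fix I :: "'n set" and e
    assume I: "card I < CARD('n)" "\<And>i j. i \<in> I \<Longrightarrow> j \<in> I \<Longrightarrow> h z (e i) (e j) = (if i = j then 1 else 0)"
      and eig: "\<And>i. i \<in> I \<Longrightarrow> \<exists>c. br z v (e i) = c *s e i"
    let ?W = "{x. \<forall>i\<in>I. h z x (e i) = 0}"
    obtain w where w: "w \<noteq> 0" "\<forall>i\<in>I. h z w (e i) = 0" using exists_h_orthogonal[OF z I] by auto
    have "\<exists>u\<in>?W. u \<noteq> 0 \<and> (\<exists>c. br z v u = c *s u)"
    proof (rule eigenvector_in_invariant_subspace)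
      show "vec.subspace ?W" by (auto simp: vec.subspace_def h_simps[OF z])
      show "br z v x \<in> ?W" if "x \<in> ?W" for x
      proof
        show "\<forall>i\<in>I. h z (br z v x) (e i) = 0"
        proof
          fix i assume i: "i \<in> I"
          then obtain c where "br z v (e i) = c *s e i" using eig by blast
          from adjoint_eigenvector[OF z v ker this, of x] that i show "h z (br z v x) (e i) = 0" by simp
        qed
      qed
      show "w \<in> ?W" "w \<noteq> 0" using w by auto
    qed (simp_all add: br_simps[OF z])
    then obtain u c where u: "u \<noteq> 0" "\<forall>i\<in>I. h z u (e i) = 0" "br z v u = c *s u" by auto
    have "\<exists>c'. br z v (d *s u) = c' *s (d *s u)" for d
      by (rule exI[of _ c]) (simp add: br_simps[OF z] u vector_smult_assoc mult.commute)
    then show "\<exists>v'. v' \<noteq> 0 \<and> (\<forall>i\<in>I. h z v' (e i) = 0) \<and> (\<forall>d. d \<noteq> 0 \<longrightarrow> (\<exists>c. br z v (d *s v') = c *s (d *s v')))"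
      using u by blast
  next
    have "br z v v = - br z v v" by (rule br_anti)
    then have "2 *\<^sub>R br z v v = 0" unfolding scaleR_2 by (metis add.left_inverse)
    then show "\<exists>c. br z v v = c *s v" by (intro exI[of _ 0]) simp
  qed (auto simp: v)
  then obtain e where e: "unitary z e" "\<forall>i. \<exists>c. br z v (e i) = c *s e i" "e n0 = v" by auto
  from e(2) obtain lam where "\<forall>i. br z v (e i) = lam i *s e i" by metis
  then show ?thesis using e by blast
qed

text \<open>The matrix of \<open>B\<close> in a unitary frame. The factor \<open>-1/2\<close> comes from \<open>T\<^sup>c(e\<^sub>i,e\<^sub>j) = 2 T\<^sup>k\<^sub>i\<^sub>j e\<^sub>k\<close> and from
  the opposite sign of the torsions of the Chern and Bismut connections.\<close>

definition Bmat :: "complex^'n \<Rightarrow> ('n \<Rightarrow> complex^'n) \<Rightarrow> complex^'n^'n" where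
  "Bmat z e = (\<chi> i j. \<Sum>\<^sub>U q k. (- (1/2) * h z (br z (e q) (e k)) (e j)) * cnj (- (1/2) * h z (br z (e q) (e k)) (e i)))"

text \<open>If \<open>c\<close> is in the kernel of \<open>B\<close>, evaluating the quadratic form of \<open>B\<close> on it gives the sum of the squared
  inner products of the brackets with \<open>v = \<Sum> c\<^sub>i e\<^sub>i\<close>.\<close>

lemma exists_B_kernel_vector:
  assumes z: "z \<in> S" and e: "unitary z e" and r: "rank (Bmat z e) < CARD('n)"
  shows "\<exists>v. h z v v = 1 \<and> (\<forall>x y. h z (br z x y) v = 0)"
proof -
  interpret bkl_frame S g G z e by unfold_locales (use z e in auto)
  obtain c m where c: "(\<Sum>\<^sub>U i. c i *s row i (Bmat z e)) = 0" "c m \<noteq> 0" using exists_left_kernel[OF r] by blast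
  define v where "v = (\<Sum>\<^sub>U i. c i *s e i)"
  have hv: "h z x v = (\<Sum>\<^sub>U i. cnj (c i) * h z x (e i))" for x
    by (simp add: v_def h_sum_right[OF z] h_simps[OF z])
  have "h z v (e m) = (\<Sum>\<^sub>U i. c i * (if i = m then 1 else 0))"
    using e by (simp add: v_def h_sum[OF z] h_simps[OF z] unitary_def)
  then have v0: "v \<noteq> 0" using c(2) by (auto simp: h_simps[OF z] if_distrib[of "\<lambda>t. _ * t"] cong: if_cong)
  have cB: "(\<Sum>\<^sub>U i. c i * (\<Sum>\<^sub>U q k. h z (br z (e q) (e k)) (e j) * cnj (h z (br z (e q) (e k)) (e i)))) = 0" for j
  proof -
    define X where "X i = (\<Sum>\<^sub>U q k. h z (br z (e q) (e k)) (e j) * cnj (h z (br z (e q) (e k)) (e i)))" for i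
    have B: "Bmat z e $ i $ j = 1/4 * X i" for i
      by (simp add: Bmat_def X_def sum_distrib_left)
    have "(\<Sum>\<^sub>U i. c i * (1/4 * X i)) = 0"
      using arg_cong[OF c(1), of "\<lambda>x. x $ j"] by (simp add: row_def B)
    then have "1/4 * (\<Sum>\<^sub>U i. c i * X i) = 0"
      unfolding sum_distrib_left by (simp add: mult_ac)
    then show ?thesis by (simp add: X_def)
  qed
  have "(\<Sum>\<^sub>U q k. h z (br z (e q) (e k)) v * cnj (h z (br z (e q) (e k)) v))
     = (\<Sum>\<^sub>U q k j i. cnj (c j) * (c i * (h z (br z (e q) (e k)) (e j) * cnj (h z (br z (e q) (e k)) (e i)))))"
    unfolding hv cnj_sum sum_product by (simp add: mult_ac)
  also have "\<dots> = (\<Sum>\<^sub>U j i q k. cnj (c j) * (c i * (h z (br z (e q) (e k)) (e j) * cnj (h z (br z (e q) (e k)) (e i)))))"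
    unfolding sum4_tuple
    by (rule sum.reindex_bij_witness[of _ "\<lambda>(j, i, q, k). (q, k, j, i)" "\<lambda>(q, k, j, i). (j, i, q, k)"]) auto
  also have "\<dots> = (\<Sum>\<^sub>U j. cnj (c j) * (\<Sum>\<^sub>U i. c i * (\<Sum>\<^sub>U q k. h z (br z (e q) (e k)) (e j) * cnj (h z (br z (e q) (e k)) (e i)))))"
    by (simp add: sum_distrib_left)
  also have "\<dots> = 0" by (simp add: cB)
  finally have "complex_of_real (\<Sum>\<^sub>U q k. (norm (h z (br z (e q) (e k)) v))\<^sup>2) = 0"
    by (simp only: complex_norm_square of_real_sum)
  then have "(\<Sum>\<^sub>U q k. (norm (h z (br z (e q) (e k)) v))\<^sup>2) = 0" by (simp only: of_real_eq_0_iff)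
  then have qk: "h z (br z (e q) (e k)) v = 0" for q k by (simp add: sum_nonneg_eq_0_iff sum_nonneg)
  have xk: "h z (br z x (e k)) v = 0" for x k
  proof -
    have "h z (br z x (e k)) v = (\<Sum>\<^sub>U q. h z x (e q) * h z (br z (e q) (e k)) v)"
      by (rule frame_linear) (simp_all add: br_simps[OF z] h_simps[OF z])
    then show ?thesis by (simp add: qk)
  qed
  have xy: "h z (br z x y) v = 0" for x y
  proof -
    have "h z (br z x y) v = (\<Sum>\<^sub>U q. h z y (e q) * h z (br z x (e q)) v)"
      by (rule frame_linear) (simp_all add: br_simps[OF z] h_simps[OF z])
    then show ?thesis by (simp add: xk)
  qed
  obtain d where "d \<noteq> 0" "h z (d *s v) (d *s v) = 1" using h_normalise[OF z v0] by blast
  then show ?thesis using xy by (intro exI[of _ "d *s v"]) (simp add: h_simps[OF z])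
qed

theorem flat_and_faithful:
  assumes z: "z \<in> S" and card: "CARD('n) \<ge> 4" and rank: "\<And>e. unitary z e \<Longrightarrow> rank (Bmat z e) = CARD('n) - 1"
  shows "Rop z v u w = 0" and "(\<And>y. br z x y = 0) \<Longrightarrow> x = 0"
proof -
  obtain e1 where e1: "unitary z e1" using exists_unitary[OF z] by blast
  have "rank (Bmat z e1) < CARD('n)" using rank[OF e1] card by linarith
  then obtain v0 where v0: "h z v0 v0 = 1" "\<forall>x y. h z (br z x y) v0 = 0"
    using exists_B_kernel_vector[OF z e1] by blast
  fix n0 :: 'n
  obtain e lam where fr: "unitary z e" "e n0 = v0" "\<forall>j. br z v0 (e j) = lam j *s e j"
    using exists_eigenframe[OF z v0(1), of n0] v0(2) by blast
  interpret bkl_frame S g G z e by unfold_locales (use z fr in auto)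
  have kern: "tc n0 i j = 0" for i j using v0(2) by (simp add: tc_eq_br fr)
  have diag: "tc k n0 j = (if k = j then lam j else 0)" for k j
    using fr by (auto simp: tc_eq_br h_simps[OF z] unitary_def)
  have Bm: "Bmat z e $ i $ j = 1/4 * (\<Sum>\<^sub>U q k. tc j q k * cnj (tc i q k))" for i j
    by (simp add: Bmat_def tc_eq_br sum_distrib_left)
  have Bk: "c m = 0"
    if c: "\<And>j. (\<Sum>\<^sub>U i. c i * (\<Sum>\<^sub>U q k. tc j q k * cnj (tc i q k))) = 0" and m: "m \<noteq> n0" for c m
  proof (rule rank_left_kernel[OF rank[OF fr(1)] _ _ m])
    show "row n0 (Bmat z e) = 0" by (simp add: row_def vec_eq_iff Bm kern)
    show "(\<Sum>\<^sub>U i. c i *s row i (Bmat z e)) = 0"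
    proof -
      define X where "X i j = (\<Sum>\<^sub>U q k. tc j q k * cnj (tc i q k))" for i j
      have "(\<Sum>\<^sub>U i. c i * X i j) = 0" for j unfolding X_def by (rule c)
      then have "(\<Sum>\<^sub>U i. 1/4 * (c i * X i j)) = 0" for j unfolding sum_distrib_left[symmetric] by simp
      then show ?thesis by (simp add: vec_eq_iff row_def Bm X_def[symmetric])
    qed
  qed
  interpret cc: cartan_components tc lam n0
    by unfold_locales (rule tc_skew tc_jacobi tc_jacobi11 diag kern | erule (1) Bk)+
  show "Rop z v u w = 0"
  proof (rule Rop_zero_if_Zop_zero[OF z])
    fix v u w
    define r where "r x y a b = h z (Zop z (e x) (e y) (e a)) (e b)" for x y a b
    have r0: "r x y a b = 0" for x y a b
    proof (rule cc.kaehler_derivation_zero[OF card])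
      show "r x y a b = r a y x b" for x y a b by (simp add: r_def Zop_sym[OF z, of "e x"])
      show "cnj (r x y a b) = r y x b a" for x y a b unfolding r_def by (rule h_Zop_cnj[OF z])
      show "(\<Sum>\<^sub>U m. r v u i m * tc k m j + r v u j m * tc k i m) = (\<Sum>\<^sub>U m. tc m i j * r v u m k)" for v u i j k
      proof -
        have 1: "h z (br z (Zop z (e v) (e u) (e i)) (e j)) (e k) = (\<Sum>\<^sub>U m. r v u i m * tc k m j)"
          unfolding r_def tc_eq_br by (rule frame_linear) (simp_all add: br_simps[OF z] h_simps[OF z])
        have 2: "h z (br z (e i) (Zop z (e v) (e u) (e j))) (e k) = (\<Sum>\<^sub>U m. r v u j m * tc k i m)"
          unfolding r_def tc_eq_br by (rule frame_linear) (simp_all add: br_simps[OF z] h_simps[OF z])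
        have 3: "h z (Zop z (e v) (e u) (br z (e i) (e j))) (e k) = (\<Sum>\<^sub>U m. tc m i j * r v u m k)"
          unfolding r_def tc_eq_br by (rule frame_linear) (simp_all add: Zop_simps[OF z] h_simps[OF z])
        show ?thesis
          unfolding sum.distrib 1[symmetric] 2[symmetric] 3[symmetric] Zop_derivation[OF z]
          by (simp add: h_simps[OF z])
      qed
    qed
    have frame0: "x = 0" if "\<And>i. h z x (e i) = 0" for x
      using unitary_expansion[OF z fr(1), of x] by (simp add: that)
    have Z1: "Zop z (e x) (e y) (e a) = 0" for x y a
      by (rule frame0) (use r0 in \<open>simp add: r_def\<close>)
    have Z2: "Zop z (e x) (e y) w = 0" for x y w
    proof (rule frame0)
      fix i
      have "h z (Zop z (e x) (e y) w) (e i) = (\<Sum>\<^sub>U m. h z w (e m) * h z (Zop z (e x) (e y) (e m)) (e i))"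
        by (rule frame_linear) (simp_all add: Zop_simps[OF z] h_simps[OF z])
      then show "h z (Zop z (e x) (e y) w) (e i) = 0" by (simp add: Z1 h_simps[OF z])
    qed
    have Z3: "Zop z v (e y) w = 0" for v y w
    proof (rule frame0)
      fix i
      have "h z (Zop z w (e y) v) (e i) = (\<Sum>\<^sub>U m. h z v (e m) * h z (Zop z w (e y) (e m)) (e i))"
        by (rule frame_linear) (simp_all add: Zop_simps[OF z] h_simps[OF z])
      moreover have "Zop z w (e y) (e m) = 0" for m using Z2 Zop_sym[OF z] by metis
      ultimately show "h z (Zop z v (e y) w) (e i) = 0" using Zop_sym[OF z, of v "e y" w] by (simp add: h_simps[OF z])
    qed
    show "Zop z v u w = 0"
    proof (rule frame0)
      fix i
      have a: "h z (Zop z v u w) (e i) = cnj (h z (Zop z u v (e i)) w)" for u i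
        using h_Zop_cnj[OF z, of u v "e i" w] by simp
      have b: "h z (Zop z u v (e i)) w = h z (Zop z (e i) v u) w" for u using Zop_sym[OF z, of u v "e i"] by simp
      have c: "h z (Zop z (e i) v u) w = (\<Sum>\<^sub>U m. h z u (e m) * h z (Zop z (e i) v (e m)) w)" for u
        by (rule frame_linear) (simp_all add: Zop_simps[OF z] h_simps[OF z])
      have "h z (Zop z (e i) v (e m)) w = cnj (h z (Zop z v (e i) w) (e m))" for m
        using h_Zop_cnj[OF z, of v "e i" w "e m"] by simp
      then have d: "h z (Zop z (e i) v (e m)) w = 0" for m by (simp add: Z3 h_simps[OF z])
      have "h z (Zop z (e i) v u) w = 0" unfolding c[of u] d by simp
      then show "h z (Zop z v u w) (e i) = 0" unfolding a[of u i] b[of u] by simp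
    qed
  qed
  show "x = 0" if "\<And>y. br z x y = 0"
  proof -
    have "h z x (e i) = 0" for i
    proof (rule cc.adjoint_faithful)
      fix q k
      have "h z (br z x (e k)) (e q) = (\<Sum>\<^sub>U i. h z x (e i) * h z (br z (e i) (e k)) (e q))"
        by (rule frame_linear) (simp_all add: br_simps[OF z] h_simps[OF z])
      then show "(\<Sum>\<^sub>U i. tc q i k * h z x (e i)) = 0"
        by (simp add: that tc_eq_br mult.commute h_simps[OF z])
    qed (use card in simp)
    then show ?thesis using unitary_expansion[OF z fr(1), of x] by simp
  qed
qed

end

section \<open>From the global definitions to one chart\<close>

lemma cov_const: "cov \<Gamma> (\<lambda>_. x) (\<lambda>_. u) z = \<Gamma> z x u"
  by (simp add: cov_def)

lemma torsion_eq: "torsion \<Gamma> z x y = \<Gamma> z x y - \<Gamma> z y x"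
  by (simp add: torsion_def cov_const lie_def)

lemma hermitian_connection_chart:
  assumes M: "hermitian_manifold X \<A> g" and conn: "connection \<A> \<Gamma>" and met: "metric_compatible \<A> g \<Gamma>"
    and J: "J_compatible \<A> \<Gamma>" and c: "c \<in> \<A>"
  shows "hermitian_connection (chart_img c) (g c) (\<Gamma> c)"
proof
  show "open (chart_img c)" using M c by (auto simp: hermitian_manifold_def complex_manifold_def)
  fix z assume z: "z \<in> chart_img c"
  have g: "hermitian_metric \<A> g" using M by (simp add: hermitian_manifold_def)
  show "bilinear (g c z)" "g c z u v = g c z v u" "u \<noteq> 0 \<Longrightarrow> g c z u u > 0" "g c z (Jop u) (Jop v) = g c z u v" for u v
    using g c z unfolding hermitian_metric_def by blast+
  show "bilinear (\<Gamma> c z)" using conn c z unfolding connection_def by blast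
  show "frechet_derivative (\<lambda>w. g c w u v) (at z) x = g c z (\<Gamma> c z x u) v + g c z u (\<Gamma> c z x v)" for u v x
    using met c z unfolding metric_compatible_def cov_const by blast
  show "\<Gamma> c z x (Jop v) = Jop (\<Gamma> c z x v)" for x v
    using J c z unfolding J_compatible_def cov_const by blast
next
  show "smooth_on (chart_img c) (\<lambda>z. g c z u v)" for u v
    using M c unfolding hermitian_manifold_def hermitian_metric_def by blast
  show "smooth_on (chart_img c) (\<lambda>z. \<Gamma> c z u v)" for u v
    using conn c unfolding connection_def by blast
qed

lemma type10_iff: "type10 X \<longleftrightarrow> X = (fst X, - Jop (fst X))"
proof
  assume "type10 X"
  then have "Jop (fst X) = - snd X" by (simp add: type10_def ctan_scale_def)
  then show "X = (fst X, - Jop (fst X))" by (simp add: prod_eq_iff)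
next
  assume X: "X = (fst X, - Jop (fst X))"
  show "type10 X" by (subst X, subst type10_def) (simp add: ctan_scale_def)
qed

context hermitian_connection
begin

lemma curv_op_eq: "z \<in> S \<Longrightarrow> curv_op G z x y w = Rop z x y w"
  by (simp add: curv_op_def cov_const lie_def)
     (simp add: cov_def Rop_def dG_def G_simps lie_def)

lemma curv_eq: "z \<in> S \<Longrightarrow> curv g G z x y w v = g z (Rop z x y w) v"
  by (simp add: curv_def curv_op_eq)

lemma Rop_minus:
  assumes z: "z \<in> S"
  shows "Rop z (- x) y w = - Rop z x y w" "Rop z x (- y) w = - Rop z x y w" "Rop z x y (- w) = - Rop z x y w"
  by (simp_all add: Rop_def dG_simps[OF z] G_simps[OF z] linear_neg[OF linear_dG_first[OF z]])

text \<open>The real parts of the two curvature conditions already contain their full content, as the arguments can be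
  multiplied by \<open>J\<close>.\<close>

lemma Re_curv_C:
  assumes z: "z \<in> S"
  shows "Re (curv_C g G z (x, - Jop x) (y, - Jop y) (w, - Jop w) (v, Jop v)) =
     2 * (g z (Rop z x y w) v - g z (Rop z (Jop x) (Jop y) w) v + g z (Rop z x (Jop y) w) (Jop v) + g z (Rop z (Jop x) y w) (Jop v))"
    "Re (curv_C g G z (x, - Jop x) (y, Jop y) (w, - Jop w) (v, Jop v)) =
     2 * (g z (Rop z x y w) v + g z (Rop z (Jop x) (Jop y) w) v - g z (Rop z x (Jop y) w) (Jop v) + g z (Rop z (Jop x) y w) (Jop v))"
  by (simp_all add: curv_C_def cext_def curv_eq[OF z] Rop_minus[OF z] Rop_J[OF z] g_simps[OF z] g_J[OF z] g_J_left[OF z])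

text \<open>The real part of the first condition is the sum of a term that is skew in the last two arguments and
  one that is symmetric in them; both vanish.\<close>

lemma bkl_chartI:
  assumes skew: "\<And>z x y w. z \<in> S \<Longrightarrow> g z (torsion_of z x y) w = - g z (torsion_of z x w) y"
    and c1: "\<And>z X Y Z W. z \<in> S \<Longrightarrow> type10 X \<Longrightarrow> type10 Y \<Longrightarrow> type10 Z \<Longrightarrow> type10 W \<Longrightarrow> curv_C g G z X Y Z (ctan_cnj W) = 0"
    and c2: "\<And>z X Y Z W. z \<in> S \<Longrightarrow> type10 X \<Longrightarrow> type10 Y \<Longrightarrow> type10 Z \<Longrightarrow> type10 W \<Longrightarrow>
       curv_C g G z X (ctan_cnj Y) Z (ctan_cnj W) = curv_C g G z Z (ctan_cnj Y) X (ctan_cnj W)"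
  shows "bkl_chart S g G"
proof
  fix z assume z: "z \<in> S"
  let ?K = "\<lambda>x y w v. g z (Rop z x y w) v"
  have t10: "type10 (x, - Jop x)" for x by (subst type10_iff) simp
  have cj: "ctan_cnj (x, - Jop x) = (x, Jop x)" for x by (simp add: ctan_cnj_def)
  show "g z (torsion_of z x y) w = - g z (torsion_of z x w) y" for x y w by (rule skew[OF z])
  have sk: "?K x y w v = - ?K x y v w" for x y w v
    unfolding Rop_metric_skew[OF z, of x y w v] by (simp add: g_sym[OF z])
  have sy: "?K x y w (Jop v) = ?K x y v (Jop w)" for x y w v
    using sk[of x y w "Jop v"] by (simp add: Rop_J[OF z] g_J_left[OF z])
  have 1: "?K x y w v - ?K (Jop x) (Jop y) w v + ?K x (Jop y) w (Jop v) + ?K (Jop x) y w (Jop v) = 0" for x y w v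
    using c1[OF z t10 t10 t10 t10, of x y w v] Re_curv_C(1)[OF z, of x y w v] by (simp add: cj)
  have JJ: "?K (Jop x) (Jop y) w v = ?K x y w v" for x y w v
    using 1[of x y w v] 1[of x y v w] sk[of x y w v] sk[of "Jop x" "Jop y" w v] sy[of x "Jop y" w v] sy[of "Jop x" y w v]
    by linarith
  show RJJ: "Rop z (Jop x) (Jop y) w = Rop z x y w" for x y w
    using JJ g_eq_iff[OF z] by blast
  have Jm: "Rop z (Jop x) y w = - Rop z x (Jop y) w" for x y w
    using RJJ[of x "Jop y" w] by (simp add: Rop_minus[OF z] minus_equation_iff[of "Rop z (Jop x) y w"])
  show "Rop z x y w + Jop (Rop z x (Jop y) w) = Rop z w y x + Jop (Rop z w (Jop y) x)" for x y w
  proof -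
    have "g z (Rop z x y w + Jop (Rop z x (Jop y) w)) v = g z (Rop z w y x + Jop (Rop z w (Jop y) x)) v" for v
    proof -
      have "Re (curv_C g G z (x, - Jop x) (y, Jop y) (w, - Jop w) (v, Jop v)) = Re (curv_C g G z (w, - Jop w) (y, Jop y) (x, - Jop x) (v, Jop v))"
        using c2[OF z t10 t10 t10 t10, of x y w v] by (simp add: cj)
      then show ?thesis
        unfolding Re_curv_C(2)[OF z] RJJ[of x y] RJJ[of w y] Jm[of x y] Jm[of w y] by (simp add: g_simps[OF z] g_J_left[OF z])
    qed
    then show ?thesis using g_eq_iff[OF z] by blast
  qed
qed

end

text \<open>The difference \<open>d\<close> of the two metric connections is determined by the difference of their torsions
  through the Koszul formula, and it commutes with \<open>J\<close>. As the Bismut torsion \<open>H\<close> is totally skew and the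
  Chern torsion \<open>C\<close> is of type \<open>(2,0)\<close>, the invariance of \<open>d\<close> under \<open>J\<close> says
  \<open>H(Jy,Jw,x) - H(y,w,x) = 2C(y,w,x)\<close>.\<close>

lemma chern_torsion_eq_minus_bismut_torsion:
  assumes b: "hermitian_connection S g Gb" and c: "hermitian_connection S g Gc" and z: "z \<in> S"
    and skew: "\<And>x y w. g z (Gb z x y - Gb z y x) w = - g z (Gb z x w - Gb z w x) y"
    and c11: "\<And>x y. Gc z x y - Gc z y x + (Gc z (Jop x) (Jop y) - Gc z (Jop y) (Jop x)) = 0"
  shows "(Gc z x y - Gc z y x) - (Gc z (Jop x) (Jop y) - Gc z (Jop y) (Jop x))
       = - ((Gb z x y - Gb z y x) - (Gb z (Jop x) (Jop y) - Gb z (Jop y) (Jop x)))"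
proof -
  interpret b: hermitian_connection S g Gb by (rule b)
  interpret c: hermitian_connection S g Gc by (rule c)
  note gs = b.g_simps[OF z]
  define d where "d x y w = g z (Gb z x y - Gc z x y) w" for x y w
  define H where "H x y w = g z (Gb z x y - Gb z y x) w" for x y w
  define C where "C x y w = g z (Gc z x y - Gc z y x) w" for x y w
  have d_skew: "d x y w = - d x w y" for x y w
    using b.g_compat[OF z, of y w x] c.g_compat[OF z, of y w x]
    by (simp add: d_def gs b.g_sym[OF z, of y])
  have HC: "H x y w - C x y w = d x y w - d y x w" for x y w
    by (simp add: H_def C_def d_def gs)
  have H1: "H x y w = - H x w y" for x y w unfolding H_def by (rule skew)
  have H2: "H x y w = - H y x w" for x y w by (simp add: H_def gs)
  have C2: "C x y w = - C y x w" for x y w by (simp add: C_def gs)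
  have dJ: "d x (Jop y) (Jop w) = d x y w" for x y w
    by (simp add: d_def b.G_J[OF z] c.G_J[OF z] b.g_J[OF z] Jop_simps(2)[symmetric] del: Jop_simps)
  have CJ0: "Gc z (Jop x) (Jop y) - Gc z (Jop y) (Jop x) = - (Gc z x y - Gc z y x)" for x y
    using c11[of x y] unfolding add_eq_0_iff .
  have CJ1: "Gc z x (Jop y) - Gc z (Jop y) x = Jop (Gc z x y - Gc z y x)" for x y
  proof -
    have t: "(Gc z (Jop x) y - Gc z y (Jop x)) + (Gc z x (Jop y) - Gc z (Jop y) x)
       = Jop ((Gc z x y - Gc z y x) - (Gc z (Jop x) (Jop y) - Gc z (Jop y) (Jop x)))"
      using c.torsion_J[OF z, of x y] by (simp only: c.torsion_of_def)
    have s: "Gc z (Jop x) y - Gc z y (Jop x) = Gc z x (Jop y) - Gc z (Jop y) x"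
      using CJ0[of x "Jop y"] by (simp add: c.G_simps[OF z] algebra_simps)
    have "2 *\<^sub>R (Gc z x (Jop y) - Gc z (Jop y) x) = 2 *\<^sub>R Jop (Gc z x y - Gc z y x)"
      using t unfolding s CJ0 scaleR_2 diff_minus_eq_add linear_add[OF linear_Jop] .
    then show ?thesis by simp
  qed
  have CJa: "C x (Jop y) (Jop w) = C x y w" for x y w
    unfolding C_def CJ1 by (rule b.g_J[OF z])
  have CJb: "C (Jop x) (Jop y) w = - C x y w" for x y w
    unfolding C_def CJ0 by (simp add: gs)
  have CJc: "C (Jop x) y (Jop w) = C x y w" for x y w
    using CJa[of y x w] C2[of "Jop x" y "Jop w"] C2[of x y w] by simp
  (* Koszul formula; the three terms with H agree, since H is invariant under cyclic permutation *)
  have koszul: "2 * d x y w = H x y w - (C x y w - C y w x + C w x y)" for x y w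
    using HC[of x y w] HC[of y w x] HC[of w x y] d_skew[of x y w] d_skew[of y w x] d_skew[of w x y]
      H1[of x y w] H2[of x y w] H1[of y w x] H2[of y w x] H2[of x w y] H1[of w x y] H2[of w x y]
    by linarith
  have main: "H (Jop y) (Jop w) x - H y w x = 2 * C y w x" for x y w
    using koszul[of x y w] koszul[of x "Jop y" "Jop w"] dJ[of x y w] CJa[of x y w] CJb[of y w x] CJc[of w x y]
      H1[of x y w] H2[of x w y] H1[of w x y] H2[of y w x] H1[of x "Jop y" "Jop w"] H2[of x "Jop w" "Jop y"]
      H1[of "Jop w" x "Jop y"] H2[of "Jop y" "Jop w" x]
    by linarith
  have "g z ((Gc z x y - Gc z y x) - (Gc z (Jop x) (Jop y) - Gc z (Jop y) (Jop x))) v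
      = g z (- ((Gb z x y - Gb z y x) - (Gb z (Jop x) (Jop y) - Gb z (Jop y) (Jop x)))) v" for v
    using main[of x y v] CJb[of x y v] unfolding H_def C_def by (simp add: gs)
  then show ?thesis using b.g_eq_iff[OF z] by blast
qed

lemma ctan_scale_type10: "ctan_scale a (x, - Jop x) = (a *s x, - Jop (a *s (x :: complex^'n::finite)))"
  by (simp add: ctan_scale_def Jop_def vec_eq_iff complex_eq_iff algebra_simps)

lemma sum_type10: "(\<Sum>l\<in>A. (F l, - Jop (F l))) = (\<Sum>l\<in>A. F l, - Jop (\<Sum>l\<in>A. F l :: complex^'n::finite))"
  by (induction A rule: infinite_finite_induct) (auto simp: zero_prod_def)

context hermitian_connection
begin

lemma metric_C_type10: "z \<in> S \<Longrightarrow> metric_C g z (x, - Jop x) (ctan_cnj (y, - Jop y)) = h z x y"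
  by (simp add: metric_C_def cext_def ctan_cnj_def h_def complex_eq_iff g_simps g_J g_J_left)

lemma unitary_frame_iff:
  assumes z: "z \<in> S"
  shows "unitary_frame g z e \<longleftrightarrow> (\<forall>i. e i = (fst (e i), - Jop (fst (e i)))) \<and> unitary z (\<lambda>i. fst (e i))"
proof
  assume u: "unitary_frame g z e"
  then have t: "e i = (fst (e i), - Jop (fst (e i)))" for i using type10_iff unfolding unitary_frame_def by blast
  have "metric_C g z (e i) (ctan_cnj (e j)) = h z (fst (e i)) (fst (e j))" for i j
    by (subst (1 2) t) (rule metric_C_type10[OF z])
  then show "(\<forall>i. e i = (fst (e i), - Jop (fst (e i)))) \<and> unitary z (\<lambda>i. fst (e i))"
    using u t by (auto simp: unitary_frame_def unitary_def)
next
  assume a: "(\<forall>i. e i = (fst (e i), - Jop (fst (e i)))) \<and> unitary z (\<lambda>i. fst (e i))"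
  then have t: "e i = (fst (e i), - Jop (fst (e i)))" for i by blast
  have "metric_C g z (e i) (ctan_cnj (e j)) = h z (fst (e i)) (fst (e j))" for i j
    by (subst (1 2) t) (rule metric_C_type10[OF z])
  then show "unitary_frame g z e"
    using a type10_iff[THEN iffD2, OF t] by (simp add: unitary_frame_def unitary_def)
qed

lemma torsion_C_type10:
  assumes z: "z \<in> S"
  shows "torsion_C G z (x, - Jop x) (y, - Jop y) =
    (torsion_of z x y - torsion_of z (Jop x) (Jop y), - Jop (torsion_of z x y - torsion_of z (Jop x) (Jop y)))"
    "fst (torsion_C G z (x, - Jop x) (ctan_cnj (y, - Jop y))) = torsion_of z x y + torsion_of z (Jop x) (Jop y)"
  unfolding torsion_J[OF z, symmetric]
  by (simp_all add: torsion_C_def cext_vec_def ctan_cnj_def ctan_scale_def torsion_eq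
      torsion_of_def[symmetric] torsion_simps[OF z])

lemma torsion_coeff_eq:
  assumes z: "z \<in> S" and e: "unitary_frame g z e"
    and br: "br' = torsion_of z (fst (e i)) (fst (e j)) - torsion_of z (Jop (fst (e i))) (Jop (fst (e j)))"
  shows "torsion_coeff G z e k i j = h z br' (fst (e k)) / 2"
proof -
  have t: "e l = (fst (e l), - Jop (fst (e l)))" for l
    using e unfolding unitary_frame_iff[OF z] by blast
  have u: "unitary z (\<lambda>i. fst (e i))"
    using e unfolding unitary_frame_iff[OF z] by blast
  have lhs: "torsion_C G z (e i) (e j) = (br', - Jop br')"
    by (subst (1 2) t) (simp only: torsion_C_type10[OF z] br)
  have "ctan_scale (2 * t $ l) (e l) = ((2 * t $ l) *s fst (e l), - Jop ((2 * t $ l) *s fst (e l)))" for t :: "complex^'n" and l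
    by (subst t) (rule ctan_scale_type10)
  then have rhs: "(\<Sum>\<^sub>U l. ctan_scale (2 * t $ l) (e l)) = (\<Sum>\<^sub>U l. (2 * t $ l) *s fst (e l), - Jop (\<Sum>\<^sub>U l. (2 * t $ l) *s fst (e l)))" for t :: "complex^'n"
    by (simp only: sum_type10)
  have "(THE t :: complex^'n. torsion_C G z (e i) (e j) = (\<Sum>\<^sub>U l. ctan_scale (2 * t $ l) (e l))) = (\<chi> l. h z br' (fst (e l)) / 2)"
  proof (rule the_equality)
    show "torsion_C G z (e i) (e j) = (\<Sum>\<^sub>U l. ctan_scale (2 * (\<chi> l. h z br' (fst (e l)) / 2) $ l) (e l))"
      unfolding lhs rhs using unitary_expansion[OF z u, of br'] by simp
  next
    fix t :: "complex^'n"
    assume "torsion_C G z (e i) (e j) = (\<Sum>\<^sub>U l. ctan_scale (2 * t $ l) (e l))"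
    then have b: "br' = (\<Sum>\<^sub>U l. (2 * t $ l) *s fst (e l))" unfolding lhs rhs by simp
    have "h z br' (fst (e m)) = 2 * t $ m" for m
    proof -
      have "h z br' (fst (e m)) = (\<Sum>\<^sub>U l. if l = m then 2 * t $ m else 0)"
        unfolding b h_sum[OF z finite_class.finite_UNIV] h_simps[OF z]
        using u by (intro sum.cong refl) (auto simp: unitary_def)
      then show ?thesis by simp
    qed
    then show "t = (\<chi> l. h z br' (fst (e l)) / 2)" by (simp add: vec_eq_iff)
  qed
  then show ?thesis by (simp add: torsion_coeff_def)
qed

end

theorem theorem2:
  fixes X :: "'a topology"
    and \<A> :: "('a, 'n::finite) chart set"
    and g :: "('a, 'n) chart \<Rightarrow> 'n local_metric"
    and \<Gamma>b \<Gamma>c :: "('a, 'n) chart \<Rightarrow> 'n local_conn"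
  assumes "hermitian_manifold X \<A> g"
    and "CARD('n) \<ge> 4"
    and "bismut_connection \<A> g \<Gamma>b"
    and "chern_connection \<A> g \<Gamma>c"
    and "bismut_kaehler_like \<A> g \<Gamma>b"
    and "has_B_rank \<A> g \<Gamma>c (CARD('n) - 1)"
  shows "bismut_flat \<A> g \<Gamma>b \<and> full \<A> g \<Gamma>c"
proof -
  have chart: "(\<forall>x y w v. curv (g c) (\<Gamma>b c) p x y w v = 0) \<and>
      (\<forall>e. unitary_frame (g c) p e \<longrightarrow> pos_def_hermitian (A_matrix (\<Gamma>c c) p e))"
    if c: "c \<in> \<A>" and p: "p \<in> chart_img c" for c p
  proof -
    interpret b: hermitian_connection "chart_img c" "g c" "\<Gamma>b c"
      by (rule hermitian_connection_chart[OF assms(1) _ _ _ c]) (use assms(3) in \<open>auto simp: bismut_connection_def\<close>)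
    interpret ch: hermitian_connection "chart_img c" "g c" "\<Gamma>c c"
      by (rule hermitian_connection_chart[OF assms(1) _ _ _ c]) (use assms(4) in \<open>auto simp: chern_connection_def\<close>)
    have skew: "g c z (b.torsion_of z x y) w = - g c z (b.torsion_of z x w) y" if z: "z \<in> chart_img c" for z x y w
      using assms(3) c z unfolding bismut_connection_def torsion_eq b.torsion_of_def by blast
    have "bkl_chart (chart_img c) (g c) (\<Gamma>b c)"
      using assms(5) c by (intro b.bkl_chartI skew) (auto simp: bismut_kaehler_like_def)
    then interpret bk: bkl_chart "chart_img c" "g c" "\<Gamma>b c" .
    have c11: "ch.torsion_of p x y + ch.torsion_of p (Jop x) (Jop y) = 0" for x y
    proof -
      have "type10 (x, - Jop x)" "type10 (y, - Jop y)" by (subst type10_iff, simp)+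
      then have "torsion_C (\<Gamma>c c) p (x, - Jop x) (ctan_cnj (y, - Jop y)) = 0"
        using assms(4) c p unfolding chern_connection_def by blast
      then show ?thesis using ch.torsion_C_type10(2)[OF p, of x y] by simp
    qed
    have br: "ch.torsion_of p x y - ch.torsion_of p (Jop x) (Jop y) = - bk.br p x y" for x y
      unfolding bk.br_def ch.torsion_of_def b.torsion_of_def
    proof (rule chern_torsion_eq_minus_bismut_torsion[where S = "chart_img c" and g = "g c"])
      show "hermitian_connection (chart_img c) (g c) (\<Gamma>b c)" "hermitian_connection (chart_img c) (g c) (\<Gamma>c c)" "p \<in> chart_img c"
        by (fact b.hermitian_connection_axioms, fact ch.hermitian_connection_axioms, fact p)
      show "g c p (\<Gamma>b c p x y - \<Gamma>b c p y x) w = - g c p (\<Gamma>b c p x w - \<Gamma>b c p w x) y" for x y w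
        using skew[OF p, of x y w] unfolding b.torsion_of_def .
      show "\<Gamma>c c p x y - \<Gamma>c c p y x + (\<Gamma>c c p (Jop x) (Jop y) - \<Gamma>c c p (Jop y) (Jop x)) = 0" for x y
        using c11[of x y] unfolding ch.torsion_of_def .
    qed
    have coeff: "torsion_coeff (\<Gamma>c c) p e k i j = - (1/2) * b.h p (bk.br p (fst (e i)) (fst (e j))) (fst (e k))"
      if "unitary_frame (g c) p e" for e k i j
      unfolding ch.torsion_coeff_eq[OF p that refl] br
      using b.h_simps(5)[OF p, of "-1" "bk.br p (fst (e i)) (fst (e j))" "fst (e k)"] by simp
    have rank: "rank (bk.Bmat p f) = CARD('n) - 1" if f: "b.unitary p f" for f
    proof -
      define e where "e i = (f i, - Jop (f i))" for i
      have e: "unitary_frame (g c) p e" unfolding b.unitary_frame_iff[OF p] using f by (simp add: e_def)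
      have "B_matrix (\<Gamma>c c) p e = bk.Bmat p f"
        unfolding B_matrix_def bk.Bmat_def coeff[OF e] by (simp add: e_def)
      then show ?thesis using assms(6) c p e unfolding has_B_rank_def by metis
    qed
    note ff = bk.flat_and_faithful[OF p assms(2) rank]
    have "curv (g c) (\<Gamma>b c) p x y w v = 0" for x y w v
      by (simp add: b.curv_eq[OF p] ff(1) b.g_simps[OF p])
    moreover have "pos_def_hermitian (A_matrix (\<Gamma>c c) p e)" if e: "unitary_frame (g c) p e" for e
    proof -
      define T where "T q i k = torsion_coeff (\<Gamma>c c) p e q i k" for q i k
      have A: "A_matrix (\<Gamma>c c) p e $ i $ j = (\<Sum>\<^sub>U q k. T q i k * cnj (T q j k))" for i j
        by (simp add: A_matrix_def T_def)
      have u: "b.unitary p (\<lambda>i. fst (e i))" using e unfolding b.unitary_frame_iff[OF p] by blast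
      interpret fr: bkl_frame "chart_img c" "g c" "\<Gamma>b c" p "\<lambda>i. fst (e i)"
        by unfold_locales (use p u in auto)
      have "Re (\<Sum>\<^sub>U i j. A_matrix (\<Gamma>c c) p e $ i $ j * v $ i * cnj (v $ j)) > 0" if v: "v \<noteq> 0" for v :: "complex^'n"
      proof -
        define a where "a q k = (\<Sum>\<^sub>U i. T q i k * v $ i)" for q k
        have "(\<Sum>\<^sub>U i j. A_matrix (\<Gamma>c c) p e $ i $ j * v $ i * cnj (v $ j))
          = (\<Sum>\<^sub>U i j q k. (T q i k * v $ i) * cnj (T q j k * v $ j))"
          by (simp add: A sum_distrib_left mult_ac)
        also have "\<dots> = (\<Sum>\<^sub>U q k i j. (T q i k * v $ i) * cnj (T q j k * v $ j))"
          unfolding sum4_tuple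
          by (rule sum.reindex_bij_witness[of _ "\<lambda>(q, k, i, j). (i, j, q, k)" "\<lambda>(i, j, q, k). (q, k, i, j)"]) auto
        also have "\<dots> = (\<Sum>\<^sub>U q k. a q k * cnj (a q k))"
          by (simp add: a_def sum_product)
        also have "\<dots> = complex_of_real (\<Sum>\<^sub>U q k. (norm (a q k))\<^sup>2)"
          by (simp only: complex_norm_square of_real_sum)
        finally have eq: "Re (\<Sum>\<^sub>U i j. A_matrix (\<Gamma>c c) p e $ i $ j * v $ i * cnj (v $ j)) = (\<Sum>\<^sub>U q k. (norm (a q k))\<^sup>2)"
          by simp
        have nn: "(\<Sum>\<^sub>U q k. (norm (a q k))\<^sup>2) \<ge> 0" by (simp add: sum_nonneg)
        have "(\<Sum>\<^sub>U q k. (norm (a q k))\<^sup>2) \<noteq> 0"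
        proof
          assume "(\<Sum>\<^sub>U q k. (norm (a q k))\<^sup>2) = 0"
          then have a0: "a q k = 0" for q k by (simp add: sum_nonneg_eq_0_iff sum_nonneg)
          define x where "x = (\<Sum>\<^sub>U i. v $ i *s fst (e i))"
          have hx: "b.h p x (fst (e m)) = v $ m" for m
          proof -
            have "b.h p x (fst (e m)) = (\<Sum>\<^sub>U i. if i = m then v $ m else 0)"
              unfolding x_def b.h_sum[OF p finite_class.finite_UNIV] b.h_simps[OF p]
              using u by (intro sum.cong refl) (auto simp: b.unitary_def)
            then show ?thesis by simp
          qed
          have frame0: "w = 0" if "\<And>i. b.h p w (fst (e i)) = 0" for w
            using b.unitary_expansion[OF p u, of w] by (simp add: that)
          have k0: "bk.br p x (fst (e k)) = 0" for k
          proof (rule frame0)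
            fix q
            have "b.h p (bk.br p x (fst (e k))) (fst (e q)) = (\<Sum>\<^sub>U i. b.h p x (fst (e i)) * b.h p (bk.br p (fst (e i)) (fst (e k))) (fst (e q)))"
              by (rule fr.frame_linear) (simp_all add: bk.br_simps[OF p] b.h_simps[OF p])
            also have "\<dots> = - 2 * a q k"
              by (simp add: hx a_def T_def coeff[OF e] sum_distrib_left sum_negf[symmetric] mult_ac)
            finally show "b.h p (bk.br p x (fst (e k))) (fst (e q)) = 0" by (simp add: a0)
          qed
          have brx: "bk.br p x y = 0" for y
          proof (rule frame0)
            fix q
            have "b.h p (bk.br p x y) (fst (e q)) = (\<Sum>\<^sub>U i. b.h p y (fst (e i)) * b.h p (bk.br p x (fst (e i))) (fst (e q)))"
              by (rule fr.frame_linear) (simp_all add: bk.br_simps[OF p] b.h_simps[OF p])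
            then show "b.h p (bk.br p x y) (fst (e q)) = 0" by (simp add: k0 b.h_simps[OF p])
          qed
          have "x = 0" by (rule ff(2)) (assumption, rule brx)
          have "v $ m = 0" for m using hx[of m] unfolding \<open>x = 0\<close> b.h_simps[OF p] by simp
          then have "v = 0" by (simp add: vec_eq_iff)
          then show False using v by simp
        qed
        then show ?thesis unfolding eq using nn by linarith
      qed
      moreover have "A_matrix (\<Gamma>c c) p e $ j $ i = cnj (A_matrix (\<Gamma>c c) p e $ i $ j)" for i j
        by (simp add: A mult.commute)
      ultimately show ?thesis unfolding pos_def_hermitian_def by blast
    qed
    ultimately show ?thesis by blast
  qed
  then show ?thesis by (simp add: bismut_flat_def full_def)
qed

end
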